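(* Let $K$ be a colorable seed with vertex set $[m]$, and let $$\mathcal{X}_K=\{(L,\lambda^{\mathbb{R}}) \mid L=K(J)\text{ for some } J,\ \lambda^{\mathbb{R}}\text{ is a mod }2\text{ characteristic map over }L\},$$ where $J$ ranges over $m$-tuples of positive integers. For a property $\mathcal{P}$, suppose that the following hold: 1. (Basis step) For any $m$-tuple $J$ of positive integers and any quasi-injective mod $2$ dual characteristic map $\overline{\lambda^{\mathbb{R}}}$ over $K(J)$, the pair $(K(J),\lambda^{\mathbb{R}})$ satisfies $\mathcal{P}$. 2. (Inductive step) If $(L,\lambda^{\mathbb{R}})\in\mathcal{X}_K$ satisfies $\mathcal{P}$, then so does the pair consisting of the wedge $\mathrm{Wed}_v(L)$ of $L$ at $v$ and the canonical extension of $\lambda^{\mathbb{R}}$ at $v$, for any vertex $v$ of $L$. Then $\mathcal{P}$ holds on $\mathcal{X}_K$, i.e. every element of $\mathcal{X}_K$ satisfies $\mathcal{P}$.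
   Context: A PL sphere is a simplicial complex PL homeomorphic to the boundary of a simplex. The wedge of a simplicial complex $K$ at a vertex $v$ is $\mathrm{Wed}_v(K)=(I*\mathrm{Lk}_K(v))\cup(\partial I*(K\setminus v))$, where $I$ is a $1$-simplex on two new vertices $v_1,v_2$, $*$ is the join, $\mathrm{Lk}_K(v)$ is the link and $K\setminus v=\{\tau\in K: v\notin\tau\}$. A seed is a PL sphere not isomorphic to a wedge of another PL sphere. For an $m$-tuple $J=(j_1,\dots,j_m)$ of positive integers and $K$ with vertex set $[m]=\{1,\dots,m\}$, $K(J)$ is the complex obtained from $K$ by performing $j_i-1$ wedge operations at $i$ or its copies for each $i$; equivalently, $K(J)$ is the complex on vertices $i_k$ ($1\le i\le m$, $1\le k\le j_i$) whose minimal non-faces are the sets $\{i_k : i\in\eta,\,1\le k\le j_i\}$ for $\eta$ a minimal non-face of $K$. For an $(n-1)$-dimensional complex $L$ with vertex set $V$, $|V|=\ell$, a mod $2$ characteristic map over $L$ is a map $\lambda^{\mathbb{R}}:V\to\mathbb{Z}_2^n$ such that the images of the vertices of each simplex are linearly independent; it is regarded as an $n\times \ell$ matrix whose columns are the $\lambda^{\mathbb{R}}(v)$. Two such maps are D-J equivalent (Davis-Januszkiewicz equivalent) if one is obtained from the other by row operations. The dual $\overline{\lambda^{\mathbb{R}}}$ (a mod $2$ dual characteristic map over $L$) is an $\ell\times(\ell-n)$ matrix whose columns form a basis of $\ker\lambda^{\mathbb{R}}$, and $\overline{\lambda^{\mathbb{R}}}(v)\in\mathbb{Z}_2^{\ell-n}$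 denotes its row indexed by $v$; it is well defined up to column operations. A PL sphere is colorable if it admits a mod $2$ characteristic map. A pair $\{v,w\}$ of vertices of $L$ is a suspended pair if $L=\partial I*L'$, where $I$ is the $1$-simplex on $\{v,w\}$, for some complex $L'$. The map $\overline{\lambda^{\mathbb{R}}}$ is quasi-injective if $\overline{\lambda^{\mathbb{R}}}(v)=\overline{\lambda^{\mathbb{R}}}(w)$ with $v\ne w$ implies that $\{v,w\}$ is a suspended pair of $L$. Canonical extension: given $\lambda^{\mathbb{R}}$ over $L$ and a vertex $v$, up to D-J equivalence and relabeling of vertices one can write $\lambda^{\mathbb{R}}=\begin{bmatrix}1&0&\mathbf{a}\\0&I_{n-1}&A\end{bmatrix}$ with first column indexed by $v$. The canonical extension of $\lambda^{\mathbb{R}}$ at $v$ is the mod $2$ characteristic map over $\mathrm{Wed}_v(L)$ given by $\begin{bmatrix}1&0&0&\mathbf{a}\\0&1&0&\mathbf{a}\\0&0&I_{n-1}&A\end{bmatrix}$, with first two columns indexed by $v_1,v_2$ and the others as before. *)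

theory Defs
  imports
    "HOL-Analysis.Analysis"
    "HOL-Library.Function_Algebras"
    "HOL-Library.Z2"
begin

section \<open>Abstract simplicial complexes\<close>

type_synonym 'v cpx = "'v set set"

definition simplicial_cpx :: "'v cpx \<Rightarrow> bool" where
  "simplicial_cpx K \<longleftrightarrow> finite K \<and> (\<forall>\<sigma>\<in>K. finite \<sigma>) \<and> {} \<in> K \<and> (\<forall>\<sigma>\<in>K. \<forall>\<tau>. \<tau> \<subseteq> \<sigma> \<longrightarrow> \<tau> \<in> K)"

abbreviation verts :: "'v cpx \<Rightarrow> 'v set" where
  "verts K \<equiv> \<Union>K"

text \<open>The dimension plus one, i.e. the \<open>n\<close> of an \<open>(n - 1)\<close>-dimensional complex.\<close>
definition rk :: "'v cpx \<Rightarrow> nat" where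
  "rk K = Max (card ` K)"

definition isomorphic :: "'v cpx \<Rightarrow> 'w cpx \<Rightarrow> bool" where
  "isomorphic K L \<longleftrightarrow> (\<exists>\<phi>. bij_betw \<phi> (verts K) (verts L) \<and> L = (\<lambda>\<sigma>. \<phi> ` \<sigma>) ` K)"

definition join :: "'v cpx \<Rightarrow> 'v cpx \<Rightarrow> 'v cpx" where
  "join K L = {\<sigma> \<union> \<tau> |\<sigma> \<tau>. \<sigma> \<in> K \<and> \<tau> \<in> L}"

definition link :: "'v cpx \<Rightarrow> 'v \<Rightarrow> 'v cpx" where
  "link K v = {\<tau>. v \<notin> \<tau> \<and> insert v \<tau> \<in> K}"

definition deletion :: "'v cpx \<Rightarrow> 'v \<Rightarrow> 'v cpx" where
  "deletion K v = {\<tau> \<in> K. v \<notin> \<tau>}"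

abbreviation full_simplex :: "'v set \<Rightarrow> 'v cpx" where
  "full_simplex W \<equiv> Pow W"

definition simplex_boundary :: "'v set \<Rightarrow> 'v cpx" where
  "simplex_boundary W = {\<sigma>. \<sigma> \<subset> W}"

definition wedge :: "'v cpx \<Rightarrow> 'v \<Rightarrow> 'v \<Rightarrow> 'v \<Rightarrow> 'v cpx" where
  "wedge K v v1 v2 =
     join (full_simplex {v1, v2}) (link K v) \<union> join (simplex_boundary {v1, v2}) (deletion K v)"

definition new_pair :: "'v cpx \<Rightarrow> 'v \<Rightarrow> 'v \<Rightarrow> bool" where
  "new_pair K v1 v2 \<longleftrightarrow> v1 \<noteq> v2 \<and> v1 \<notin> verts K \<and> v2 \<notin> verts K"

definition min_nonfaces :: "'v cpx \<Rightarrow> 'v set set" where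
  "min_nonfaces K = {\<eta>. \<eta> \<subseteq> verts K \<and> \<eta> \<notin> K \<and> (\<forall>\<tau>. \<tau> \<subset> \<eta> \<longrightarrow> \<tau> \<in> K)}"

text \<open>\<open>copies J \<eta>\<close> is the set of all vertices \<open>i\<^sub>k\<close>, encoded as pairs \<open>(i, k)\<close>,
  with \<open>i \<in> \<eta>\<close> and \<open>1 \<le> k \<le> J i\<close>;
  \<open>K_of K J\<close> is the complex \<open>K(J)\<close>, given by its minimal non-faces.\<close>
definition copies :: "('v \<Rightarrow> nat) \<Rightarrow> 'v set \<Rightarrow> ('v \<times> nat) set" where
  "copies J \<eta> = {(i, k). i \<in> \<eta> \<and> 1 \<le> k \<and> k \<le> J i}"

definition K_of :: "'v cpx \<Rightarrow> ('v \<Rightarrow> nat) \<Rightarrow> ('v \<times> nat) cpx" where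
  "K_of K J = {\<sigma>. \<sigma> \<subseteq> copies J (verts K) \<and> (\<forall>\<eta> \<in> min_nonfaces K. \<not> copies J \<eta> \<subseteq> \<sigma>)}"

definition suspended_pair :: "'v cpx \<Rightarrow> 'v \<Rightarrow> 'v \<Rightarrow> bool" where
  "suspended_pair L v w \<longleftrightarrow> v \<noteq> w \<and>
     (\<exists>L'. simplicial_cpx L' \<and> v \<notin> verts L' \<and> w \<notin> verts L' \<and> L = join (simplex_boundary {v, w}) L')"

section \<open>PL spheres and seeds\<close>

text \<open>The geometric realization of a complex with vertices of type \<open>'v\<close> lives in \<open>'v \<Rightarrow> real\<close>
  with pointwise operations and the product topology.\<close>

instantiation "fun" :: (type, real_vector) real_vector
begin

definition scaleR_fun :: "real \<Rightarrow> ('a \<Rightarrow> 'b) \<Rightarrow> 'a \<Rightarrow> 'b" where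
  "scaleR_fun r f = (\<lambda>x. r *\<^sub>R f x)"

instance
  by standard (auto simp: scaleR_fun_def fun_eq_iff scaleR_add_right scaleR_add_left)

end

definition vertex_pt :: "'v \<Rightarrow> 'v \<Rightarrow> real" where
  "vertex_pt v = (\<lambda>x. if x = v then 1 else 0)"

definition cell :: "'v set \<Rightarrow> ('v \<Rightarrow> real) set" where
  "cell \<sigma> = convex hull (vertex_pt ` \<sigma>)"

definition realization :: "'v cpx \<Rightarrow> ('v \<Rightarrow> real) set" where
  "realization K = (\<Union>\<sigma>\<in>K. cell \<sigma>)"

text \<open>A geometric simplicial complex is represented by the vertex sets of its simplices.\<close>
definition geometric_cpx :: "('v \<Rightarrow> real) set set \<Rightarrow> bool" where
  "geometric_cpx T \<longleftrightarrow> simplicial_cpx T \<and> (\<forall>S\<in>T. \<not> affine_dependent S) \<and>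
     (\<forall>S\<in>T. \<forall>S'\<in>T. convex hull S \<inter> convex hull S' = convex hull (S \<inter> S'))"

definition subdivision_of :: "('v \<Rightarrow> real) set set \<Rightarrow> 'v cpx \<Rightarrow> bool" where
  "subdivision_of T K \<longleftrightarrow> geometric_cpx T \<and> (\<Union>S\<in>T. convex hull S) = realization K \<and>
     (\<forall>S\<in>T. \<exists>\<sigma>\<in>K. convex hull S \<subseteq> cell \<sigma>)"

definition affine_map_on :: "'a::real_vector set \<Rightarrow> ('a \<Rightarrow> 'b::real_vector) \<Rightarrow> bool" where
  "affine_map_on C f \<longleftrightarrow>
     (\<forall>x\<in>C. \<forall>y\<in>C. \<forall>t\<in>{0..1}. f ((1 - t) *\<^sub>R x + t *\<^sub>R y) = (1 - t) *\<^sub>R f x + t *\<^sub>R f y)"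

definition PL_on :: "'v cpx \<Rightarrow> (('v \<Rightarrow> real) \<Rightarrow> ('w \<Rightarrow> real)) \<Rightarrow> bool" where
  "PL_on K f \<longleftrightarrow> (\<exists>T. subdivision_of T K \<and> (\<forall>S\<in>T. affine_map_on (convex hull S) f))"

definition PL_homeomorphic :: "'v cpx \<Rightarrow> 'w cpx \<Rightarrow> bool" where
  "PL_homeomorphic K L \<longleftrightarrow>
     (\<exists>f g. homeomorphism (realization K) (realization L) f g \<and> PL_on K f \<and> PL_on L g)"

definition PL_sphere :: "'v cpx \<Rightarrow> bool" where
  "PL_sphere K \<longleftrightarrow> simplicial_cpx K \<and> (\<exists>d::nat. PL_homeomorphic K (simplex_boundary {..d}))"

text \<open>Complexes being finite, it is no restriction that \<open>M\<close> has natural numbers as vertices.\<close>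
definition seed :: "'v cpx \<Rightarrow> bool" where
  "seed K \<longleftrightarrow> PL_sphere K \<and>
     \<not> (\<exists>(M :: nat cpx) v v1 v2. PL_sphere M \<and> v \<in> verts M \<and> new_pair M v1 v2 \<and>
          isomorphic K (wedge M v v1 v2))"

section \<open>Mod 2 characteristic maps\<close>

text \<open>A vector over \<open>\<int>\<^sub>2\<close> with index set \<open>I\<close> is a function vanishing outside \<open>I\<close>. A characteristic map
  (and likewise a dual one) is a function from vertices to vectors, zero outside the vertex set;
  so \<open>\<Lambda> v i\<close> is the matrix entry in row \<open>i\<close> and column \<open>v\<close>. Rows are numbered from \<open>0\<close>.\<close>

definition Z2_scale :: "bit \<Rightarrow> ('i \<Rightarrow> bit) \<Rightarrow> 'i \<Rightarrow> bit" where
  "Z2_scale c x = (\<lambda>i. c * x i)"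

global_interpretation Z2: vector_space "Z2_scale :: bit \<Rightarrow> ('i \<Rightarrow> bit) \<Rightarrow> 'i \<Rightarrow> bit"
  by standard (auto simp: Z2_scale_def fun_eq_iff distrib_left distrib_right mult.assoc)

definition Z2_vec :: "'i set \<Rightarrow> ('i \<Rightarrow> bit) set" where
  "Z2_vec I = {x. \<forall>i. i \<notin> I \<longrightarrow> x i = 0}"

definition unit_vec :: "nat \<Rightarrow> nat \<Rightarrow> bit" where
  "unit_vec i = (\<lambda>k. if k = i then 1 else 0)"

definition indep_family :: "'a set \<Rightarrow> ('a \<Rightarrow> 'i \<Rightarrow> bit) \<Rightarrow> bool" where
  "indep_family A x \<longleftrightarrow> inj_on x A \<and> Z2.independent (x ` A)"

definition char_map :: "'v cpx \<Rightarrow> ('v \<Rightarrow> nat \<Rightarrow> bit) \<Rightarrow> bool" where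
  "char_map L \<Lambda> \<longleftrightarrow> (\<forall>v\<in>verts L. \<Lambda> v \<in> Z2_vec {..<rk L}) \<and> (\<forall>v. v \<notin> verts L \<longrightarrow> \<Lambda> v = 0) \<and>
     (\<forall>\<sigma>\<in>L. indep_family \<sigma> \<Lambda>)"

definition colorable :: "'v cpx \<Rightarrow> bool" where
  "colorable L \<longleftrightarrow> (\<exists>\<Lambda>. char_map L \<Lambda>)"

text \<open>Over \<open>\<int>\<^sub>2\<close> the elementary row operations are row additions and row swaps.\<close>
inductive row_op :: "nat \<Rightarrow> ('v \<Rightarrow> nat \<Rightarrow> bit) \<Rightarrow> ('v \<Rightarrow> nat \<Rightarrow> bit) \<Rightarrow> bool" for n where
  add: "i < n \<Longrightarrow> j < n \<Longrightarrow> i \<noteq> j \<Longrightarrow> row_op n \<Lambda> (\<lambda>v. (\<Lambda> v)(i := \<Lambda> v i + \<Lambda> v j))"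
| swap: "i < n \<Longrightarrow> j < n \<Longrightarrow> row_op n \<Lambda> (\<lambda>v. (\<Lambda> v)(i := \<Lambda> v j, j := \<Lambda> v i))"

definition DJ_equiv :: "nat \<Rightarrow> ('v \<Rightarrow> nat \<Rightarrow> bit) \<Rightarrow> ('v \<Rightarrow> nat \<Rightarrow> bit) \<Rightarrow> bool" where
  "DJ_equiv n = (row_op n)\<^sup>*\<^sup>*"

definition char_kernel :: "'v cpx \<Rightarrow> ('v \<Rightarrow> nat \<Rightarrow> bit) \<Rightarrow> ('v \<Rightarrow> bit) set" where
  "char_kernel L \<Lambda> = {x \<in> Z2_vec (verts L). (\<Sum>v\<in>verts L. Z2_scale (x v) (\<Lambda> v)) = 0}"

text \<open>\<open>\<mu>\<close> is a dual of \<open>\<Lambda>\<close>: its columns \<open>\<lambda>v. \<mu> v k\<close> form a basis of the kernel of \<open>\<Lambda>\<close>.\<close>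
definition dual_of :: "'v cpx \<Rightarrow> ('v \<Rightarrow> nat \<Rightarrow> bit) \<Rightarrow> ('v \<Rightarrow> nat \<Rightarrow> bit) \<Rightarrow> bool" where
  "dual_of L \<Lambda> \<mu> \<longleftrightarrow> (let r = card (verts L) - rk L in
     (\<forall>v\<in>verts L. \<mu> v \<in> Z2_vec {..<r}) \<and> (\<forall>v. v \<notin> verts L \<longrightarrow> \<mu> v = 0) \<and>
     indep_family {..<r} (\<lambda>k v. \<mu> v k) \<and>
     Z2.span ((\<lambda>k v. \<mu> v k) ` {..<r}) = char_kernel L \<Lambda>)"

definition quasi_injective :: "'v cpx \<Rightarrow> ('v \<Rightarrow> nat \<Rightarrow> bit) \<Rightarrow> bool" where
  "quasi_injective L \<mu> \<longleftrightarrow>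
     (\<forall>v\<in>verts L. \<forall>w\<in>verts L. v \<noteq> w \<and> \<mu> v = \<mu> w \<longrightarrow> suspended_pair L v w)"

text \<open>The normal form with rows \<open>(1 0 a)\<close> and \<open>(0 I A)\<close>: column \<open>v\<close> is the first unit vector, and
  the remaining unit vectors are the columns of the vertices \<open>w 1, \<dots>, w (n - 1)\<close>.\<close>
definition normal_form_at :: "'v cpx \<Rightarrow> 'v \<Rightarrow> ('v \<Rightarrow> nat \<Rightarrow> bit) \<Rightarrow> bool" where
  "normal_form_at L v \<Lambda> \<longleftrightarrow> \<Lambda> v = unit_vec 0 \<and>
     (\<exists>w. inj_on w {1..<rk L} \<and> w ` {1..<rk L} \<subseteq> verts L - {v} \<and>
          (\<forall>i\<in>{1..<rk L}. \<Lambda> (w i) = unit_vec i))"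

text \<open>The matrix with rows \<open>(1 0 0 a)\<close>, \<open>(0 1 0 a)\<close> and \<open>(0 0 I A)\<close>: outside the columns of
  \<open>v1\<close> and \<open>v2\<close> the first row is duplicated.\<close>
definition extension_matrix ::
    "'v \<Rightarrow> 'v \<Rightarrow> 'v \<Rightarrow> ('v \<Rightarrow> nat \<Rightarrow> bit) \<Rightarrow> 'v \<Rightarrow> nat \<Rightarrow> bit" where
  "extension_matrix v v1 v2 \<Lambda> = (\<lambda>x.
     if x = v1 then unit_vec 0 else if x = v2 then unit_vec 1 else if x = v then 0
     else (\<lambda>i. case i of 0 \<Rightarrow> \<Lambda> x 0 | Suc k \<Rightarrow> \<Lambda> x k))"

text \<open>The canonical extension is determined only up to D-J equivalence; \<open>\<mu>\<close> is any map over
  \<open>wedge L v v1 v2\<close> in that class.\<close>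
definition canonical_extension ::
    "'v cpx \<Rightarrow> 'v \<Rightarrow> 'v \<Rightarrow> 'v \<Rightarrow> ('v \<Rightarrow> nat \<Rightarrow> bit) \<Rightarrow> ('v \<Rightarrow> nat \<Rightarrow> bit) \<Rightarrow> bool" where
  "canonical_extension L v v1 v2 \<Lambda> \<mu> \<longleftrightarrow>
     (\<exists>\<Lambda>'. DJ_equiv (rk L) \<Lambda> \<Lambda>' \<and> normal_form_at L v \<Lambda>' \<and>
           DJ_equiv (Suc (rk L)) (extension_matrix v v1 v2 \<Lambda>') \<mu>)"

text \<open>Complexes are identified up to relabeling of vertices, since a wedge of \<open>K(J)\<close> is not
  literally of the form \<open>K(J')\<close>; hence \<open>L\<close> ranges over all copies of the \<open>K(J)\<close> with vertices
  among the pairs of natural numbers.\<close>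
definition X_of ::
    "nat cpx \<Rightarrow> ((nat \<times> nat) cpx \<times> (nat \<times> nat \<Rightarrow> nat \<Rightarrow> bit)) set" where
  "X_of K = {(L, \<Lambda>). (\<exists>J. (\<forall>i\<in>verts K. 1 \<le> J i) \<and> isomorphic (K_of K J) L) \<and> char_map L \<Lambda>}"

end

theory Submission
  imports Defs
begin

text \<open>
  If two vertices \<open>v\<close>, \<open>w\<close> have equal rows in the dual of \<open>\<lambda>\<close>, then every facet contains \<open>v\<close> or \<open>w\<close>, since the
  complement of a facet indexes a basis of the kernel. As every ridge lies in two facets, \<open>v\<close> and \<open>w\<close> are
  interchangeable; so they form a suspended pair, or \<open>L\<close> is the wedge of a complex \<open>M\<close> with new vertices
  \<open>v\<close>, \<open>w\<close>, and \<open>\<lambda>\<close> is the canonical extension of a map over \<open>M\<close>. Moreover \<open>M\<close> is again of the form \<open>K(J')\<close>,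
  unless \<open>v\<close> and \<open>w\<close> are the only copies of two vertices of \<open>K\<close>; in that case \<open>K\<close> itself is a wedge of the
  link of a vertex, which is impossible for a seed. Induction on the number of vertices finishes the proof.

  The input from PL topology is that the link of a vertex of a PL sphere is a PL sphere, which also yields
  purity and the statement on ridges. Because the simplices are mapped to convex sets, a PL homeomorphism
  gives isomorphic subdivisions of both complexes. Radial projection from the vertex subdivides its link in
  \<open>K\<close>; on the side of \<open>\<partial>\<Delta>\<close> the image \<open>y\<close> of the vertex need not be a vertex, and a piecewise
  linear identification of the directions at \<open>y\<close> with the cone over \<open>\<partial>\<Delta>\<close> of one dimension less is used
  instead, after cutting the subdivisions along the finitely many hyperplanes where it bends.
\<close>

section \<open>Realizations and piecewise linear parametrizations\<close>

text \<open>The complexes \<open>K(J)\<close> are never shown to be PL spheres. The kernel argument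
  asks of them only that all facets have the same size and that every ridge lies in a second facet;
  both properties go over from \<open>K\<close> to \<open>K(J)\<close> by counting complements of
  faces. PL topology is applied to \<open>K\<close> alone, but there these two properties do not
  suffice: the definition of a seed excludes wedges of PL spheres only, so the link that exhibits
  \<open>K\<close> as a wedge must itself be a PL sphere.

  The proof about links keeps one abstract complex with two families of vertex positions, one in
  each realization. A refinement made for one side is then a refinement of the other, and changing
  positions is the homeomorphism. The obstacle is that directions at a point inside a face of the
  boundary of a simplex have no linear identification with a cone over a smaller boundary. The one
  used subtracts a minimum of linear functions; it bends where two of these agree, which is the
  origin of the hyperplanes.\<close>

lemma simplicial_cpx_finite: "simplicial_cpx K \<Longrightarrow> finite K"
  and simplicial_cpx_finite_face: "simplicial_cpx K \<Longrightarrow> \<sigma> \<in> K \<Longrightarrow> finite \<sigma>"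
  and simplicial_cpx_empty: "simplicial_cpx K \<Longrightarrow> {} \<in> K"
  and simplicial_cpx_subset: "simplicial_cpx K \<Longrightarrow> \<sigma> \<in> K \<Longrightarrow> \<tau> \<subseteq> \<sigma> \<Longrightarrow> \<tau> \<in> K"
  by (auto simp: simplicial_cpx_def)

lemma simplicial_cpx_finite_verts: "simplicial_cpx K \<Longrightarrow> finite (verts K)"
  by (auto simp: simplicial_cpx_def)

lemma simplicial_cpx_vertex: "simplicial_cpx K \<Longrightarrow> v \<in> verts K \<longleftrightarrow> {v} \<in> K"
  by (auto simp: simplicial_cpx_def)

lemma simplicial_cpx_simplex_boundary:
  "finite D \<Longrightarrow> D \<noteq> {} \<Longrightarrow> simplicial_cpx (simplex_boundary D)"
  unfolding simplicial_cpx_def simplex_boundary_def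
  by (auto intro: finite_subset[OF _ finite_Pow_iff[THEN iffD2]] finite_subset)

lemma simplicial_cpx_link:
  assumes "simplicial_cpx K" "v \<in> verts K"
  shows "simplicial_cpx (link K v)"
proof -
  have "link K v \<subseteq> K"
    using assms(1) by (auto simp: link_def simplicial_cpx_def)
  moreover have "\<tau> \<in> link K v" if "\<sigma> \<in> link K v" "\<tau> \<subseteq> \<sigma>" for \<sigma> \<tau>
    using that simplicial_cpx_subset[OF assms(1), of "insert v \<sigma>" "insert v \<tau>"] by (auto simp: link_def)
  moreover have "{} \<in> link K v"
    using assms simplicial_cpx_vertex[OF assms(1)] by (auto simp: link_def)
  ultimately show ?thesis
    using assms(1) unfolding simplicial_cpx_def by (meson finite_subset subsetD)
qed

section \<open>Barycentric coordinates and realizations\<close>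

abbreviation supp :: "('v \<Rightarrow> real) \<Rightarrow> 'v set" where
  "supp x \<equiv> {i. x i \<noteq> 0}"

lemma sum_supp:
  fixes c :: "'a \<Rightarrow> real" and h :: "'a \<Rightarrow> real"
  assumes "finite A" "supp c \<subseteq> A"
  shows "(\<Sum>s\<in>supp c. c s * h s) = (\<Sum>s\<in>A. c s * h s)" "sum c (supp c) = sum c A"
  using assms by (auto intro!: sum.mono_neutral_left)

lemma convex_fun_iff:
  "convex (C :: ('v \<Rightarrow> real) set) \<longleftrightarrow>
     (\<forall>x\<in>C. \<forall>y\<in>C. \<forall>u\<ge>0. \<forall>v\<ge>0. u + v = 1 \<longrightarrow> (\<lambda>i. u * x i + v * y i) \<in> C)"
  unfolding convex_def scaleR_fun_def plus_fun_def by simp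

lemma sum_fun_apply: "(\<Sum>s\<in>A. f s) i = (\<Sum>s\<in>A. f s i :: real)"
  by (induct A rule: infinite_finite_induct) auto

text \<open>The vertices are unit vectors, so a point is its own family of barycentric coordinates,
  and its support is the smallest face that carries it.\<close>

lemma cell_iff:
  assumes "finite \<sigma>"
  shows "x \<in> cell \<sigma> \<longleftrightarrow> (\<forall>i. 0 \<le> x i) \<and> supp x \<subseteq> \<sigma> \<and> sum x \<sigma> = 1"
proof
  let ?C = "{x :: 'a \<Rightarrow> real. (\<forall>i. 0 \<le> x i) \<and> supp x \<subseteq> \<sigma> \<and> sum x \<sigma> = 1}"
  have "convex ?C"
    unfolding convex_fun_iff
    by (auto simp: sum.distrib sum_distrib_left[symmetric] subset_iff) (metis add_0 mult_zero_right)
  moreover have "vertex_pt ` \<sigma> \<subseteq> ?C"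
    using assms by (auto simp: vertex_pt_def split: if_splits)
  ultimately have "cell \<sigma> \<subseteq> ?C"
    unfolding cell_def by (simp add: hull_minimal)
  then show "x \<in> cell \<sigma> \<Longrightarrow> (\<forall>i. 0 \<le> x i) \<and> supp x \<subseteq> \<sigma> \<and> sum x \<sigma> = 1"
    by auto
next
  assume x: "(\<forall>i. 0 \<le> x i) \<and> supp x \<subseteq> \<sigma> \<and> sum x \<sigma> = 1"
  have "(\<Sum>j\<in>\<sigma>. x j *\<^sub>R vertex_pt j) \<in> cell \<sigma>"
    using x assms unfolding cell_def by (intro convex_sum) (auto intro: hull_inc)
  also have "(\<Sum>j\<in>\<sigma>. x j *\<^sub>R vertex_pt j) = x"
  proof
    fix i
    have "(\<Sum>j\<in>\<sigma>. x j *\<^sub>R vertex_pt j) i = (\<Sum>j\<in>\<sigma>. if i = j then x j else 0)"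
      unfolding sum_fun_apply by (intro sum.cong) (auto simp: scaleR_fun_def vertex_pt_def)
    also have "\<dots> = x i" using x assms by auto
    finally show "(\<Sum>j\<in>\<sigma>. x j *\<^sub>R vertex_pt j) i = x i" .
  qed
  finally show "x \<in> cell \<sigma>" .
qed

lemma realization_iff:
  assumes "simplicial_cpx K"
  shows "x \<in> realization K \<longleftrightarrow> (\<forall>i. 0 \<le> x i) \<and> supp x \<in> K \<and> sum x (supp x) = 1"
proof -
  have "x \<in> cell \<sigma> \<Longrightarrow> \<sigma> \<in> K \<Longrightarrow> (\<forall>i. 0 \<le> x i) \<and> supp x \<in> K \<and> sum x (supp x) = 1" for \<sigma>
    using cell_iff[of \<sigma> x] simplicial_cpx_finite_face[OF assms, of \<sigma>]
      simplicial_cpx_subset[OF assms, of \<sigma> "supp x"] sum_supp(2)[of \<sigma> x] by auto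
  moreover have "(\<forall>i. 0 \<le> x i) \<and> supp x \<in> K \<and> sum x (supp x) = 1 \<Longrightarrow> x \<in> cell (supp x)"
    using cell_iff[of "supp x" x] simplicial_cpx_finite_face[OF assms, of "supp x"] by auto
  ultimately show ?thesis
    unfolding realization_def by blast
qed

lemma realizationD:
  assumes "simplicial_cpx K" "x \<in> realization K"
  shows "0 \<le> x i" "supp x \<in> K" "finite (supp x)" "finite A \<Longrightarrow> supp x \<subseteq> A \<Longrightarrow> sum x A = 1"
    "supp x \<subseteq> verts K"
  using assms realization_iff[OF assms(1), of x] simplicial_cpx_finite_face[OF assms(1)]
    sum_supp(2)[of A x] by auto

lemma realizationI:
  assumes "simplicial_cpx K" "\<And>i. 0 \<le> x i" "supp x \<in> K" "finite A" "supp x \<subseteq> A" "sum x A = 1"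
  shows "x \<in> realization K"
  using assms realization_iff[OF assms(1), of x] sum_supp(2)[of A x] by auto

text \<open>Such a set contains a point whose support is largest; the midpoint with any other point
  shows that this support contains all others.\<close>
lemma convex_subset_realization:
  assumes K: "simplicial_cpx K" and C: "convex C" "C \<subseteq> realization K"
  obtains \<sigma> where "\<sigma> \<in> K" "C \<subseteq> cell \<sigma>"
proof (cases "C = {}")
  case True
  then show ?thesis using that[of "{}"] simplicial_cpx_empty[OF K] by auto
next
  case False
  let ?S = "(\<lambda>x. supp x) ` C"
  have "?S \<subseteq> K" using C(2) realizationD(2)[OF K] by auto
  then have fin: "finite ?S" using simplicial_cpx_finite[OF K] finite_subset by blast
  obtain s where s: "s \<in> ?S" "\<And>t. t \<in> ?S \<Longrightarrow> s \<subseteq> t \<Longrightarrow> t = s"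
    using finite_has_maximal[OF fin] False by (metis image_is_empty)
  then obtain x where x: "x \<in> C" "s = supp x" by auto
  have sub: "supp z \<subseteq> s" if z: "z \<in> C" for z
  proof -
    define y where "y = (\<lambda>i. (1/2) * x i + (1/2) * z i)"
    have y: "y \<in> C"
      using C(1) x(1) z unfolding convex_fun_iff y_def by (metis field_sum_of_halves half_gt_zero_iff less_eq_real_def zero_less_one)
    have nn: "0 \<le> x i" "0 \<le> z i" for i
      using realizationD(1)[OF K] C(2) x(1) z by auto
    have "supp y = s \<union> supp z"
      unfolding y_def x(2) using nn by (auto simp: add_nonneg_eq_0_iff)
    then show ?thesis using s(2)[of "supp y"] y by auto
  qed
  have sK: "s \<in> K" using s(1) \<open>?S \<subseteq> K\<close> by auto
  have "C \<subseteq> cell s"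
  proof
    fix z assume "z \<in> C"
    then show "z \<in> cell s"
      using cell_iff[of s z] sub[of z] simplicial_cpx_finite_face[OF K sK] realizationD[OF K, of z] C(2)
      by auto
  qed
  then show ?thesis using that sK by blast
qed

text \<open>The ambient function space may be an infinite product. Compactness comes from the cube,
  by Tychonoff's theorem, in which the cell is closed.\<close>

lemma compact_cell:
  assumes "finite \<sigma>"
  shows "compact (cell \<sigma>)"
proof -
  let ?B = "PiE UNIV (\<lambda>_. {0..1}) :: ('a \<Rightarrow> real) set"
  have "compactin (product_topology (\<lambda>_. euclidean) UNIV) ?B"
    by (subst compactin_PiE) auto
  then have cB: "compact ?B"
    by (simp add: euclidean_product_topology)
  have cl1: "closed {x :: 'a \<Rightarrow> real. x i = 0}" for i
    by (intro closed_Collect_eq continuous_on_product_coordinates continuous_on_const)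
  have cl2: "closed {x :: 'a \<Rightarrow> real. sum x \<sigma> = 1}"
    by (intro closed_Collect_eq continuous_on_sum continuous_on_product_coordinates continuous_on_const)
  have "cell \<sigma> = ?B \<inter> ((\<Inter>i\<in>-\<sigma>. {x. x i = 0}) \<inter> {x. sum x \<sigma> = 1})"
  proof (rule set_eqI)
    fix x :: "'a \<Rightarrow> real"
    have "x i \<le> 1" if "\<forall>i. 0 \<le> x i" "supp x \<subseteq> \<sigma>" "sum x \<sigma> = 1" for i
      using that member_le_sum[of i \<sigma> x] assms by (cases "i \<in> \<sigma>") force+
    then show "x \<in> cell \<sigma> \<longleftrightarrow> x \<in> ?B \<inter> ((\<Inter>i\<in>-\<sigma>. {x. x i = 0}) \<inter> {x. sum x \<sigma> = 1})"
      unfolding cell_iff[OF assms] by (auto simp: PiE_def Pi_def)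
  qed
  moreover have "closed ((\<Inter>i\<in>-\<sigma>. {x :: 'a \<Rightarrow> real. x i = 0}) \<inter> {x. sum x \<sigma> = 1})"
    using cl1 cl2 by (intro closed_Int closed_INT) auto
  ultimately show ?thesis using cB by (simp add: compact_Int_closed)
qed

lemma compact_realization: "simplicial_cpx K \<Longrightarrow> compact (realization K)"
  unfolding realization_def
  by (intro compact_UN) (auto simp: simplicial_cpx_finite simplicial_cpx_finite_face intro: compact_cell)

section \<open>Labelled subdivisions\<close>

definition pl_map :: "('a \<Rightarrow> 'v \<Rightarrow> real) \<Rightarrow> ('a \<Rightarrow> real) \<Rightarrow> 'v \<Rightarrow> real" where
  "pl_map \<alpha> c = (\<lambda>i. \<Sum>s\<in>supp c. c s * \<alpha> s i)"

lemma pl_map_eq: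
  "finite A \<Longrightarrow> supp c \<subseteq> A \<Longrightarrow> pl_map \<alpha> c i = (\<Sum>s\<in>A. c s * \<alpha> s i)"
  unfolding pl_map_def by (rule sum_supp)

lemma pl_map_vertex_pt: "pl_map \<alpha> (vertex_pt s) = \<alpha> s"
proof -
  have "supp (vertex_pt s) = {s}" by (auto simp: vertex_pt_def)
  then show ?thesis unfolding pl_map_def by (simp add: vertex_pt_def)
qed

lemma vertex_pt_in_realization:
  assumes "simplicial_cpx N" "{s} \<in> N"
  shows "vertex_pt s \<in> realization N"
proof (rule realizationI[where A="{s}"])
  have "supp (vertex_pt s) = {s}" by (auto simp: vertex_pt_def)
  then show "supp (vertex_pt s) \<in> N" "supp (vertex_pt s) \<subseteq> {s}" using assms by auto
qed (use assms in \<open>auto simp: vertex_pt_def\<close>)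

text \<open>A subdivision of \<open>K\<close> with its simplices labelled by an abstract complex \<open>N\<close>:
  \<open>\<alpha>\<close> gives the positions of the vertices.\<close>
definition triang :: "'a cpx \<Rightarrow> ('a \<Rightarrow> 'v \<Rightarrow> real) \<Rightarrow> 'v cpx \<Rightarrow> bool" where
  "triang N \<alpha> K \<longleftrightarrow> simplicial_cpx N \<and> bij_betw (pl_map \<alpha>) (realization N) (realization K) \<and>
     (\<forall>S\<in>N. \<exists>\<sigma>\<in>K. \<alpha> ` S \<subseteq> cell \<sigma>)"

lemma triangD:
  assumes "triang N \<alpha> K"
  shows "simplicial_cpx N" "inj_on (pl_map \<alpha>) (realization N)"
    "pl_map \<alpha> ` realization N = realization K" "S \<in> N \<Longrightarrow> \<exists>\<sigma>\<in>K. \<alpha> ` S \<subseteq> cell \<sigma>"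
  using assms by (auto simp: triang_def bij_betw_def)

lemma triang_inj_on_verts:
  assumes "triang N \<alpha> K"
  shows "inj_on \<alpha> (verts N)"
proof (rule inj_onI)
  note N = triangD(1)[OF assms]
  fix s t assume st: "s \<in> verts N" "t \<in> verts N" "\<alpha> s = \<alpha> t"
  then have "vertex_pt s = vertex_pt t"
    using triangD(2)[OF assms] vertex_pt_in_realization[OF N] simplicial_cpx_vertex[OF N]
      pl_map_vertex_pt[of \<alpha>] by (metis inj_onD)
  then show "s = t" unfolding vertex_pt_def by (metis zero_neq_one)
qed

lemma continuous_on_pl_map:
  assumes "simplicial_cpx N"
  shows "continuous_on (realization N) (pl_map \<alpha>)"
proof (rule continuous_on_coordinatewise_then_product)
  fix i
  have "continuous_on (realization N) (\<lambda>c. \<Sum>s\<in>verts N. c s * \<alpha> s i)"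
    by (intro continuous_intros continuous_on_product_then_coordinatewise[OF continuous_on_id])
  then show "continuous_on (realization N) (\<lambda>c. pl_map \<alpha> c i)"
    using realizationD(5)[OF assms] simplicial_cpx_finite_verts[OF assms]
    by (subst continuous_on_cong[OF refl pl_map_eq]) auto
qed

text \<open>A countable index type makes the function space metrizable, hence Hausdorff; a
  continuous bijection from a compact space is then a homeomorphism.\<close>

lemma triang_homeomorphism:
  fixes \<alpha> :: "'a \<Rightarrow> 'v::countable \<Rightarrow> real"
  assumes "triang N \<alpha> K"
  obtains g where "homeomorphism (realization N) (realization K) (pl_map \<alpha>) g"
  using homeomorphism_compact[OF compact_realization[OF triangD(1)] continuous_on_pl_map[OF triangD(1)]
      triangD(3) triangD(2)] assms by blast

text \<open>\<open>affine_map_on\<close> speaks of two points at a time. Every coordinate of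
  \<open>f\<close> is convex, and so is its negative; Jensen's inequality for both gives the
  equation for any number of points.\<close>

lemma affine_map_on_pl_map:
  fixes f :: "('v \<Rightarrow> real) \<Rightarrow> ('w \<Rightarrow> real)"
  assumes f: "affine_map_on C f" and C: "convex C"
    and c: "finite (supp c)" "supp c \<subseteq> C" "\<And>s. 0 \<le> c s" "sum c (supp c) = 1"
  shows "f (pl_map (\<lambda>s. s) c) = pl_map f c"
proof
  fix j
  have ne: "supp c \<noteq> {}" using c(4) by (metis sum.empty zero_neq_one)
  have aff: "f ((1 - t) *\<^sub>R x + t *\<^sub>R y) j = (1 - t) * f x j + t * f y j"
    if "x \<in> C" "y \<in> C" "0 \<le> t" "t \<le> 1" for x y t
    using f that unfolding affine_map_on_def by (simp add: scaleR_fun_def)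
  have cv: "convex_on C (\<lambda>x. f x j)" "convex_on C (\<lambda>x. - f x j)"
    using C aff by (auto intro!: convex_onI simp: algebra_simps)
  have eq: "(\<Sum>s\<in>supp c. c s *\<^sub>R s) = pl_map (\<lambda>s. s) c"
    by (auto simp: pl_map_def fun_eq_iff sum_fun_apply scaleR_fun_def)
  have "f (\<Sum>s\<in>supp c. c s *\<^sub>R s) j \<le> (\<Sum>s\<in>supp c. c s * f s j)"
    using convex_on_sum[OF c(1) ne cv(1), of c "\<lambda>s. s"] c by auto
  moreover have "- f (\<Sum>s\<in>supp c. c s *\<^sub>R s) j \<le> (\<Sum>s\<in>supp c. c s * - f s j)"
    using convex_on_sum[OF c(1) ne cv(2), of c "\<lambda>s. s"] c by auto
  ultimately show "f (pl_map (\<lambda>s. s) c) j = pl_map f c j"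
    unfolding eq by (simp add: pl_map_def sum_negf)
qed

lemma convex_hull_iff_pl_map:
  fixes S :: "('v \<Rightarrow> real) set"
  assumes "finite S"
  shows "x \<in> convex hull S \<longleftrightarrow>
    (\<exists>c. (\<forall>s. 0 \<le> c s) \<and> supp c \<subseteq> S \<and> sum c (supp c) = 1 \<and> x = pl_map (\<lambda>s. s) c)"
proof
  assume "x \<in> convex hull S"
  then obtain u where u: "\<forall>s\<in>S. 0 \<le> u s" "sum u S = 1" "(\<Sum>s\<in>S. u s *\<^sub>R s) = x"
    unfolding convex_hull_finite[OF assms] by auto
  define c where "c = (\<lambda>s. if s \<in> S then u s else 0)"
  have c: "supp c \<subseteq> S" by (auto simp: c_def)
  have "x = pl_map (\<lambda>s. s) c"
    unfolding u(3)[symmetric] fun_eq_iff pl_map_eq[OF assms c]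
    by (auto simp: sum_fun_apply scaleR_fun_def c_def)
  moreover have "sum c (supp c) = 1"
    unfolding sum_supp(2)[OF assms c] using u(2) by (simp add: c_def)
  ultimately show "\<exists>c. (\<forall>s. 0 \<le> c s) \<and> supp c \<subseteq> S \<and> sum c (supp c) = 1 \<and> x = pl_map (\<lambda>s. s) c"
    using c u(1) by (intro exI[of _ c]) (auto simp: c_def)
next
  assume "\<exists>c. (\<forall>s. 0 \<le> c s) \<and> supp c \<subseteq> S \<and> sum c (supp c) = 1 \<and> x = pl_map (\<lambda>s. s) c"
  then obtain c where c: "\<forall>s. 0 \<le> c s" "supp c \<subseteq> S" "sum c (supp c) = 1" "x = pl_map (\<lambda>s. s) c"
    by auto
  have "(\<Sum>s\<in>S. c s *\<^sub>R s) = x"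
    unfolding c(4) fun_eq_iff pl_map_eq[OF assms c(2)] by (auto simp: sum_fun_apply scaleR_fun_def)
  then show "x \<in> convex hull S"
    unfolding convex_hull_finite[OF assms] using c(1,3) sum_supp(2)[OF assms c(2)] by auto
qed

lemma affine_independent_barycentric_unique:
  fixes S :: "('v \<Rightarrow> real) set"
  assumes "finite S" "\<not> affine_dependent S" "supp c \<subseteq> S" "supp d \<subseteq> S"
    "sum c (supp c) = sum d (supp d)" "pl_map (\<lambda>s. s) c = pl_map (\<lambda>s. s) d"
  shows "c = d"
proof (rule ccontr)
  assume "c \<noteq> d"
  then obtain s where s: "c s \<noteq> d s" by auto
  then have "s \<in> supp c \<or> s \<in> supp d" by auto
  then have "s \<in> S" using assms(3,4) by blast
  have 1: "(\<Sum>s\<in>S. c s - d s) = 0"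
    using assms(5) sum_supp(2)[OF assms(1,3)] sum_supp(2)[OF assms(1,4)] by (simp add: sum_subtractf)
  have 2: "(\<Sum>v\<in>S. (c v - d v) *\<^sub>R v) = 0"
    using assms(6) unfolding fun_eq_iff pl_map_eq[OF assms(1,3)] pl_map_eq[OF assms(1,4)]
    by (simp add: sum_fun_apply scaleR_fun_def left_diff_distrib sum_subtractf)
  have "affine_dependent S"
    unfolding affine_dependent_explicit_finite[OF assms(1)]
    using 1 2 s \<open>s \<in> S\<close> by (intro exI[of _ "\<lambda>s. c s - d s"]) auto
  then show False using assms(2) by blast
qed

text \<open>A point lying in two simplices lies in the hull of their common vertices. By affine
  independence its coordinates there agree with those in either simplex, so a point determines its
  labelled coordinates.\<close>

lemma subdivision_triang:
  assumes K: "simplicial_cpx K" and T: "subdivision_of T K"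
  shows "triang T (\<lambda>s. s) K"
proof -
  have sT: "simplicial_cpx T" and ai: "\<And>S. S \<in> T \<Longrightarrow> \<not> affine_dependent S"
    and int: "\<And>S S'. S \<in> T \<Longrightarrow> S' \<in> T \<Longrightarrow> convex hull S \<inter> convex hull S' = convex hull (S \<inter> S')"
    and un: "(\<Union>S\<in>T. convex hull S) = realization K"
    and cells: "\<And>S. S \<in> T \<Longrightarrow> \<exists>\<sigma>\<in>K. convex hull S \<subseteq> cell \<sigma>"
    using T by (auto simp: subdivision_of_def geometric_cpx_def)
  note fin = simplicial_cpx_finite_face[OF sT]
  have hull: "pl_map (\<lambda>s. s) c \<in> convex hull (supp c)" if "c \<in> realization T" for c
    using realizationD(1,3)[OF sT that] realizationD(4)[OF sT that realizationD(3)[OF sT that]]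
    by (auto simp: convex_hull_iff_pl_map)
  have uniq: "c = d" if "c \<in> realization T" "x = pl_map (\<lambda>s. s) c" "x = pl_map (\<lambda>s. s) d"
      "supp d \<subseteq> supp c" "sum d (supp d) = 1" for c d x
    using affine_independent_barycentric_unique[of "supp c" c d] that realizationD[OF sT that(1)]
      realizationD(4)[OF sT that(1) realizationD(3)[OF sT that(1)]] ai by auto
  have "inj_on (pl_map (\<lambda>s. s)) (realization T)"
  proof (rule inj_onI)
    fix c c' assume c: "c \<in> realization T" "c' \<in> realization T" "pl_map (\<lambda>s. s) c = pl_map (\<lambda>s. s) c'"
    let ?x = "pl_map (\<lambda>s. s) c"
    have "?x \<in> convex hull (supp c \<inter> supp c')"
      using hull[OF c(1)] hull[OF c(2)] c(3) int[OF realizationD(2)[OF sT c(1)] realizationD(2)[OF sT c(2)]]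
      by auto
    then obtain d where d: "supp d \<subseteq> supp c \<inter> supp c'" "sum d (supp d) = 1" "?x = pl_map (\<lambda>s. s) d"
      using convex_hull_iff_pl_map[of "supp c \<inter> supp c'"] realizationD(3)[OF sT c(1)] by auto
    show "c = c'"
      using uniq[OF c(1) refl d(3)] uniq[OF c(2) c(3) d(3)] d by auto
  qed
  moreover have "pl_map (\<lambda>s. s) ` realization T = realization K"
  proof
    show "pl_map (\<lambda>s. s) ` realization T \<subseteq> realization K"
      using hull un realizationD(2)[OF sT] by blast
    show "realization K \<subseteq> pl_map (\<lambda>s. s) ` realization T"
    proof
      fix x assume "x \<in> realization K"
      then obtain S where S: "S \<in> T" "x \<in> convex hull S" using un by auto
      then obtain c where c: "\<forall>s. 0 \<le> c s" "supp c \<subseteq> S" "sum c (supp c) = 1" "x = pl_map (\<lambda>s. s) c"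
        using convex_hull_iff_pl_map[OF fin] by blast
      then have "c \<in> realization T"
        using realization_iff[OF sT] simplicial_cpx_subset[OF sT S(1)] by auto
      then show "x \<in> pl_map (\<lambda>s. s) ` realization T" using c(4) by auto
    qed
  qed
  moreover have "\<exists>\<sigma>\<in>K. (\<lambda>s. s) ` S \<subseteq> cell \<sigma>" if "S \<in> T" for S
    using cells[OF that] hull_subset[of S convex] by auto
  ultimately show ?thesis using sT by (auto simp: triang_def bij_betw_def)
qed

text \<open>The images of the simplices of a subdivision of \<open>K\<close> need no further subdivision, as they are
  convex and hence contained in cells of \<open>L\<close>.\<close>
lemma PL_homeomorphic_triang:
  assumes K: "simplicial_cpx K" and L: "simplicial_cpx L" and "PL_homeomorphic K L"
  obtains N :: "('v \<Rightarrow> real) cpx" and \<alpha> \<beta> where "triang N \<alpha> (K :: 'v cpx)" "triang N \<beta> L"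
proof -
  obtain f g T where fg: "homeomorphism (realization K) (realization L) f g"
    and T: "subdivision_of T K" and aff: "\<And>S. S \<in> T \<Longrightarrow> affine_map_on (convex hull S) f"
    using assms(3) unfolding PL_homeomorphic_def PL_on_def by blast
  have tK: "triang T (\<lambda>s. s) K" by (rule subdivision_triang[OF K T])
  note sT = triangD(1)[OF tK]
  have bf: "bij_betw f (realization K) (realization L)"
    using fg unfolding homeomorphism_def by (metis bij_betw_byWitness subset_refl)
  \<comment> \<open>On every simplex \<open>f\<close> is the linear extension of its values at the
    vertices. Hence the same labels \<open>T\<close>, placed by \<open>f\<close>, parametrize the
    realization of \<open>L\<close>.\<close>
  have eq: "pl_map f c = (f \<circ> pl_map (\<lambda>s. s)) c" if c: "c \<in> realization T" for c
    using affine_map_on_pl_map[OF aff[OF realizationD(2)[OF sT c]] convex_convex_hull realizationD(3)[OF sT c]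
       hull_subset realizationD(1)[OF sT c] realizationD(4)[OF sT c realizationD(3)[OF sT c]]] by auto
  have "bij_betw (f \<circ> pl_map (\<lambda>s. s)) (realization T) (realization L)"
    using tK bf unfolding triang_def by (blast intro: bij_betw_trans)
  then have bij: "bij_betw (pl_map f) (realization T) (realization L)"
    using bij_betw_cong[of "realization T" "pl_map f" "f \<circ> pl_map (\<lambda>s. s)"] eq by blast
  have "\<exists>\<sigma>\<in>L. f ` S \<subseteq> cell \<sigma>" if S: "S \<in> T" for S
  proof -
    have sub: "convex hull S \<subseteq> realization K" using T S by (auto simp: subdivision_of_def)
    have "convex (f ` (convex hull S))"
      unfolding convex_alt[of "f ` (convex hull S)"]
    proof (intro ballI allI impI)
      fix p q and u :: real
      assume "p \<in> f ` (convex hull S)" "q \<in> f ` (convex hull S)" "0 \<le> u \<and> u \<le> 1"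
      then obtain x y where pq: "p = f x" "q = f y"
        and xy: "x \<in> convex hull S" "y \<in> convex hull S" "0 \<le> u" "u \<le> 1" by auto
      have "(1 - u) *\<^sub>R f x + u *\<^sub>R f y = f ((1 - u) *\<^sub>R x + u *\<^sub>R y)"
        using aff[OF S] xy unfolding affine_map_on_def by auto
      moreover have "(1 - u) *\<^sub>R x + u *\<^sub>R y \<in> convex hull S"
        using xy convex_convex_hull[of S] unfolding convex_alt by blast
      ultimately show "(1 - u) *\<^sub>R p + u *\<^sub>R q \<in> f ` (convex hull S)" unfolding pq by auto
    qed
    moreover have "f ` (convex hull S) \<subseteq> realization L"
      using sub bf by (auto simp: bij_betw_def)
    ultimately obtain \<sigma> where "\<sigma> \<in> L" "f ` (convex hull S) \<subseteq> cell \<sigma>"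
      using convex_subset_realization[OF L] by blast
    then show ?thesis using hull_subset[of S convex] by blast
  qed
  then have "triang T f L" using sT bij by (auto simp: triang_def)
  then show ?thesis using that tK by blast
qed

section \<open>From labelled subdivisions back to PL homeomorphisms\<close>

lemma triang_hull:
  assumes "triang N \<alpha> K" "S \<in> N"
  shows "convex hull (\<alpha> ` S) = pl_map \<alpha> ` {c \<in> realization N. supp c \<subseteq> S}"
proof -
  note N = triangD(1)[OF assms(1)]
  have fS: "finite S" using simplicial_cpx_finite_face[OF N assms(2)] .
  have inj: "inj_on \<alpha> S"
    using triang_inj_on_verts[OF assms(1)] assms(2) by (auto intro: inj_on_subset)
  have e: "(\<Sum>x\<in>\<alpha> ` S. u x *\<^sub>R x) = (\<lambda>i. \<Sum>s\<in>S. u (\<alpha> s) * \<alpha> s i)" for u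
    by (auto simp: fun_eq_iff sum_fun_apply scaleR_fun_def sum.reindex[OF inj])
  show ?thesis
  proof (intro subset_antisym subsetI)
    fix x assume "x \<in> convex hull (\<alpha> ` S)"
    then obtain u where u: "\<forall>y\<in>\<alpha> ` S. 0 \<le> u y" "sum u (\<alpha> ` S) = 1" "(\<Sum>y\<in>\<alpha> ` S. u y *\<^sub>R y) = x"
      using convex_hull_finite[of "\<alpha> ` S"] fS by auto
    define c where "c = (\<lambda>s. if s \<in> S then u (\<alpha> s) else 0)"
    have c: "supp c \<subseteq> S" by (auto simp: c_def)
    have "sum c S = 1" using u(2) by (simp add: c_def sum.reindex[OF inj])
    then have "c \<in> realization N"
      using u(1) c simplicial_cpx_subset[OF N assms(2) c] fS
      by (intro realizationI[OF N, where A=S]) (auto simp: c_def)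
    moreover have "x = pl_map \<alpha> c"
      unfolding u(3)[symmetric] e fun_eq_iff pl_map_eq[OF fS c] by (simp add: c_def)
    ultimately show "x \<in> pl_map \<alpha> ` {c \<in> realization N. supp c \<subseteq> S}" using c by auto
  next
    fix x assume "x \<in> pl_map \<alpha> ` {c \<in> realization N. supp c \<subseteq> S}"
    then obtain c where c: "c \<in> realization N" "supp c \<subseteq> S" "x = pl_map \<alpha> c" by auto
    have "(\<Sum>s\<in>S. c s *\<^sub>R \<alpha> s) \<in> convex hull (\<alpha> ` S)"
      using realizationD(1)[OF N c(1)] realizationD(4)[OF N c(1) fS c(2)] fS
      by (intro convex_sum) (auto intro: hull_inc)
    moreover have "(\<Sum>s\<in>S. c s *\<^sub>R \<alpha> s) = x"
      unfolding c(3) fun_eq_iff pl_map_eq[OF fS c(2)] by (simp add: sum_fun_apply scaleR_fun_def)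
    ultimately show "x \<in> convex hull (\<alpha> ` S)" by simp
  qed
qed

text \<open>As in Radon's theorem, the positive and the negative part of an affine dependence,
  divided by their common mass \<open>M\<close>, are two points of the realization with the same
  image, against injectivity.\<close>

lemma triang_affine_independent:
  assumes "triang N \<alpha> K" "S \<in> N"
  shows "\<not> affine_dependent (\<alpha> ` S)"
proof
  note N = triangD(1)[OF assms(1)]
  have fS: "finite S" using simplicial_cpx_finite_face[OF N assms(2)] .
  have inj: "inj_on \<alpha> S"
    using triang_inj_on_verts[OF assms(1)] assms(2) by (auto intro: inj_on_subset)
  assume "affine_dependent (\<alpha> ` S)"
  then obtain U where U: "sum U (\<alpha> ` S) = 0" "\<exists>v\<in>\<alpha> ` S. U v \<noteq> 0" "(\<Sum>v\<in>\<alpha> ` S. U v *\<^sub>R v) = 0"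
    using affine_dependent_explicit_finite[of "\<alpha> ` S"] fS by auto
  define w where "w = (\<lambda>s. if s \<in> S then U (\<alpha> s) else 0)"
  have w0: "sum w S = 0" using U(1) by (simp add: w_def sum.reindex[OF inj])
  have w1: "(\<Sum>s\<in>S. w s * \<alpha> s i) = 0" for i
    using fun_cong[OF U(3), of i] by (simp add: w_def sum_fun_apply scaleR_fun_def sum.reindex[OF inj])
  obtain s0 where s0: "s0 \<in> S" "w s0 \<noteq> 0" using U(2) by (auto simp: w_def)
  define M where "M = (\<Sum>s\<in>S. max 0 (w s))"
  have "M \<noteq> 0"
  proof
    assume "M = 0"
    then have le: "\<forall>s\<in>S. max 0 (w s) = 0"
      unfolding M_def using fS by (subst (asm) sum_nonneg_eq_0_iff) auto
    then have "\<forall>s\<in>S. 0 \<le> - w s" by (auto simp: max_def split: if_splits)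
    moreover have "(\<Sum>s\<in>S. - w s) = 0" using w0 by (simp add: sum_negf)
    ultimately have "\<forall>s\<in>S. - w s = 0" using fS by (metis (no_types, lifting) sum_nonneg_eq_0_iff)
    then show False using s0 by auto
  qed
  moreover have "0 \<le> M" unfolding M_def by (intro sum_nonneg) auto
  ultimately have M: "0 < M" by simp
  define c d where "c = (\<lambda>s. max 0 (w s) / M)" and "d = (\<lambda>s. max 0 (- w s) / M)"
  have cd: "c s - d s = w s / M" for s by (auto simp: c_def d_def max_def diff_divide_distrib[symmetric])
  have sup: "supp c \<subseteq> S" "supp d \<subseteq> S" by (auto simp: c_def d_def w_def)
  have c1: "sum c S = 1" using M by (simp add: c_def M_def sum_divide_distrib[symmetric])
  have "sum c S - sum d S = 0"
    using w0 by (simp add: sum_subtractf[symmetric] cd sum_divide_distrib[symmetric])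
  then have d1: "sum d S = 1" using c1 by simp
  have "c \<in> realization N" "d \<in> realization N"
    using M c1 d1 sup simplicial_cpx_subset[OF N assms(2)] fS
    by (auto intro!: realizationI[OF N, where A=S] simp: c_def d_def)
  moreover have "pl_map \<alpha> c = pl_map \<alpha> d"
  proof
    fix i
    have "(\<Sum>s\<in>S. c s * \<alpha> s i) - (\<Sum>s\<in>S. d s * \<alpha> s i) = (\<Sum>s\<in>S. w s * \<alpha> s i) / M"
      by (simp add: sum_subtractf[symmetric] left_diff_distrib[symmetric] cd sum_divide_distrib)
    then show "pl_map \<alpha> c i = pl_map \<alpha> d i"
      unfolding pl_map_eq[OF fS sup(1)] pl_map_eq[OF fS sup(2)] using w1 by simp
  qed
  ultimately have "c = d" using triangD(2)[OF assms(1)] by (meson inj_onD)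
  then have "w s0 / M = 0" using cd[of s0] by simp
  then show False using M s0 by simp
qed

text \<open>The condition on intersecting hulls is the injectivity of
  \<open>pl_map \<alpha>\<close>: the images of the coordinates supported in \<open>S\<close> and in
  \<open>S'\<close> meet in the image of those supported in \<open>S \<inter> S'\<close>.\<close>

lemma triang_subdivision:
  assumes K: "simplicial_cpx K" and t: "triang N \<alpha> K"
  shows "subdivision_of ((`) \<alpha> ` N) K"
proof -
  note N = triangD(1)[OF t] and hull = triang_hull[OF t]
  have inj: "inj_on \<alpha> (verts N)" by (rule triang_inj_on_verts[OF t])
  have "simplicial_cpx ((`) \<alpha> ` N)"
    unfolding simplicial_cpx_def
  proof (intro conjI ballI allI impI)
    fix \<sigma> \<tau> assume "\<sigma> \<in> (`) \<alpha> ` N" "\<tau> \<subseteq> \<sigma>"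
    then obtain S where S: "S \<in> N" "\<tau> \<subseteq> \<alpha> ` S" by auto
    then obtain R where "R \<subseteq> S" "\<tau> = \<alpha> ` R" by (meson subset_imageE)
    then show "\<tau> \<in> (`) \<alpha> ` N" using simplicial_cpx_subset[OF N S(1)] by auto
  qed (use N in \<open>auto simp: simplicial_cpx_def\<close>)
  moreover have "convex hull (\<alpha> ` S) \<inter> convex hull (\<alpha> ` S') = convex hull (\<alpha> ` S \<inter> \<alpha> ` S')"
    if S: "S \<in> N" "S' \<in> N" for S S'
  proof -
    have i: "\<alpha> ` S \<inter> \<alpha> ` S' = \<alpha> ` (S \<inter> S')"
      using inj_on_image_Int[OF inj, of S S'] S by auto
    have SS: "S \<inter> S' \<in> N" using simplicial_cpx_subset[OF N S(1)] by auto
    have "pl_map \<alpha> ` {c \<in> realization N. supp c \<subseteq> S} \<inter> pl_map \<alpha> ` {c \<in> realization N. supp c \<subseteq> S'}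
       = pl_map \<alpha> ` ({c \<in> realization N. supp c \<subseteq> S} \<inter> {c \<in> realization N. supp c \<subseteq> S'})"
      by (rule inj_on_image_Int[OF triangD(2)[OF t], symmetric]) auto
    also have "{c \<in> realization N. supp c \<subseteq> S} \<inter> {c \<in> realization N. supp c \<subseteq> S'}
        = {c \<in> realization N. supp c \<subseteq> S \<inter> S'}" by auto
    finally show ?thesis unfolding i hull[OF S(1)] hull[OF S(2)] hull[OF SS] .
  qed
  moreover have "(\<Union>S\<in>(`) \<alpha> ` N. convex hull S) = realization K"
  proof -
    have "(\<Union>S\<in>(`) \<alpha> ` N. convex hull S) = pl_map \<alpha> ` (\<Union>S\<in>N. {c \<in> realization N. supp c \<subseteq> S})"
      by (simp add: hull image_UN)
    also have "(\<Union>S\<in>N. {c \<in> realization N. supp c \<subseteq> S}) = realization N"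
      using realizationD(2)[OF N] by auto
    finally show ?thesis using triangD(3)[OF t] by simp
  qed
  moreover have "\<exists>\<sigma>\<in>K. convex hull (\<alpha> ` S) \<subseteq> cell \<sigma>" if "S \<in> N" for S
    using triangD(4)[OF t that] unfolding cell_def by (meson convex_convex_hull hull_minimal)
  ultimately show ?thesis
    using triang_affine_independent[OF t] by (auto simp: subdivision_of_def geometric_cpx_def)
qed

lemma supp_combination:
  fixes c d :: "'a \<Rightarrow> real"
  shows "supp (\<lambda>s. u * c s + v * d s) \<subseteq> supp c \<union> supp d"
  by auto

lemma pl_map_combination:
  assumes "finite (supp c)" "finite (supp d)"
  shows "pl_map \<alpha> (\<lambda>s. u * c s + v * d s) i = u * pl_map \<alpha> c i + v * pl_map \<alpha> d i"
proof -
  have "finite (supp c \<union> supp d)" using assms by simp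
  note e = pl_map_eq[OF this]
  show ?thesis
    by (subst (1 2 3) e) (auto simp: sum_distrib_left sum.distrib[symmetric] algebra_simps)
qed

lemma triang_PL_on:
  assumes K: "simplicial_cpx K" and t: "triang N \<alpha> K"
    and f: "\<And>c. c \<in> realization N \<Longrightarrow> f (pl_map \<alpha> c) = pl_map \<beta> c"
  shows "PL_on K f"
  unfolding PL_on_def
proof (intro exI[of _ "(`) \<alpha> ` N"] conjI ballI)
  note N = triangD(1)[OF t]
  show "subdivision_of ((`) \<alpha> ` N) K" by (rule triang_subdivision[OF K t])
  fix X assume "X \<in> (`) \<alpha> ` N"
  then obtain S where S: "S \<in> N" "X = \<alpha> ` S" by auto
  show "affine_map_on (convex hull X) f"
    unfolding affine_map_on_def S(2) triang_hull[OF t S(1)]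
  proof (clarify)
    fix c d and u :: real
    assume c: "c \<in> realization N" "supp c \<subseteq> S" and d: "d \<in> realization N" "supp d \<subseteq> S" and u: "u \<in> {0..1}"
    define e where "e = (\<lambda>s. (1 - u) * c s + u * d s)"
    have fS: "finite S" using simplicial_cpx_finite_face[OF N S(1)] .
    have eS: "supp e \<subseteq> S" using supp_combination[of "1 - u" c u d] c(2) d(2) unfolding e_def by blast
    have "sum e S = 1"
      unfolding e_def sum.distrib sum_distrib_left[symmetric]
      using realizationD(4)[OF N c(1) fS c(2)] realizationD(4)[OF N d(1) fS d(2)] by simp
    then have e: "e \<in> realization N"
      using u realizationD(1)[OF N c(1)] realizationD(1)[OF N d(1)] eS fS simplicial_cpx_subset[OF N S(1) eS]
      by (intro realizationI[OF N, where A=S]) (auto simp: e_def)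
    have pe: "(1 - u) *\<^sub>R pl_map \<gamma> c + u *\<^sub>R pl_map \<gamma> d = pl_map \<gamma> e" for \<gamma> :: "_ \<Rightarrow> 'z \<Rightarrow> real"
      unfolding e_def fun_eq_iff
      by (simp add: scaleR_fun_def
          pl_map_combination[OF realizationD(3)[OF N c(1)] realizationD(3)[OF N d(1)]])
    show "f ((1 - u) *\<^sub>R pl_map \<alpha> c + u *\<^sub>R pl_map \<alpha> d)
        = (1 - u) *\<^sub>R f (pl_map \<alpha> c) + u *\<^sub>R f (pl_map \<alpha> d)"
      unfolding pe f[OF c(1)] f[OF d(1)] f[OF e] ..
  qed
qed

text \<open>Changing the positions of the labels from \<open>\<alpha>\<close> to
  \<open>\<beta>\<close> is the homeomorphism. This is the converse of
  \<open>PL_homeomorphic_triang\<close>: a PL homeomorphism amounts to one complex with two families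
  of positions.\<close>

lemma triang_PL_homeomorphic:
  fixes K :: "'v::countable cpx" and L :: "'w::countable cpx"
  assumes K: "simplicial_cpx K" and L: "simplicial_cpx L"
    and tK: "triang N \<alpha> K" and tL: "triang N \<beta> L"
  shows "PL_homeomorphic K L"
proof -
  obtain g where g: "homeomorphism (realization N) (realization K) (pl_map \<alpha>) g"
    by (rule triang_homeomorphism[OF tK])
  obtain h where h: "homeomorphism (realization N) (realization L) (pl_map \<beta>) h"
    by (rule triang_homeomorphism[OF tL])
  have "homeomorphism (realization K) (realization L) (pl_map \<beta> \<circ> g) (pl_map \<alpha> \<circ> h)"
    using g h homeomorphism_compose homeomorphism_symD by blast
  moreover have "PL_on K (pl_map \<beta> \<circ> g)"
    by (rule triang_PL_on[OF K tK]) (use g in \<open>auto simp: homeomorphism_def\<close>)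
  moreover have "PL_on L (pl_map \<alpha> \<circ> h)"
    by (rule triang_PL_on[OF L tL]) (use h in \<open>auto simp: homeomorphism_def\<close>)
  ultimately show ?thesis unfolding PL_homeomorphic_def by blast
qed

section \<open>Cutting along hyperplanes\<close>

text \<open>The stellar subdivision of the edge \<open>{a, b}\<close>. The second part is the cone
  with apex \<open>z\<close> over the faces of the closed star of the edge that do not contain the
  edge.\<close>

definition edge_star :: "'a cpx \<Rightarrow> 'a \<Rightarrow> 'a \<Rightarrow> 'a \<Rightarrow> 'a cpx" where
  "edge_star N a b z = {S \<in> N. \<not> {a, b} \<subseteq> S} \<union> {insert z S |S. \<not> {a, b} \<subseteq> S \<and> S \<union> {a, b} \<in> N}"

lemma edge_star_cases:
  assumes "R \<in> edge_star N a b z"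
  obtains "R \<in> N" "\<not> {a, b} \<subseteq> R" | S where "R = insert z S" "\<not> {a, b} \<subseteq> S" "S \<union> {a, b} \<in> N"
  using assms unfolding edge_star_def by blast

lemma simplicial_cpx_edge_star:
  assumes N: "simplicial_cpx N" and z: "z \<notin> verts N"
  shows "simplicial_cpx (edge_star N a b z)"
proof -
  have sub: "edge_star N a b z \<subseteq> Pow (insert z (verts N))"
    unfolding edge_star_def by auto
  have fin: "finite (insert z (verts N))" using simplicial_cpx_finite_verts[OF N] by simp
  have "Q \<in> edge_star N a b z" if R: "R \<in> edge_star N a b z" and Q: "Q \<subseteq> R" for Q R
    using R
  proof (cases rule: edge_star_cases)
    case 1
    then show ?thesis using Q simplicial_cpx_subset[OF N] by (auto simp: edge_star_def)
  next
    case (2 S)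
    show ?thesis
    proof (cases "z \<in> Q")
      case True
      have "(Q - {z}) \<union> {a, b} \<subseteq> S \<union> {a, b}" using Q 2(1) by auto
      then have "(Q - {z}) \<union> {a, b} \<in> N" by (rule simplicial_cpx_subset[OF N 2(3)])
      moreover have "\<not> {a, b} \<subseteq> Q - {z}" using 2(1,2) Q by auto
      ultimately show ?thesis using True unfolding edge_star_def
        by (intro UnI2 CollectI exI[of _ "Q - {z}"]) auto
    next
      case False
      then have "Q \<subseteq> S" using Q 2(1) by auto
      then have "Q \<in> N" "\<not> {a, b} \<subseteq> Q" using 2(2) simplicial_cpx_subset[OF N 2(3), of Q] by auto
      then show ?thesis by (simp add: edge_star_def)
    qed
  qed
  moreover have "{} \<in> edge_star N a b z"
    using simplicial_cpx_empty[OF N] by (auto simp: edge_star_def)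
  ultimately show ?thesis
    using sub fin unfolding simplicial_cpx_def by (meson PowD finite_Pow_iff finite_subset subset_eq)
qed

text \<open>Passes from coordinates in the subdivision to coordinates in \<open>N\<close>: the
  weight of \<open>z\<close>, a point of the edge, is handed to \<open>a\<close> and
  \<open>b\<close> in the proportion \<open>1 - t\<close> to \<open>t\<close>.\<close>

definition star_coords :: "'a \<Rightarrow> 'a \<Rightarrow> 'a \<Rightarrow> real \<Rightarrow> ('a \<Rightarrow> real) \<Rightarrow> 'a \<Rightarrow> real" where
  "star_coords a b z t c = c(z := 0, a := c a + (1 - t) * c z, b := c b + t * c z)"

lemma bij_betw_star_coords:
  assumes N: "simplicial_cpx N" and ab: "{a, b} \<in> N" "a \<noteq> b" and z: "z \<notin> verts N"
    and t: "0 < t" "t < 1"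
  shows "bij_betw (star_coords a b z t) (realization (edge_star N a b z)) (realization N)"
proof -
  let ?N = "edge_star N a b z"
  note N' = simplicial_cpx_edge_star[OF N z, of a b]
  \<comment> \<open>The inverse moves weight from \<open>a\<close> and \<open>b\<close> back to
    \<open>z\<close> in the same proportion. \<open>m\<close> is the largest amount possible;
    afterwards \<open>a\<close> or \<open>b\<close> has weight zero, as befits a face without the
    edge.\<close>
  define m where "m = (\<lambda>c :: 'a \<Rightarrow> real. min (c a / (1 - t)) (c b / t))"
  define R where "R = (\<lambda>c. c(z := m c, a := c a - (1 - t) * m c, b := c b - t * m c))"
  define V where "V = verts N - {a, b}"
  have abV: "verts N = insert a (insert b V)" "a \<notin> V" "b \<notin> V" "z \<notin> V" "a \<noteq> z" "b \<noteq> z"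
    using ab z unfolding V_def by auto
  have fV: "finite V" using simplicial_cpx_finite_verts[OF N] V_def by simp
  let ?W = "insert z (insert a (insert b V))"
  have sumW: "sum c ?W = c z + c a + c b + sum c V" for c :: "'a \<Rightarrow> real"
    using fV abV ab by simp
  have ver: "verts ?N \<subseteq> ?W" unfolding edge_star_def using abV(1) by auto
  have vN: "verts N \<subseteq> ?W" using abV by auto
  have fW: "finite ?W" using fV by simp
  have E: "star_coords a b z t c \<in> realization N" if c: "c \<in> realization ?N" for c
  proof (rule realizationI[OF N _ _ fW])
    let ?e = "star_coords a b z t c"
    note nn = realizationD(1)[OF N' c]
    have "sum ?e V = sum c V" using abV by (intro sum.cong) (auto simp: star_coords_def)
    moreover have "c z + c a + c b + sum c V = 1"
      using realizationD(4)[OF N' c fW] realizationD(5)[OF N' c] ver sumW by auto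
    ultimately show "sum ?e ?W = 1"
      unfolding sumW using abV ab by (simp add: star_coords_def algebra_simps)
    show "0 \<le> ?e i" for i using nn t by (auto simp: star_coords_def)
    show "supp ?e \<in> N"
    proof (cases "c z = 0")
      case True
      then have "?e = c" by (auto simp: star_coords_def fun_eq_iff)
      moreover have "supp c \<in> N"
        using realizationD(2)[OF N' c] True by (cases rule: edge_star_cases) auto
      ultimately show ?thesis by simp
    next
      case False
      then have cz: "0 < c z" using nn[of z] by simp
      obtain S where S: "supp c = insert z S" "S \<union> {a, b} \<in> N"
        using realizationD(2)[OF N' c]
      proof (cases rule: edge_star_cases)
        case 1
        then show ?thesis using False z by auto
      qed (use that in blast)
      have "supp ?e \<subseteq> S \<union> {a, b}"
        using S(1) by (auto simp: star_coords_def split: if_splits)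
      then show ?thesis using simplicial_cpx_subset[OF N S(2)] by blast
    qed
    show "supp ?e \<subseteq> ?W"
      using realizationD(5)[OF N' c] ver by (auto simp: star_coords_def split: if_splits)
  qed
  have Rr: "R c \<in> realization ?N" if c: "c \<in> realization N" for c
  proof (rule realizationI[OF N' _ _ fW])
    note nn = realizationD(1)[OF N c]
    have m0: "0 \<le> m c" using nn t by (simp add: m_def)
    have ma: "(1 - t) * m c \<le> c a" "t * m c \<le> c b"
      using t unfolding m_def
      by (metis diff_gt_0_iff_gt min.cobounded1 mult.commute pos_le_divide_eq,
          metis min.cobounded2 mult.commute pos_le_divide_eq)
    show "0 \<le> R c i" for i using nn m0 ma by (auto simp: R_def)
    have cz: "c z = 0" using realizationD(5)[OF N c] z by blast
    show sW: "supp (R c) \<subseteq> ?W"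
      using realizationD(5)[OF N c] vN by (auto simp: R_def split: if_splits)
    have "sum (R c) V = sum c V" using abV by (intro sum.cong) (auto simp: R_def)
    moreover have "c a + c b + sum c V = 1"
      using realizationD(4)[OF N c fW] realizationD(5)[OF N c] vN sumW[of c] cz by auto
    ultimately show "sum (R c) ?W = 1"
      unfolding sumW using abV ab by (simp add: R_def algebra_simps)
    have zero: "R c a = 0 \<or> R c b = 0"
      using t abV ab(2) by (auto simp: R_def m_def min_def)
    show "supp (R c) \<in> ?N"
    proof (cases "m c = 0")
      case True
      then have "R c = c" using cz by (auto simp: R_def fun_eq_iff)
      then show ?thesis using zero realizationD(2)[OF N c] by (auto simp: edge_star_def)
    next
      case False
      then have mp: "0 < m c" using m0 by simp
      then have "c a \<noteq> 0" "c b \<noteq> 0" using ma t by (smt (verit) mult_pos_pos)+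
      then have s: "supp c = (supp (R c) - {z}) \<union> {a, b}"
        using cz abV by (auto simp: R_def split: if_splits)
      have "supp (R c) = insert z (supp (R c) - {z})" using mp abV by (auto simp: R_def)
      moreover have "\<not> {a, b} \<subseteq> supp (R c) - {z}" using zero by auto
      moreover have "(supp (R c) - {z}) \<union> {a, b} \<in> N" using s realizationD(2)[OF N c] by simp
      ultimately show ?thesis unfolding edge_star_def by blast
    qed
  qed
  have RE: "R (star_coords a b z t c) = c" if c: "c \<in> realization ?N" for c
  proof -
    note nn = realizationD(1)[OF N' c]
    have zero: "c z = 0 \<or> c a = 0 \<or> c b = 0" "c z = 0 \<longrightarrow> c a = 0 \<or> c b = 0"
      using realizationD(2)[OF N' c] by (cases rule: edge_star_cases; use z in auto)+
    have "m (star_coords a b z t c) = min (c a / (1 - t) + c z) (c b / t + c z)"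
      using t abV ab(2) by (simp add: m_def star_coords_def add_divide_distrib)
    also have "\<dots> = c z"
    proof -
      have "0 \<le> c a / (1 - t)" "0 \<le> c b / t" "c a / (1 - t) = 0 \<or> c b / t = 0"
        using zero nn[of a] nn[of b] t by auto
      then show ?thesis by (auto simp: min_def)
    qed
    finally show ?thesis using abV ab(2) by (auto simp: R_def star_coords_def fun_eq_iff)
  qed
  have ER: "star_coords a b z t (R c) = c" if c: "c \<in> realization N" for c
  proof -
    have cz: "c z = 0" using realizationD(5)[OF N c] z by blast
    then show ?thesis using abV ab(2) by (auto simp: R_def star_coords_def fun_eq_iff)
  qed
  show ?thesis
    by (rule bij_betw_byWitness[where f'=R]) (use E Rr RE ER in auto)
qed

lemma cell_convex_comb:
  assumes "x \<in> cell \<sigma>" "y \<in> cell \<sigma>" "0 \<le> t" "t \<le> 1"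
  shows "(\<lambda>i. (1 - t) * x i + t * y i) \<in> cell \<sigma>"
  using assms convex_convex_hull[of "vertex_pt ` \<sigma>"] unfolding cell_def convex_fun_iff by auto

lemma triang_edge_star:
  assumes tr: "triang N \<alpha> K" and ab: "{a, b} \<in> N" "a \<noteq> b" and z: "z \<notin> verts N"
    and t: "0 < t" "t < 1"
  shows "triang (edge_star N a b z) (\<alpha>(z := \<lambda>i. (1 - t) * \<alpha> a i + t * \<alpha> b i)) K"
proof -
  let ?N = "edge_star N a b z" and ?\<alpha> = "\<alpha>(z := \<lambda>i. (1 - t) * \<alpha> a i + t * \<alpha> b i)"
  note N = triangD(1)[OF tr]
  note N' = simplicial_cpx_edge_star[OF N z, of a b]
  have zab: "z \<noteq> a" "z \<noteq> b" using ab z by auto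
  note bij = bij_betw_star_coords[OF N ab z t]
  have eq: "pl_map ?\<alpha> c = (pl_map \<alpha> \<circ> star_coords a b z t) c" if c: "c \<in> realization ?N" for c
  proof
    fix i
    have e: "star_coords a b z t c \<in> realization N" using bij c by (auto simp: bij_betw_def)
    define V where "V = (supp c \<union> verts N) - {a, b, z}"
    have V: "finite V" "a \<notin> V" "b \<notin> V" "z \<notin> V"
      using realizationD(3)[OF N' c] simplicial_cpx_finite_verts[OF N] V_def by auto
    let ?W = "insert z (insert a (insert b V))"
    have fW: "finite ?W" using V by simp
    have s1: "supp c \<subseteq> ?W" unfolding V_def by blast
    have s2: "supp (star_coords a b z t c) \<subseteq> ?W" by (rule order_trans[OF realizationD(5)[OF N e]]) (auto simp: V_def)
    have "(\<Sum>s\<in>V. c s * ?\<alpha> s i) = (\<Sum>s\<in>V. star_coords a b z t c s * \<alpha> s i)"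
      using V by (intro sum.cong) (auto simp: star_coords_def)
    then show "pl_map ?\<alpha> c i = (pl_map \<alpha> \<circ> star_coords a b z t) c i"
      using V zab ab(2) unfolding o_def pl_map_eq[OF fW s1] pl_map_eq[OF fW s2]
      by (simp add: star_coords_def algebra_simps)
  qed
  have "bij_betw (pl_map \<alpha> \<circ> star_coords a b z t) (realization ?N) (realization K)"
    using bij tr unfolding triang_def by (blast intro: bij_betw_trans)
  then have bij': "bij_betw (pl_map ?\<alpha>) (realization ?N) (realization K)"
    using bij_betw_cong[of "realization ?N" "pl_map ?\<alpha>" "pl_map \<alpha> \<circ> star_coords a b z t"] eq by blast
  have "\<exists>\<sigma>\<in>K. ?\<alpha> ` R \<subseteq> cell \<sigma>" if R: "R \<in> ?N" for R
    using R
  proof (cases rule: edge_star_cases)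
    case 1
    then have "?\<alpha> ` R = \<alpha> ` R" using z by (intro image_cong) auto
    then show ?thesis using triangD(4)[OF tr 1(1)] by simp
  next
    case (2 S)
    obtain \<sigma> where \<sigma>: "\<sigma> \<in> K" "\<alpha> ` (S \<union> {a, b}) \<subseteq> cell \<sigma>" using triangD(4)[OF tr 2(3)] by blast
    then have "(\<lambda>i. (1 - t) * \<alpha> a i + t * \<alpha> b i) \<in> cell \<sigma>"
      using t by (intro cell_convex_comb) auto
    then have "?\<alpha> ` R \<subseteq> cell \<sigma>" using \<sigma>(2) 2(1) by auto
    then show ?thesis using \<sigma>(1) by blast
  qed
  then show ?thesis using N' bij' by (auto simp: triang_def)
qed

section \<open>Simplices on one side of a hyperplane\<close>

definition unseparated :: "(('w \<Rightarrow> real) \<Rightarrow> real) \<Rightarrow> 'a cpx \<Rightarrow> ('a \<Rightarrow> 'w \<Rightarrow> real) \<Rightarrow> bool" where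
  "unseparated g N \<beta> \<longleftrightarrow> (\<forall>S\<in>N. (\<forall>s\<in>S. 0 \<le> g (\<beta> s)) \<or> (\<forall>s\<in>S. g (\<beta> s) \<le> 0))"

definition affine_functional :: "(('w \<Rightarrow> real) \<Rightarrow> real) \<Rightarrow> bool" where
  "affine_functional g \<longleftrightarrow> (\<forall>x y t. g (\<lambda>i. (1 - t) * x i + t * y i) = (1 - t) * g x + t * g y)"

text \<open>Earlier cuts survive later ones: a new simplex lies in the simplex spanned by
  \<open>S\<close> and the edge, which is already on one side of the hyperplane.\<close>

lemma unseparated_edge_star:
  assumes "simplicial_cpx N" "affine_functional g" "unseparated g N \<beta>" "z \<notin> verts N" "0 < t" "t < 1"
  shows "unseparated g (edge_star N a b z) (\<beta>(z := \<lambda>i. (1 - t) * \<beta> a i + t * \<beta> b i))"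
  unfolding unseparated_def
proof
  fix R assume "R \<in> edge_star N a b z"
  then show "(\<forall>s\<in>R. 0 \<le> g ((\<beta>(z := \<lambda>i. (1 - t) * \<beta> a i + t * \<beta> b i)) s)) \<or>
      (\<forall>s\<in>R. g ((\<beta>(z := \<lambda>i. (1 - t) * \<beta> a i + t * \<beta> b i)) s) \<le> 0)"
  proof (cases rule: edge_star_cases)
    case 1
    have "z \<notin> R" using 1 assms(4) by auto
    then have "(\<beta>(z := x)) s = \<beta> s" if "s \<in> R" for s x using that by auto
    then show ?thesis using assms(3) 1(1) by (simp add: unseparated_def)
  next
    case (2 S)
    have e: "g (\<lambda>i. (1 - t) * \<beta> a i + t * \<beta> b i) = (1 - t) * g (\<beta> a) + t * g (\<beta> b)"
      by (rule assms(2)[unfolded affine_functional_def, rule_format])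
    from bspec[OF assms(3)[unfolded unseparated_def] 2(3)] show ?thesis
    proof (elim disjE)
      assume 1: "\<forall>s\<in>S \<union> {a, b}. 0 \<le> g (\<beta> s)"
      then have "0 \<le> (1 - t) * g (\<beta> a) + t * g (\<beta> b)" using assms(5,6) by simp
      then show ?thesis using 1 2(1) e by auto
    next
      assume neg: "\<forall>s\<in>S \<union> {a, b}. g (\<beta> s) \<le> 0"
      then have "(1 - t) * g (\<beta> a) \<le> 0" "t * g (\<beta> b) \<le> 0"
        using assms(5,6) by (auto simp: mult_le_0_iff)
      then show ?thesis using neg 2(1) e by auto
    qed
  qed
qed

text \<open>Starring an edge that crosses the hyperplane in its intersection point with the hyperplane
  creates no new crossing edge.\<close>
lemma cut_by_functional:
  fixes N :: "'a cpx"
  assumes inf: "infinite (UNIV :: 'a set)"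
    and "triang N \<alpha> K" "triang N \<beta> L" "a0 \<in> verts N" "affine_functional g"
    and "\<forall>h\<in>H. affine_functional h \<and> unseparated h N \<beta>"
  shows "\<exists>(N' :: 'a cpx) \<alpha>' \<beta>'. triang N' \<alpha>' K \<and> triang N' \<beta>' L \<and> a0 \<in> verts N' \<and>
     \<alpha>' a0 = \<alpha> a0 \<and> \<beta>' a0 = \<beta> a0 \<and> (\<forall>h\<in>insert g H. unseparated h N' \<beta>')"
  using assms(2-)
proof (induction "card {(a, b). {a, b} \<in> N \<and> g (\<beta> a) < 0 \<and> 0 < g (\<beta> b)}"
    arbitrary: N \<alpha> \<beta> rule: less_induct)
  case less
  note N = triangD(1)[OF less.prems(1)]
  define X where "X = (\<lambda>(N :: 'a cpx) \<beta>. {(a, b). {a, b} \<in> N \<and> g (\<beta> a) < 0 \<and> 0 < g (\<beta> b)})"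
  have X_mem: "(a, b) \<in> X N \<beta> \<longleftrightarrow> {a, b} \<in> N \<and> g (\<beta> a) < 0 \<and> 0 < g (\<beta> b)" for a b N \<beta>
    by (simp add: X_def)
  have fX: "finite (X N \<beta>)"
    by (rule finite_subset[of _ "verts N \<times> verts N"]) (auto simp: X_def simplicial_cpx_finite_verts[OF N])
  show ?case
  proof (cases "X N \<beta> = {}")
    case True
    have "unseparated g N \<beta>"
      unfolding unseparated_def
    proof (rule ballI, rule ccontr)
      fix S assume S: "S \<in> N" and "\<not> ((\<forall>s\<in>S. 0 \<le> g (\<beta> s)) \<or> (\<forall>s\<in>S. g (\<beta> s) \<le> 0))"
      then obtain a b where "a \<in> S" "b \<in> S" "g (\<beta> a) < 0" "0 < g (\<beta> b)" by (meson not_le)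
      then have "(a, b) \<in> X N \<beta>" using simplicial_cpx_subset[OF N S, of "{a, b}"] by (simp add: X_mem)
      then show False using True by simp
    qed
    then show ?thesis using less.prems by blast
  next
    case False
    then obtain a b where abX: "(a, b) \<in> X N \<beta>" by auto
    then have ab: "{a, b} \<in> N" "g (\<beta> a) < 0" "0 < g (\<beta> b)" by (auto simp: X_mem)
    then have ne: "a \<noteq> b" by auto
    obtain z where z: "z \<notin> verts N"
      using ex_new_if_finite[OF inf simplicial_cpx_finite_verts[OF N]] by blast
    \<comment> \<open>The zero of the affine function \<open>g\<close> along the edge; it is
      strictly inside because the ends have opposite signs.\<close>
    define t where "t = - g (\<beta> a) / (g (\<beta> b) - g (\<beta> a))"
    have t: "0 < t" "t < 1" using ab by (auto simp: t_def field_simps)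
    define N' where "N' = edge_star N a b z"
    define \<alpha>' where "\<alpha>' = \<alpha>(z := \<lambda>i. (1 - t) * \<alpha> a i + t * \<alpha> b i)"
    define \<beta>' where "\<beta>' = \<beta>(z := \<lambda>i. (1 - t) * \<beta> a i + t * \<beta> b i)"
    have tr: "triang N' \<alpha>' K" "triang N' \<beta>' L"
      unfolding N'_def \<alpha>'_def \<beta>'_def
      using triang_edge_star[OF less.prems(1) ab(1) ne z t] triang_edge_star[OF less.prems(2) ab(1) ne z t]
      by auto
    \<comment> \<open>The label \<open>a0\<close> has to persist with both of its positions, because
      the link at this label is taken after all the cuts.\<close>
    have "{a0} \<in> N'"
      using less.prems(3) simplicial_cpx_vertex[OF N] ne by (auto simp: N'_def edge_star_def)
    then have a0: "a0 \<in> verts N'" by auto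
    have a0z: "a0 \<noteq> z" using less.prems(3) z by auto
    have gz: "g (\<beta>' z) = 0"
    proof -
      have "g (\<beta>' z) = (1 - t) * g (\<beta> a) + t * g (\<beta> b)"
        unfolding \<beta>'_def fun_upd_same by (rule less.prems(4)[unfolded affine_functional_def, rule_format])
      also have "\<dots> = 0" using ab by (simp add: t_def field_simps)
      finally show ?thesis .
    qed
    have sub: "X N' \<beta>' \<subseteq> X N \<beta> - {(a, b)}"
    proof
      fix p assume p: "p \<in> X N' \<beta>'"
      obtain c d where cd: "p = (c, d)" by fastforce
      have X: "{c, d} \<in> N'" "g (\<beta>' c) < 0" "0 < g (\<beta>' d)" using p cd by (auto simp: X_mem)
      then have cz: "c \<noteq> z" "d \<noteq> z" using gz by auto
      have "{c, d} \<in> N \<and> \<not> {a, b} \<subseteq> {c, d}"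
        using X(1) unfolding N'_def by (cases rule: edge_star_cases) (use cz in auto)
      then show "p \<in> X N \<beta> - {(a, b)}" using X cz cd by (auto simp: X_mem \<beta>'_def)
    qed
    then have "card (X N' \<beta>') < card (X N \<beta>)"
      using fX abX by (meson card_mono card_Diff1_less finite_Diff le_less_trans)
    moreover have "\<forall>h\<in>H. affine_functional h \<and> unseparated h N' \<beta>'"
      using less.prems(5) unseparated_edge_star[OF N _ _ z t] unfolding N'_def \<beta>'_def by blast
    ultimately have "\<exists>(N'' :: 'a cpx) \<alpha>'' \<beta>''. triang N'' \<alpha>'' K \<and> triang N'' \<beta>'' L \<and> a0 \<in> verts N'' \<and>
     \<alpha>'' a0 = \<alpha>' a0 \<and> \<beta>'' a0 = \<beta>' a0 \<and> (\<forall>h\<in>insert g H. unseparated h N'' \<beta>'')"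
      using less.hyps[of N' \<beta>' \<alpha>'] tr a0 less.prems(4) unfolding X_def by blast
    moreover have "\<alpha>' a0 = \<alpha> a0" "\<beta>' a0 = \<beta> a0" using a0z by (auto simp: \<alpha>'_def \<beta>'_def)
    ultimately show ?thesis by simp
  qed
qed

lemma cut_by_functionals:
  fixes N :: "'a cpx"
  assumes "infinite (UNIV :: 'a set)" "triang N \<alpha> K" "triang N \<beta> L" "a0 \<in> verts N"
    and "finite G" "\<forall>g\<in>G. affine_functional g"
  shows "\<exists>(N' :: 'a cpx) \<alpha>' \<beta>'. triang N' \<alpha>' K \<and> triang N' \<beta>' L \<and> a0 \<in> verts N' \<and>
     \<alpha>' a0 = \<alpha> a0 \<and> \<beta>' a0 = \<beta> a0 \<and> (\<forall>g\<in>G. unseparated g N' \<beta>')"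
  using assms(5,6)
proof (induction G rule: finite_induct)
  case empty
  show ?case by (intro exI[of _ N] exI[of _ \<alpha>] exI[of _ \<beta>]) (use assms(2-4) in simp)
next
  case (insert g G)
  have "\<forall>g\<in>G. affine_functional g" using insert.prems by simp
  from insert.IH[OF this] obtain N' :: "'a cpx" and \<alpha>' \<beta>'
    where 1: "triang N' \<alpha>' K" "triang N' \<beta>' L" "a0 \<in> verts N'"
      "\<alpha>' a0 = \<alpha> a0" "\<beta>' a0 = \<beta> a0" "\<forall>g\<in>G. unseparated g N' \<beta>'"
    by (elim exE conjE)
  have "\<forall>h\<in>G. affine_functional h \<and> unseparated h N' \<beta>'" using 1(6) insert.prems by blast
  then show ?case
    using cut_by_functional[OF assms(1) 1(1,2,3), of g G] insert.prems 1(4,5) by simp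
qed

section \<open>Links of vertices in PL spheres\<close>

lemma pl_map_in_cell:
  assumes "finite (supp c)" "\<And>s. 0 \<le> c s" "sum c (supp c) = 1" "\<alpha> ` supp c \<subseteq> cell \<sigma>"
  shows "pl_map \<alpha> c \<in> cell \<sigma>"
proof -
  have "(\<Sum>s\<in>supp c. c s *\<^sub>R \<alpha> s) \<in> cell \<sigma>"
    using assms by (intro convex_sum) (auto simp: cell_def)
  also have "(\<Sum>s\<in>supp c. c s *\<^sub>R \<alpha> s) = pl_map \<alpha> c"
    by (auto simp: pl_map_def fun_eq_iff sum_fun_apply scaleR_fun_def)
  finally show ?thesis .
qed

text \<open>The star of \<open>a\<close> is a cone with apex \<open>\<alpha> a\<close>. If \<open>Q\<close> is linear on the simplices of the star,
  vanishes at the apex and maps the directions at the apex bijectively to the cone over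
  \<open>realization M\<close>, then radial projection of the images subdivides \<open>M\<close>.\<close>
lemma triang_link:
  fixes \<alpha> :: "'a \<Rightarrow> 'v::countable \<Rightarrow> real" and Q :: "('v \<Rightarrow> real) \<Rightarrow> 'w \<Rightarrow> real"
  assumes tr: "triang N \<alpha> K" and M: "simplicial_cpx M" and a: "a \<in> verts N"
    and lin: "\<And>S c. S \<in> link N a \<Longrightarrow> c \<in> realization N \<Longrightarrow> supp c \<subseteq> insert a S \<Longrightarrow>
          Q (pl_map \<alpha> c) = (\<lambda>j. \<Sum>s\<in>S. c s * Q (\<alpha> s) j)"
    and inj: "\<And>c d. c \<in> realization N \<Longrightarrow> d \<in> realization N \<Longrightarrow> insert a (supp c) \<in> N \<Longrightarrow>
          insert a (supp d) \<in> N \<Longrightarrow> Q (pl_map \<alpha> c) = Q (pl_map \<alpha> d) \<Longrightarrow> pl_map \<alpha> c = pl_map \<alpha> d"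
    and Qa: "Q (\<alpha> a) = (\<lambda>j. 0)"
    and cells: "\<And>S. S \<in> link N a \<Longrightarrow> \<exists>\<sigma>\<in>M. \<forall>s\<in>S. (\<forall>j. 0 \<le> Q (\<alpha> s) j) \<and> supp (Q (\<alpha> s)) \<subseteq> \<sigma>"
    and dirs: "\<And>w. w \<in> realization M \<Longrightarrow> \<exists>u e. 0 < e \<and> (\<forall>t. 0 < t \<and> t < e \<longrightarrow>
          (\<lambda>i. \<alpha> a i + t * u i) \<in> realization K \<and> Q (\<lambda>i. \<alpha> a i + t * u i) = (\<lambda>j. t * w j))"
  shows "triang (link N a) (\<lambda>s j. Q (\<alpha> s) j / sum (Q (\<alpha> s)) (verts M)) M"
proof -
  note N = triangD(1)[OF tr]
  note lN = simplicial_cpx_link[OF N a]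
  have aN: "{a} \<in> N" using a simplicial_cpx_vertex[OF N] by blast
  have fM: "finite (verts M)" by (rule simplicial_cpx_finite_verts[OF M])
  define m where "m = (\<lambda>s. sum (Q (\<alpha> s)) (verts M))"
  define \<gamma> where "\<gamma> = (\<lambda>s j. Q (\<alpha> s) j / m s)"
  have suppv: "supp (vertex_pt s) = {s}" for s :: 'a by (auto simp: vertex_pt_def)
  have linkD: "insert a S \<in> N" "a \<notin> S" if "S \<in> link N a" for S
    using that by (auto simp: link_def)
  \<comment> \<open>\<open>Q\<close> separates the points of the star and sends the apex to zero, so
    no other vertex goes to zero and the radial projection is defined at every vertex of the
    link.\<close>
  have mpos: "0 < m s" if s: "{s} \<in> link N a" for s
  proof -
    obtain \<sigma> where \<sigma>: "\<sigma> \<in> M" "\<forall>j. 0 \<le> Q (\<alpha> s) j" "supp (Q (\<alpha> s)) \<subseteq> \<sigma>"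
      using cells[OF s] by auto
    have "m s \<noteq> 0"
    proof
      assume "m s = 0"
      then have z: "\<forall>j\<in>verts M. Q (\<alpha> s) j = 0"
        unfolding m_def using \<sigma>(2) fM by (subst (asm) sum_nonneg_eq_0_iff) auto
      then have "Q (\<alpha> s) j = 0" for j using \<sigma>(1,3) by (cases "j \<in> verts M") auto
      then have "Q (pl_map \<alpha> (vertex_pt s)) = Q (pl_map \<alpha> (vertex_pt a))"
        unfolding pl_map_vertex_pt using Qa by auto
      moreover have "insert a {s} \<in> N" "{s} \<in> N"
        using linkD[OF s] simplicial_cpx_subset[OF N] by auto
      ultimately have "pl_map \<alpha> (vertex_pt s) = pl_map \<alpha> (vertex_pt a)"
        using inj[of "vertex_pt s" "vertex_pt a"] vertex_pt_in_realization[OF N] aN unfolding suppv by auto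
      then have "\<alpha> s = \<alpha> a" by (simp add: pl_map_vertex_pt)
      then have "s = a" using triang_inj_on_verts[OF tr] \<open>{s} \<in> N\<close> a by (auto dest: inj_onD)
      then show False using linkD[OF s] by simp
    qed
    moreover have "0 \<le> m s" unfolding m_def using \<sigma>(2) by (simp add: sum_nonneg)
    ultimately show ?thesis by simp
  qed
  have mpos': "0 < m s" if "S \<in> link N a" "s \<in> S" for s S
    using mpos simplicial_cpx_subset[OF lN that(1), of "{s}"] that(2) by auto
  have gcell: "\<exists>\<sigma>\<in>M. \<gamma> ` S \<subseteq> cell \<sigma>" if S: "S \<in> link N a" for S
  proof -
    obtain \<sigma> where \<sigma>: "\<sigma> \<in> M" "\<forall>s\<in>S. (\<forall>j. 0 \<le> Q (\<alpha> s) j) \<and> supp (Q (\<alpha> s)) \<subseteq> \<sigma>"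
      using cells[OF S] by auto
    have f\<sigma>: "finite \<sigma>" using simplicial_cpx_finite_face[OF M \<sigma>(1)] .
    have "\<gamma> s \<in> cell \<sigma>" if s: "s \<in> S" for s
    proof -
      have "sum (Q (\<alpha> s)) \<sigma> = m s"
        unfolding m_def using fM \<sigma> s by (intro sum.mono_neutral_left) auto
      then have "sum (\<gamma> s) \<sigma> = 1"
        using mpos'[OF S s] by (simp add: \<gamma>_def sum_divide_distrib[symmetric])
      moreover have "supp (\<gamma> s) \<subseteq> \<sigma>" using \<sigma>(2) s by (auto simp: \<gamma>_def)
      ultimately show ?thesis
        using \<sigma>(2) s mpos'[OF S s] unfolding cell_iff[OF f\<sigma>] by (auto simp: \<gamma>_def less_imp_le)
    qed
    then show ?thesis using \<sigma>(1) by blast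
  qed
  \<comment> \<open>The weight on the link that is needed to reach \<open>pl_map \<gamma> c\<close>.
    Scaling by an \<open>\<epsilon>\<close> with \<open>\<epsilon> * \<tau> c \<le> 1\<close> leaves
    a nonnegative weight for the apex.\<close>
  define \<tau> where "\<tau> = (\<lambda>c :: 'a \<Rightarrow> real. \<Sum>s\<in>supp c. c s / m s)"
  have \<tau>0: "0 \<le> \<tau> c" if c: "c \<in> realization (link N a)" for c
    unfolding \<tau>_def using realizationD(1)[OF lN c] mpos'[OF realizationD(2)[OF lN c]]
    by (intro sum_nonneg) (auto simp: less_imp_le)
  \<comment> \<open>Moving towards the apex brings the point into the star, where \<open>Q\<close>
    is known to be injective, and merely scales its value.\<close>
  have lift: "\<exists>c'. c' \<in> realization N \<and> insert a (supp c') \<in> N \<and>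
        Q (pl_map \<alpha> c') = (\<lambda>j. \<epsilon> * pl_map \<gamma> c j) \<and> (\<forall>s. s \<noteq> a \<longrightarrow> c' s = \<epsilon> * c s / m s)"
    if c: "c \<in> realization (link N a)" and \<epsilon>: "0 < \<epsilon>" "\<epsilon> * \<tau> c \<le> 1" for c \<epsilon>
  proof -
    let ?S = "supp c"
    define c' where "c' = (\<lambda>s. if s = a then 1 - \<epsilon> * \<tau> c else \<epsilon> * c s / m s)"
    note S = realizationD(2)[OF lN c] and fS = realizationD(3)[OF lN c]
    have ca: "a \<notin> ?S" using linkD[OF S] by simp
    have s': "supp c' \<subseteq> insert a ?S" by (auto simp: c'_def)
    have nn: "0 \<le> c' s" for s
    proof (cases "s \<in> ?S")
      case True
      then show ?thesis using \<epsilon> realizationD(1)[OF lN c] mpos'[OF S True] ca by (auto simp: c'_def)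
    qed (use \<epsilon> in \<open>auto simp: c'_def\<close>)
    have "sum c' ?S = \<epsilon> * \<tau> c"
      unfolding \<tau>_def sum_distrib_left using ca by (intro sum.cong) (auto simp: c'_def)
    then have "sum c' (insert a ?S) = 1" using fS ca by (simp add: c'_def)
    then have r: "c' \<in> realization N"
      using nn s' fS simplicial_cpx_subset[OF N linkD(1)[OF S] s']
      by (intro realizationI[OF N, where A="insert a ?S"]) auto
    have "insert a (supp c') \<subseteq> insert a ?S" using s' by blast
    then have i: "insert a (supp c') \<in> N" by (rule simplicial_cpx_subset[OF N linkD(1)[OF S]])
    have "(\<Sum>s\<in>?S. c' s * Q (\<alpha> s) j) = \<epsilon> * pl_map \<gamma> c j" for j
      unfolding pl_map_def sum_distrib_left using ca by (intro sum.cong) (auto simp: c'_def \<gamma>_def)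
    then have "Q (pl_map \<alpha> c') = (\<lambda>j. \<epsilon> * pl_map \<gamma> c j)" using lin[OF S r s'] by simp
    then show ?thesis using r i by (intro exI[of _ c']) (auto simp: c'_def)
  qed
  have "inj_on (pl_map \<gamma>) (realization (link N a))"
  proof (rule inj_onI)
    fix c d assume c: "c \<in> realization (link N a)" and d: "d \<in> realization (link N a)"
      and eq: "pl_map \<gamma> c = pl_map \<gamma> d"
    define \<epsilon> where "\<epsilon> = 1 / (1 + \<tau> c + \<tau> d)"
    have \<epsilon>: "0 < \<epsilon>" "\<epsilon> * \<tau> c \<le> 1" "\<epsilon> * \<tau> d \<le> 1"
      using \<tau>0[OF c] \<tau>0[OF d] by (auto simp: \<epsilon>_def field_simps)
    obtain c' where c': "c' \<in> realization N" "insert a (supp c') \<in> N"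
      "Q (pl_map \<alpha> c') = (\<lambda>j. \<epsilon> * pl_map \<gamma> c j)" "\<forall>s. s \<noteq> a \<longrightarrow> c' s = \<epsilon> * c s / m s"
      using lift[OF c \<epsilon>(1,2)] by blast
    obtain d' where d': "d' \<in> realization N" "insert a (supp d') \<in> N"
      "Q (pl_map \<alpha> d') = (\<lambda>j. \<epsilon> * pl_map \<gamma> d j)" "\<forall>s. s \<noteq> a \<longrightarrow> d' s = \<epsilon> * d s / m s"
      using lift[OF d \<epsilon>(1,3)] by blast
    have "pl_map \<alpha> c' = pl_map \<alpha> d'" using inj[OF c'(1) d'(1) c'(2) d'(2)] c'(3) d'(3) eq by simp
    then have "c' = d'" using triangD(2)[OF tr] c'(1) d'(1) by (auto dest: inj_onD)
    show "c = d"
    proof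
      fix s
      show "c s = d s"
      proof (cases "s \<in> supp c \<union> supp d")
        case True
        then have "0 < m s" "s \<noteq> a"
          using mpos' linkD realizationD(2)[OF lN c] realizationD(2)[OF lN d] by blast+
        then show ?thesis using c'(4) d'(4) \<open>c' = d'\<close> \<epsilon>(1) by auto
      qed auto
    qed
  qed
  moreover have "pl_map \<gamma> ` realization (link N a) = realization M"
  proof (intro subset_antisym subsetI)
    fix x assume "x \<in> pl_map \<gamma> ` realization (link N a)"
    then obtain c where c: "c \<in> realization (link N a)" "x = pl_map \<gamma> c" by auto
    obtain \<sigma> where "\<sigma> \<in> M" "\<gamma> ` supp c \<subseteq> cell \<sigma>" using gcell[OF realizationD(2)[OF lN c(1)]] by blast
    then have "x \<in> cell \<sigma>"
      unfolding c(2) using realizationD[OF lN c(1)] by (intro pl_map_in_cell) auto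
    then show "x \<in> realization M" using \<open>\<sigma> \<in> M\<close> by (auto simp: realization_def)
  next
    fix w assume w: "w \<in> realization M"
    obtain u e where ue: "0 < e" "\<And>t. 0 < t \<Longrightarrow> t < e \<Longrightarrow> (\<lambda>i. \<alpha> a i + t * u i) \<in> realization K"
      "\<And>t. 0 < t \<Longrightarrow> t < e \<Longrightarrow> Q (\<lambda>i. \<alpha> a i + t * u i) = (\<lambda>j. t * w j)"
      using dirs[OF w] by blast
    obtain g where g: "homeomorphism (realization N) (realization K) (pl_map \<alpha>) g"
      by (rule triang_homeomorphism[OF tr])
    define p where "p = (\<lambda>t i. \<alpha> a i + t * u i)"
    have va: "vertex_pt a \<in> realization N" by (rule vertex_pt_in_realization[OF N aN])
    have p0: "p 0 = pl_map \<alpha> (vertex_pt a)" by (simp add: p_def pl_map_vertex_pt)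
    have pK: "p ` {0..<e} \<subseteq> realization K"
    proof
      fix x assume "x \<in> p ` {0..<e}"
      then obtain t where t: "0 \<le> t" "t < e" "x = p t" by auto
      then show "x \<in> realization K"
        using ue(2)[of t] p0 va triangD(3)[OF tr] by (cases "t = 0") (auto simp: p_def)
    qed
    have "continuous_on {0..<e} p"
      by (rule continuous_on_coordinatewise_then_product) (auto simp: p_def intro!: continuous_intros)
    moreover have "continuous_on (p ` {0..<e}) g"
      using g pK by (meson continuous_on_subset homeomorphism_def)
    ultimately have "continuous_on {0..<e} (\<lambda>t. g (p t))"
      using continuous_on_compose[of "{0..<e}" p g] by (simp add: o_def)
    then have h: "continuous_on {0..<e} (\<lambda>t. g (p t) a)"
      by (rule continuous_on_product_then_coordinatewise)
    \<comment> \<open>At the apex the coordinate of \<open>a\<close> is 1. By continuity of the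
      inverse \<open>g\<close> it stays positive along \<open>p t\<close> for small
      \<open>t\<close>, so this point lies in a simplex through \<open>a\<close>, where
      \<open>Q\<close> is linear.\<close>
    have "g (p 0) a = 1" using g va by (simp add: p0 homeomorphism_def vertex_pt_def)
    then obtain \<delta> where \<delta>: "0 < \<delta>" "\<And>t. t \<in> {0..<e} \<Longrightarrow> dist t 0 < \<delta> \<Longrightarrow> dist (g (p t) a) 1 < 1"
      using h ue(1) unfolding continuous_on_iff by (metis atLeastLessThan_iff order_refl zero_less_one)
    define t where "t = min (\<delta> / 2) (e / 2)"
    have t: "0 < t" "t < e" "t < \<delta>" using \<delta>(1) ue(1) by (auto simp: t_def)
    have ga: "0 < g (p t) a" using \<delta>(2)[of t] t by (auto simp: dist_real_def)
    define c where "c = g (p t)"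
    have c: "c \<in> realization N" "pl_map \<alpha> c = p t" "0 < c a"
    proof -
      have "p t \<in> realization K" using pK t by auto
      then show "c \<in> realization N" "pl_map \<alpha> c = p t" "0 < c a"
        using g ga unfolding c_def homeomorphism_def by auto
    qed
    define S where "S = supp c - {a}"
    have iS: "insert a S = supp c" using c(3) by (auto simp: S_def)
    then have S: "S \<in> link N a" using realizationD(2)[OF N c(1)] by (auto simp: link_def S_def)
    have fS: "finite S" using simplicial_cpx_finite_face[OF lN S] .
    have Qt: "(\<Sum>s\<in>S. c s * Q (\<alpha> s) j) = t * w j" for j
      using lin[OF S c(1)] iS ue(3)[OF t(1,2)] c(2) unfolding p_def by (auto simp: fun_eq_iff)
    define c' where "c' = (\<lambda>s. if s = a then 0 else c s * m s / t)"
    have s': "supp c' \<subseteq> S" by (auto simp: c'_def S_def)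
    have nn: "0 \<le> c' s" for s
    proof (cases "s \<in> S")
      case True
      then show ?thesis using t realizationD(1)[OF N c(1)] mpos'[OF S True] by (auto simp: c'_def)
    qed (use s' in \<open>auto simp: S_def c'_def\<close>)
    have aS: "a \<notin> S" by (simp add: S_def)
    \<comment> \<open>Exchanging the sums over labels and over coordinates turns the weights
      \<open>m s\<close> into the total of \<open>w\<close>, which is 1.\<close>
    have "sum c' S = (\<Sum>s\<in>S. \<Sum>j\<in>verts M. c s * Q (\<alpha> s) j / t)"
      unfolding m_def c'_def using aS
      by (intro sum.cong) (auto simp: sum_distrib_left sum_divide_distrib m_def)
    also have "\<dots> = (\<Sum>j\<in>verts M. (\<Sum>s\<in>S. c s * Q (\<alpha> s) j) / t)"
      by (subst sum.swap) (simp add: sum_divide_distrib)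
    also have "\<dots> = sum w (verts M)" using Qt t by simp
    also have "\<dots> = 1" using realizationD(4)[OF M w fM] realizationD(5)[OF M w] by blast
    finally have "c' \<in> realization (link N a)"
      using nn s' fS simplicial_cpx_subset[OF lN S s'] by (intro realizationI[OF lN, where A=S]) auto
    moreover have "pl_map \<gamma> c' = w"
    proof
      fix j
      have "pl_map \<gamma> c' j = (\<Sum>s\<in>S. c s * Q (\<alpha> s) j / t)"
        unfolding pl_map_eq[OF fS s'] using aS mpos'[OF S]
        by (intro sum.cong) (auto simp: c'_def \<gamma>_def less_imp_neq[symmetric])
      also have "\<dots> = w j" using Qt[of j] t by (simp add: sum_divide_distrib[symmetric])
      finally show "pl_map \<gamma> c' j = w j" .
    qed
    ultimately show "w \<in> pl_map \<gamma> ` realization (link N a)" by blast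
  qed
  ultimately have "triang (link N a) \<gamma> M"
    using lN gcell by (auto simp: triang_def bij_betw_def)
  then show ?thesis unfolding \<gamma>_def m_def .
qed

text \<open>\<open>Q\<close> forgets the coordinate of \<open>v\<close>. The total weight 1 recovers
  it, so \<open>Q\<close> is injective, and the directions \<open>w - vertex_pt v\<close> sweep out
  the cone over the link.\<close>

lemma triang_link_vertex:
  fixes K :: "'v::countable cpx"
  assumes K: "simplicial_cpx K" and tr: "triang N \<alpha> K" and a: "a \<in> verts N" "\<alpha> a = vertex_pt v"
  shows "\<exists>\<alpha>'. triang (link N a) \<alpha>' (link K v)"
proof -
  note N = triangD(1)[OF tr]
  have aN: "{a} \<in> N" using a simplicial_cpx_vertex[OF N] by blast
  have suppv: "supp (vertex_pt v) = {v}" by (auto simp: vertex_pt_def)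
  have "vertex_pt v \<in> realization K"
    using vertex_pt_in_realization[OF N aN] triangD(3)[OF tr] pl_map_vertex_pt[of \<alpha> a] a by (metis imageI)
  then have "{v} \<in> K" using realizationD(2)[OF K] suppv by metis
  then have vK: "v \<in> verts K" by auto
  note lK = simplicial_cpx_link[OF K vK]
  have fK: "finite (verts K)" by (rule simplicial_cpx_finite_verts[OF K])
  define Q where "Q = (\<lambda>(x :: 'v \<Rightarrow> real) j. if j = v then 0 else x j)"
  have "triang (link N a) (\<lambda>s j. Q (\<alpha> s) j / sum (Q (\<alpha> s)) (verts (link K v))) (link K v)"
  proof (rule triang_link[OF tr lK a(1)])
    show "Q (\<alpha> a) = (\<lambda>j. 0)" by (auto simp: Q_def a(2) vertex_pt_def)
    fix S c assume S: "S \<in> link N a" and c: "c \<in> realization N" "supp c \<subseteq> insert a S"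
    have S': "a \<notin> S" "insert a S \<in> N" using S by (auto simp: link_def)
    have fS: "finite (insert a S)" using simplicial_cpx_finite_face[OF N S'(2)] .
    show "Q (pl_map \<alpha> c) = (\<lambda>j. \<Sum>s\<in>S. c s * Q (\<alpha> s) j)"
      using fS S'(1) a(2) unfolding Q_def fun_eq_iff pl_map_eq[OF fS c(2)] by (auto simp: vertex_pt_def)
  next
    fix c d assume c: "c \<in> realization N" and d: "d \<in> realization N"
      and eq: "Q (pl_map \<alpha> c) = Q (pl_map \<alpha> d)"
    let ?x = "pl_map \<alpha> c" and ?y = "pl_map \<alpha> d"
    have xy: "?x \<in> realization K" "?y \<in> realization K" using c d triangD(3)[OF tr] by auto
    have off: "?x j = ?y j" if "j \<noteq> v" for j using fun_cong[OF eq, of j] that by (simp add: Q_def)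
    have "sum ?x (verts K) = sum ?y (verts K)"
      using realizationD(4)[OF K xy(1) fK realizationD(5)[OF K xy(1)]]
        realizationD(4)[OF K xy(2) fK realizationD(5)[OF K xy(2)]] by simp
    moreover have "sum ?x (verts K - {v}) = sum ?y (verts K - {v})" using off by (intro sum.cong) auto
    ultimately have "?x v = ?y v" using fK vK by (simp add: sum.remove)
    then show "?x = ?y" using off by (metis ext)
  next
    fix S assume S: "S \<in> link N a"
    have S': "a \<notin> S" "insert a S \<in> N" using S by (auto simp: link_def)
    obtain \<sigma> where \<sigma>: "\<sigma> \<in> K" "\<alpha> ` insert a S \<subseteq> cell \<sigma>" using triangD(4)[OF tr S'(2)] by blast
    have f\<sigma>: "finite \<sigma>" using simplicial_cpx_finite_face[OF K \<sigma>(1)] .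
    have "v \<in> \<sigma>" using \<sigma>(2) a(2) suppv unfolding cell_iff[OF f\<sigma>, abs_def] by (auto simp: cell_iff[OF f\<sigma>])
    then have "insert v (\<sigma> - {v}) = \<sigma>" by auto
    then have "\<sigma> - {v} \<in> link K v" using \<sigma>(1) by (auto simp: link_def)
    moreover have "\<forall>s\<in>S. (\<forall>j. 0 \<le> Q (\<alpha> s) j) \<and> supp (Q (\<alpha> s)) \<subseteq> \<sigma> - {v}"
    proof
      fix s assume "s \<in> S"
      then have "\<alpha> s \<in> cell \<sigma>" using \<sigma>(2) by auto
      then show "(\<forall>j. 0 \<le> Q (\<alpha> s) j) \<and> supp (Q (\<alpha> s)) \<subseteq> \<sigma> - {v}"
        by (auto simp: cell_iff[OF f\<sigma>] Q_def)
    qed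
    ultimately show "\<exists>\<sigma>\<in>link K v. \<forall>s\<in>S. (\<forall>j. 0 \<le> Q (\<alpha> s) j) \<and> supp (Q (\<alpha> s)) \<subseteq> \<sigma>" by blast
  next
    fix w assume w: "w \<in> realization (link K v)"
    have wl: "insert v (supp w) \<in> K" "w v = 0" using realizationD(2)[OF lK w] by (auto simp: link_def)
    have fw: "finite (insert v (supp w))" using realizationD(3)[OF lK w] by simp
    have "(\<lambda>i. \<alpha> a i + t * (w i - vertex_pt v i)) \<in> realization K \<and>
        Q (\<lambda>i. \<alpha> a i + t * (w i - vertex_pt v i)) = (\<lambda>j. t * w j)" if t: "0 < t \<and> t < 1" for t
    proof
      let ?x = "\<lambda>i. \<alpha> a i + t * (w i - vertex_pt v i)"
      have x: "?x i = (if i = v then 1 - t else t * w i)" for i using wl(2) a(2) by (auto simp: vertex_pt_def)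
      have sx: "supp ?x = insert v (supp w)" unfolding x using t wl(2) by auto
      have "sum ?x (supp w) = t * sum w (supp w)"
        unfolding x sum_distrib_left using wl(2) by (intro sum.cong) auto
      also have "sum w (supp w) = 1" using realizationD(4)[OF lK w realizationD(3)[OF lK w]] by simp
      finally have "sum ?x (insert v (supp w)) = 1" using fw wl(2) x[of v] by simp
      then show "?x \<in> realization K"
        using fw sx wl(1) realizationD(1)[OF lK w] t unfolding x
        by (intro realizationI[OF K, where A="insert v (supp w)"]) (auto simp: x)
      show "Q ?x = (\<lambda>j. t * w j)" unfolding Q_def x using wl(2) by auto
    qed
    then show "\<exists>u e. 0 < e \<and> (\<forall>t. 0 < t \<and> t < e \<longrightarrow>
          (\<lambda>i. \<alpha> a i + t * u i) \<in> realization K \<and> Q (\<lambda>i. \<alpha> a i + t * u i) = (\<lambda>j. t * w j))"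
      by (intro exI[of _ "\<lambda>i. w i - vertex_pt v i"] exI[of _ 1]) auto
  qed
  then show ?thesis by blast
qed


section \<open>Directions at an arbitrary point of the boundary of a simplex\<close>

lemma realization_simplex_boundary_iff:
  assumes "finite D" "D \<noteq> {}"
  shows "x \<in> realization (simplex_boundary D) \<longleftrightarrow> (\<forall>i. 0 \<le> x i) \<and> supp x \<subset> D \<and> sum x D = 1"
proof -
  have "supp x \<subset> D \<Longrightarrow> sum x (supp x) = sum x D" by (rule sum_supp(2)[OF assms(1)]) blast
  then show ?thesis
    unfolding realization_iff[OF simplicial_cpx_simplex_boundary[OF assms]]
    unfolding simplex_boundary_def mem_Collect_eq
    by (cases "supp x \<subset> D") simp_all
qed

lemma total_preorder_minimum:
  assumes "finite D" "D \<noteq> {}" "\<And>i j. i \<in> D \<Longrightarrow> j \<in> D \<Longrightarrow> r i j \<or> r j i"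
    "\<And>i j k. r i j \<Longrightarrow> r j k \<Longrightarrow> r i k"
  shows "\<exists>i\<in>D. \<forall>j\<in>D. r i j"
  using assms(1,2,3)
proof (induction D rule: finite_ne_induct)
  case (insert x F)
  obtain i where i: "i \<in> F" "\<forall>j\<in>F. r i j" using insert.IH insert.prems by blast
  have xx: "r x x" using insert.prems by blast
  show ?case
  proof (cases "r i x")
    case True
    then show ?thesis using i by blast
  next
    case False
    then have "r x i" using insert.prems i(1) by blast
    then show ?thesis using i xx assms(4) by blast
  qed
qed auto

text \<open>For \<open>i \<noteq> b\<close>, this is a linear function of \<open>x\<close> vanishing at \<open>y\<close>. Subtracting the minimum over
  \<open>i\<close> identifies the directions of \<open>simplex_boundary D\<close> at \<open>y\<close> with the cone over
  \<open>simplex_boundary (D - {b})\<close>.\<close>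
definition shear :: "('w \<Rightarrow> real) \<Rightarrow> 'w \<Rightarrow> ('w \<Rightarrow> real) \<Rightarrow> 'w \<Rightarrow> real" where
  "shear y b x i = x i - y i / y b * x b"

text \<open>\<open>Q\<close> is the shear followed by subtraction of the minimum over
  \<open>D - {b}\<close>; its values are nonnegative with a zero coordinate, as in the cone over
  \<open>simplex_boundary (D - {b})\<close>. By the separation hypothesis one index attains the
  minimum at all vertices of a simplex simultaneously, and this makes \<open>Q\<close> linear on the
  simplices of the star.\<close>

lemma triang_link_simplex_boundary:
  fixes D :: "'w::countable set"
  assumes D: "finite D" "D \<noteq> {}" and tr: "triang N \<beta> (simplex_boundary D)" and a: "a \<in> verts N"
    and b: "b \<in> D" "\<beta> a b \<noteq> 0"
    and sep: "\<And>i j. i \<in> D - {b} \<Longrightarrow> j \<in> D - {b} \<Longrightarrow>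
        unseparated (\<lambda>x. shear (\<beta> a) b x i - shear (\<beta> a) b x j) N \<beta>"
  shows "D - {b} \<noteq> {} \<and> (\<exists>\<beta>'. triang (link N a) \<beta>' (simplex_boundary (D - {b})))"
proof -
  note N = triangD(1)[OF tr]
  have aN: "{a} \<in> N" using a simplicial_cpx_vertex[OF N] by blast
  define D' where "D' = D - {b}"
  define y where "y = \<beta> a"
  let ?A = "shear y b"
  have y: "y \<in> realization (simplex_boundary D)"
    using vertex_pt_in_realization[OF N aN] triangD(3)[OF tr] pl_map_vertex_pt[of \<beta> a]
    unfolding y_def by (metis imageI)
  then have y': "\<And>i. 0 \<le> y i" "supp y \<subset> D" "sum y D = 1"
    using realization_simplex_boundary_iff[OF D, of y] by auto
  have yb: "0 < y b" using b(2) y'(1)[of b] by (simp add: y_def)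
  obtain k where k: "k \<in> D" "y k = 0" using psubset_imp_ex_mem[OF y'(2)] by auto
  then have kD: "k \<in> D'" using yb by (auto simp: D'_def)
  have D': "finite D'" "D' \<noteq> {}" "D = insert b D'" "b \<notin> D'" using D b kD by (auto simp: D'_def)
  have sD: "sum x D = x b + sum x D'" for x :: "'w \<Rightarrow> real" using D' by simp
  define mn where "mn = (\<lambda>x. Min (?A x ` D'))"
  define Q where "Q = (\<lambda>x j. if j \<in> D' then ?A x j - mn x else 0)"
  have mn_eq: "mn x = ?A x i0" if "i0 \<in> D'" "\<forall>i\<in>D'. ?A x i0 \<le> ?A x i" for x i0
    unfolding mn_def using that D' by (intro Min_eqI) auto
  have mn_le: "mn x \<le> ?A x i" if "i \<in> D'" for x i
    unfolding mn_def using that D' by (intro Min_le) auto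
  have Ay: "?A y i = 0" for i using yb by (simp add: shear_def)
  \<comment> \<open>Two indices are compared at all vertices of the simplex at once; separation
    makes this comparison total.\<close>
  have least: "\<exists>i0\<in>D'. \<forall>i\<in>D'. \<forall>s\<in>R. ?A (\<beta> s) i0 \<le> ?A (\<beta> s) i" if R: "R \<in> N" for R
  proof (rule total_preorder_minimum[OF D'(1,2)])
    fix i j assume "i \<in> D'" "j \<in> D'"
    from bspec[OF sep[unfolded unseparated_def, OF this[unfolded D'_def]] R]
    show "(\<forall>s\<in>R. ?A (\<beta> s) i \<le> ?A (\<beta> s) j) \<or> (\<forall>s\<in>R. ?A (\<beta> s) j \<le> ?A (\<beta> s) i)"
      unfolding y_def by auto
  qed (meson order_trans)
  have Alin: "?A (pl_map \<beta> c) i = (\<Sum>s\<in>R. c s * ?A (\<beta> s) i)" if "finite R" "supp c \<subseteq> R" for c R i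
    unfolding shear_def pl_map_eq[OF that]
    by (simp add: sum_distrib_left sum_subtractf[symmetric] algebra_simps)
  have b': "simplicial_cpx (simplex_boundary D')" using D' by (intro simplicial_cpx_simplex_boundary)
  have vert: "realization (simplex_boundary D') = {w. (\<forall>i. 0 \<le> w i) \<and> supp w \<subset> D' \<and> sum w D' = 1}"
    using realization_simplex_boundary_iff[OF D'(1,2)] by blast
  have "triang (link N a) (\<lambda>s j. Q (\<beta> s) j / sum (Q (\<beta> s)) (verts (simplex_boundary D'))) (simplex_boundary D')"
  proof (rule triang_link[OF tr b' a(1)])
    have "mn y = 0" using mn_eq[of k y] kD by (simp add: Ay)
    then show Qa: "Q (\<beta> a) = (\<lambda>j. 0)" by (auto simp: Q_def y_def[symmetric] Ay)
    fix S c assume S: "S \<in> link N a" and c: "c \<in> realization N" "supp c \<subseteq> insert a S"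
    have S': "a \<notin> S" "insert a S \<in> N" using S by (auto simp: link_def)
    have fS: "finite (insert a S)" using simplicial_cpx_finite_face[OF N S'(2)] .
    obtain i0 where i0: "i0 \<in> D'" "\<forall>i\<in>D'. \<forall>s\<in>insert a S. ?A (\<beta> s) i0 \<le> ?A (\<beta> s) i"
      using least[OF S'(2)] by blast
    have ms: "mn (\<beta> s) = ?A (\<beta> s) i0" if "s \<in> insert a S" for s using mn_eq[OF i0(1)] i0(2) that by blast
    have "\<forall>i\<in>D'. ?A (pl_map \<beta> c) i0 \<le> ?A (pl_map \<beta> c) i"
      unfolding Alin[OF fS c(2)] using i0(2) realizationD(1)[OF N c(1)]
      by (intro ballI sum_mono mult_left_mono) auto
    then have mx: "mn (pl_map \<beta> c) = ?A (pl_map \<beta> c) i0" using mn_eq[OF i0(1)] by blast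
    show "Q (pl_map \<beta> c) = (\<lambda>j. \<Sum>s\<in>S. c s * Q (\<beta> s) j)"
    proof
      fix j
      have "Q (pl_map \<beta> c) j = (\<Sum>s\<in>insert a S. c s * Q (\<beta> s) j)"
      proof (cases "j \<in> D'")
        case True
        then have "Q (pl_map \<beta> c) j = (\<Sum>s\<in>insert a S. c s * (?A (\<beta> s) j - ?A (\<beta> s) i0))"
          unfolding Q_def mx Alin[OF fS c(2)] by (simp only: if_True sum_subtractf[symmetric] right_diff_distrib)
        also have "\<dots> = (\<Sum>s\<in>insert a S. c s * Q (\<beta> s) j)"
          using True ms by (intro sum.cong) (auto simp: Q_def)
        finally show ?thesis .
      qed (simp add: Q_def)
      then show "Q (pl_map \<beta> c) j = (\<Sum>s\<in>S. c s * Q (\<beta> s) j)" using fS S'(1) Qa by simp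
    qed
  next
    fix c d assume c: "c \<in> realization N" and d: "d \<in> realization N"
      and ic: "insert a (supp c) \<in> N" and id: "insert a (supp d) \<in> N"
      and eq: "Q (pl_map \<beta> c) = Q (pl_map \<beta> d)"
    let ?x = "pl_map \<beta> c" and ?z = "pl_map \<beta> d"
    have cr: "?x \<in> realization (simplex_boundary D)" "?z \<in> realization (simplex_boundary D)"
      using c d triangD(3)[OF tr] by auto
    then have x: "\<And>i. 0 \<le> ?x i" "supp ?x \<subset> D" "sum ?x D = 1"
      and z: "\<And>i. 0 \<le> ?z i" "supp ?z \<subset> D" "sum ?z D = 1"
      using realization_simplex_boundary_iff[OF D] by blast+
    \<comment> \<open>A point in the star of \<open>a\<close> lies in a common proper face with
      \<open>y\<close>, so the two share a vanishing coordinate.\<close>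
    have ex0: "\<exists>k\<in>D. pl_map \<beta> e k = 0 \<and> y k = 0" if e: "e \<in> realization N" "insert a (supp e) \<in> N" for e
    proof -
      obtain \<sigma> where \<sigma>: "\<sigma> \<in> simplex_boundary D" "\<beta> ` insert a (supp e) \<subseteq> cell \<sigma>"
        using triangD(4)[OF tr e(2)] by blast
      have f\<sigma>: "finite \<sigma>" and "\<sigma> \<subset> D" using \<sigma>(1) D(1) finite_subset by (auto simp: simplex_boundary_def)
      then obtain k where "k \<in> D" "k \<notin> \<sigma>" by auto
      moreover have "pl_map \<beta> e \<in> cell \<sigma>"
        using realizationD[OF N e(1)] \<sigma>(2) by (intro pl_map_in_cell) auto
      moreover have "y \<in> cell \<sigma>" using \<sigma>(2) by (simp add: y_def)
      ultimately show ?thesis unfolding cell_iff[OF f\<sigma>] by blast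
    qed
    obtain k1 where k1: "k1 \<in> D" "?x k1 = 0" "y k1 = 0" using ex0[OF c ic] by blast
    obtain k2 where k2: "k2 \<in> D" "?z k2 = 0" "y k2 = 0" using ex0[OF d id] by blast
    have kD': "k1 \<in> D'" "k2 \<in> D'" using k1 k2 yb by (auto simp: D'_def)
    define \<tau> where "\<tau> = mn ?x - mn ?z"
    define s where "s = (?x b - ?z b) / y b"
    \<comment> \<open>Equal values of \<open>Q\<close> leave two degrees of freedom, along
      \<open>y\<close> and along the indicator of \<open>D - {b}\<close>. The shared zeros at
      \<open>k1\<close> and \<open>k2\<close> force \<open>\<tau>\<close> to vanish, and the total
      weight then forces \<open>s\<close> to vanish.\<close>
    have A_eq: "?x i - ?z i = s * y i + \<tau>" if "i \<in> D'" for i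
      using fun_cong[OF eq, of i] that by (simp add: Q_def shear_def s_def \<tau>_def diff_divide_distrib algebra_simps)
    have "\<tau> \<le> 0" using A_eq[OF kD'(1)] k1 z(1)[of k1] by simp
    moreover have "0 \<le> \<tau>" using A_eq[OF kD'(2)] k2 x(1)[of k2] by simp
    ultimately have "\<tau> = 0" by simp
    then have e: "?x i - ?z i = s * y i" if "i \<in> D" for i
      using A_eq[of i] that D'(3) yb by (auto simp: s_def)
    have "0 = (\<Sum>i\<in>D. ?x i - ?z i)" using x(3) z(3) by (simp add: sum_subtractf)
    also have "\<dots> = s * sum y D" using e by (simp add: sum_distrib_left)
    finally have "s = 0" using y'(3) by simp
    show "?x = ?z"
    proof
      fix i show "?x i = ?z i"
      proof (cases "i \<in> D")
        case False
        then have "i \<notin> supp ?x" "i \<notin> supp ?z" using x(2) z(2) by blast+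
        then show ?thesis by simp
      qed (use e \<open>s = 0\<close> in simp)
    qed
  next
    fix S assume S: "S \<in> link N a"
    have S': "insert a S \<in> N" using S by (auto simp: link_def)
    obtain i0 where i0: "i0 \<in> D'" "\<forall>i\<in>D'. \<forall>s\<in>insert a S. ?A (\<beta> s) i0 \<le> ?A (\<beta> s) i"
      using least[OF S'] by blast
    have ms: "mn (\<beta> s) = ?A (\<beta> s) i0" if "s \<in> S" for s using mn_eq[OF i0(1)] i0(2) that by blast
    have "D' - {i0} \<in> simplex_boundary D'" using i0(1) by (auto simp: simplex_boundary_def)
    moreover have "\<forall>s\<in>S. (\<forall>j. 0 \<le> Q (\<beta> s) j) \<and> supp (Q (\<beta> s)) \<subseteq> D' - {i0}"
      using mn_le by (auto simp: Q_def ms[symmetric] split: if_splits)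
    ultimately show "\<exists>\<sigma>\<in>simplex_boundary D'. \<forall>s\<in>S. (\<forall>j. 0 \<le> Q (\<beta> s) j) \<and> supp (Q (\<beta> s)) \<subseteq> \<sigma>" by blast
  next
    fix w assume w0: "w \<in> realization (simplex_boundary D')"
    then have w: "\<And>i. 0 \<le> w i" "supp w \<subset> D'" "sum w D' = 1" unfolding vert by auto
    define Z where "Z = {i \<in> D. y i = 0}"
    have Z: "finite Z" "Z \<noteq> {}" "Z \<subseteq> D'" using D(1) k yb by (auto simp: Z_def D'_def)
    \<comment> \<open>\<open>Q\<close> does not change when a constant is added to all coordinates
      in \<open>D'\<close>, so \<open>w\<close> may be shifted. On \<open>Z\<close>, where
      \<open>y\<close> vanishes, the shift makes the least coordinate zero: moving along
      \<open>u\<close> then keeps these coordinates nonnegative and stays in the boundary.\<close>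
    define \<tau> where "\<tau> = - Min (w ` Z)"
    obtain k0 where k0: "k0 \<in> Z" "w k0 = Min (w ` Z)" using Min_in[of "w ` Z"] Z by fastforce
    have \<tau>: "0 \<le> w i + \<tau>" if "i \<in> Z" for i
      using Min_le[of "w ` Z" "w i"] that Z(1) by (simp del: Min_le_iff add: \<tau>_def[abs_def])
    \<comment> \<open>Adding a multiple of \<open>y\<close> does not change the shear either;
      \<open>\<rho>\<close> is the multiple for which the coordinates of \<open>u\<close> sum to
      zero.\<close>
    define \<rho> where "\<rho> = - (1 + real (card D') * \<tau>)"
    define u where "u = (\<lambda>i. if i = b then y b * \<rho> else if i \<in> D' then w i + \<tau> + y i * \<rho> else 0)"
    \<comment> \<open>So small that the positive coordinates of \<open>y\<close> remain positive
      along \<open>u\<close>; the summand 1 avoids a division by zero.\<close>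
    define e where "e = Min ((\<lambda>i. y i / (1 + \<bar>u i\<bar>)) ` supp y)"
    have fy: "finite (supp y)" "supp y \<noteq> {}" using y'(2) D(1) yb finite_subset by auto
    have "0 < e"
      unfolding e_def using fy y'(1) by (subst Min_gr_iff) (auto simp: order_less_le)
    moreover have "(\<lambda>i. \<beta> a i + t * u i) \<in> realization (simplex_boundary D) \<and>
        Q (\<lambda>i. \<beta> a i + t * u i) = (\<lambda>j. t * w j)" if t: "0 < t" "t < e" for t
    proof
      let ?x = "\<lambda>i. y i + t * u i"
      have pos: "0 < ?x i" if "y i \<noteq> 0" for i
      proof -
        have "e \<le> y i / (1 + \<bar>u i\<bar>)" unfolding e_def using fy that by (intro Min_le) auto
        then have "t * (1 + \<bar>u i\<bar>) < y i" using t by (simp add: pos_le_divide_eq) (smt (verit) mult_strict_right_mono)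
        moreover have "- (t * u i) \<le> t * \<bar>u i\<bar>" using t by (simp add: abs_if)
        ultimately show ?thesis using t by (simp add: algebra_simps)
      qed
      have nn: "0 \<le> ?x i" for i
      proof (cases "y i = 0")
        case True
        then have "i \<noteq> b" using yb by auto
        then show ?thesis using True t \<tau>[of i] by (auto simp: u_def Z_def D'_def)
      qed (use pos in \<open>simp add: less_imp_le\<close>)
      have k0': "k0 \<in> D'" "y k0 = 0" "k0 \<noteq> b" using k0 Z D' by (auto simp: Z_def)
      then have "?x k0 = 0" using k0(2) by (simp add: u_def \<tau>_def)
      moreover have "supp ?x \<subseteq> D" using y'(2) D'(3) by (auto simp: u_def split: if_splits)
      ultimately have sup: "supp ?x \<subset> D" using k0 unfolding Z_def by blast
      have "sum u D' = (\<Sum>i\<in>D'. w i + \<tau> + y i * \<rho>)" using D'(4) by (intro sum.cong) (auto simp: u_def)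
      also have "\<dots> = 1 + card D' * \<tau> + sum y D' * \<rho>"
        using w(3) by (simp add: sum.distrib sum_distrib_right)
      finally have "sum u D = 1 + card D' * \<tau> + (y b + sum y D') * \<rho>"
        unfolding sD by (simp add: u_def algebra_simps)
      also have "y b + sum y D' = 1" using y'(3) sD by simp
      finally have "sum u D = 0" by (simp add: \<rho>_def)
      then have "sum ?x D = 1" using y'(3) by (simp add: sum.distrib sum_distrib_left[symmetric])
      then show "(\<lambda>i. \<beta> a i + t * u i) \<in> realization (simplex_boundary D)"
        unfolding realization_simplex_boundary_iff[OF D] y_def[symmetric] using nn sup by blast
      have Ax: "?A ?x i = t * (w i + \<tau>)" if "i \<in> D'" for i
        using that D'(4) yb by (auto simp: shear_def u_def field_simps)
      obtain i1 where i1: "i1 \<in> D'" "w i1 = 0" using psubset_imp_ex_mem[OF w(2)] by auto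
      have "mn ?x = t * \<tau>"
        using mn_eq[of i1 ?x] i1 Ax w(1) t by auto
      then show "Q (\<lambda>i. \<beta> a i + t * u i) = (\<lambda>j. t * w j)"
        unfolding y_def[symmetric] Q_def using Ax w(2) by (auto simp: algebra_simps fun_eq_iff)
    qed
    ultimately show "\<exists>u e. 0 < e \<and> (\<forall>t. 0 < t \<and> t < e \<longrightarrow>
          (\<lambda>i. \<beta> a i + t * u i) \<in> realization (simplex_boundary D) \<and>
          Q (\<lambda>i. \<beta> a i + t * u i) = (\<lambda>j. t * w j))"
      by (intro exI[of _ u] exI[of _ e]) auto
  qed
  then show ?thesis using D' unfolding D'_def by blast
qed

lemma triang_relabel_simplex_boundary:
  assumes D: "finite D" "D \<noteq> {}" and h: "bij_betw h E D" and tr: "triang N \<beta> (simplex_boundary D)"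
  shows "triang N (\<lambda>s i. if i \<in> E then \<beta> s (h i) else 0) (simplex_boundary E)"
proof -
  note N = triangD(1)[OF tr]
  have E: "finite E" "E \<noteq> {}" using D h bij_betw_finite bij_betw_empty1 by (metis, metis bij_betw_imp_surj_on image_empty)
  have hE: "inj_on h E" "h ` E = D" using h by (auto simp: bij_betw_def)
  define \<phi> where "\<phi> = (\<lambda>x :: _ \<Rightarrow> real. \<lambda>i. if i \<in> E then x (h i) else 0)"
  define \<psi> where "\<psi> = (\<lambda>x :: _ \<Rightarrow> real. \<lambda>j. if j \<in> D then x (the_inv_into E h j) else 0)"
  have inv: "the_inv_into E h (h i) = i" if "i \<in> E" for i using that hE(1) by (simp add: the_inv_into_f_f)
  have inv': "the_inv_into E h j \<in> E" "h (the_inv_into E h j) = j" if "j \<in> D" for j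
    using that hE by (auto simp: the_inv_into_into f_the_inv_into_f)
  have sm: "sum (\<phi> x) E = sum x D" "sum (\<psi> z) D = sum z E" for x z
    unfolding hE(2)[symmetric] sum.reindex[OF hE(1)]
    by (auto simp: \<phi>_def \<psi>_def hE(2)[symmetric] inv intro!: sum.cong)
  have sup: "supp (\<phi> x) \<subset> E" if "supp x \<subset> D" for x
  proof -
    from psubset_imp_ex_mem[OF that] obtain j where "j \<in> D" "x j = 0" by auto
    then have "the_inv_into E h j \<in> E" "\<phi> x (the_inv_into E h j) = 0" using inv' by (auto simp: \<phi>_def)
    moreover have "supp (\<phi> x) \<subseteq> E" by (auto simp: \<phi>_def)
    ultimately show ?thesis by blast
  qed
  have sup': "supp (\<psi> z) \<subset> D" if "supp z \<subset> E" for z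
  proof -
    from psubset_imp_ex_mem[OF that] obtain i where "i \<in> E" "z i = 0" by auto
    then have "h i \<in> D" "\<psi> z (h i) = 0" using inv hE by (auto simp: \<psi>_def)
    moreover have "supp (\<psi> z) \<subseteq> D" by (auto simp: \<psi>_def)
    ultimately show ?thesis by blast
  qed
  note rD = realization_simplex_boundary_iff[OF D] and rE = realization_simplex_boundary_iff[OF E]
  have "bij_betw \<phi> (realization (simplex_boundary D)) (realization (simplex_boundary E))"
  proof (rule bij_betw_byWitness[where f'=\<psi>])
    show "\<forall>x\<in>realization (simplex_boundary D). \<psi> (\<phi> x) = x"
    proof
      fix x assume "x \<in> realization (simplex_boundary D)"
      then have "supp x \<subseteq> D" unfolding rD by blast
      then show "\<psi> (\<phi> x) = x" by (auto simp: \<phi>_def \<psi>_def inv' fun_eq_iff)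
    qed
    show "\<forall>z\<in>realization (simplex_boundary E). \<phi> (\<psi> z) = z"
    proof
      fix z assume "z \<in> realization (simplex_boundary E)"
      then have "supp z \<subseteq> E" unfolding rE by blast
      then show "\<phi> (\<psi> z) = z" using hE by (auto simp: \<phi>_def \<psi>_def inv fun_eq_iff)
    qed
    show "\<phi> ` realization (simplex_boundary D) \<subseteq> realization (simplex_boundary E)"
    proof clarify
      fix x assume "x \<in> realization (simplex_boundary D)"
      then have x: "\<forall>i. 0 \<le> x i" "supp x \<subset> D" "sum x D = 1" unfolding rD by blast+
      have "\<forall>i. 0 \<le> \<phi> x i" using x(1) by (simp add: \<phi>_def)
      then show "\<phi> x \<in> realization (simplex_boundary E)" unfolding rE using sup[OF x(2)] sm(1) x(3) by simp
    qed
    show "\<psi> ` realization (simplex_boundary E) \<subseteq> realization (simplex_boundary D)"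
    proof clarify
      fix x assume "x \<in> realization (simplex_boundary E)"
      then have x: "\<forall>i. 0 \<le> x i" "supp x \<subset> E" "sum x E = 1" unfolding rE by blast+
      have "\<forall>i. 0 \<le> \<psi> x i" using x(1) by (simp add: \<psi>_def)
      then show "\<psi> x \<in> realization (simplex_boundary D)" unfolding rD using sup'[OF x(2)] sm(2) x(3) by simp
    qed
  qed
  then have "bij_betw (\<phi> \<circ> pl_map \<beta>) (realization N) (realization (simplex_boundary E))"
    using tr unfolding triang_def by (blast intro: bij_betw_trans)
  moreover have "\<phi> \<circ> pl_map \<beta> = pl_map (\<lambda>s. \<phi> (\<beta> s))"
    by (auto simp: fun_eq_iff \<phi>_def pl_map_def)
  moreover have "\<exists>\<tau>\<in>simplex_boundary E. (\<lambda>s. \<phi> (\<beta> s)) ` S \<subseteq> cell \<tau>" if S: "S \<in> N" for S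
  proof -
    obtain \<sigma> where \<sigma>: "\<sigma> \<subset> D" "\<beta> ` S \<subseteq> cell \<sigma>"
      using triangD(4)[OF tr S] by (auto simp: simplex_boundary_def)
    define \<tau> where "\<tau> = {i \<in> E. h i \<in> \<sigma>}"
    have f: "finite \<sigma>" "finite \<tau>" using \<sigma>(1) D(1) E(1) by (auto simp: \<tau>_def dest: finite_subset)
    have "\<tau> \<subset> E" using \<sigma>(1) hE by (auto simp: \<tau>_def)
    have im: "h ` \<tau> = \<sigma>" "inj_on h \<tau>" using \<sigma>(1) hE by (auto simp: \<tau>_def inj_on_def)
    have "\<phi> (\<beta> s) \<in> cell \<tau>" if "s \<in> S" for s
    proof -
      have b: "\<And>i. 0 \<le> \<beta> s i" "supp (\<beta> s) \<subseteq> \<sigma>" "sum (\<beta> s) \<sigma> = 1"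
        using \<sigma>(2) that cell_iff[OF f(1), of "\<beta> s"] by blast+
      have "sum (\<phi> (\<beta> s)) \<tau> = sum (\<beta> s) \<sigma>"
        unfolding im(1)[symmetric] sum.reindex[OF im(2)] by (intro sum.cong) (auto simp: \<phi>_def \<tau>_def)
      then show ?thesis unfolding cell_iff[OF f(2)] using b by (auto simp: \<phi>_def \<tau>_def)
    qed
    then show ?thesis using \<open>\<tau> \<subset> E\<close> by (auto simp: simplex_boundary_def)
  qed
  ultimately have "triang N (\<lambda>s. \<phi> (\<beta> s)) (simplex_boundary E)" using N by (auto simp: triang_def)
  then show ?thesis unfolding \<phi>_def .
qed

text \<open>A vertex of \<open>K\<close> is an extreme point: when it is a convex combination of
  points with nonnegative coordinates, every point of positive weight vanishes outside the
  coordinate \<open>v\<close>.\<close>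

lemma triang_vertex_preimage:
  assumes K: "simplicial_cpx K" and tr: "triang N \<alpha> K" and v: "v \<in> verts K"
  obtains a where "a \<in> verts N" "\<alpha> a = vertex_pt v"
proof -
  note N = triangD(1)[OF tr]
  have "vertex_pt v \<in> realization K"
    using vertex_pt_in_realization[OF K] simplicial_cpx_vertex[OF K] v by blast
  then obtain c where c: "c \<in> realization N" "pl_map \<alpha> c = vertex_pt v" using triangD(3)[OF tr] by (metis imageE)
  have "supp c \<noteq> {}" using realizationD(4)[OF N c(1), of "{}"] by auto
  then obtain a where a: "c a \<noteq> 0" by auto
  have aN: "{a} \<in> N" using simplicial_cpx_subset[OF N realizationD(2)[OF N c(1)], of "{a}"] a by simp
  have in_K: "\<alpha> s \<in> realization K" if "{s} \<in> N" for s
    using vertex_pt_in_realization[OF N that] triangD(3)[OF tr] pl_map_vertex_pt[of \<alpha> s] by (metis imageI)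
  have off: "\<alpha> a i = 0" if "i \<noteq> v" for i
  proof -
    have nn: "0 \<le> c s * \<alpha> s i" if "s \<in> supp c" for s
    proof -
      have "{s} \<in> N" using simplicial_cpx_subset[OF N realizationD(2)[OF N c(1)], of "{s}"] that by simp
      then show ?thesis using realizationD(1)[OF K in_K] realizationD(1)[OF N c(1)] by simp
    qed
    have "(\<Sum>s\<in>supp c. c s * \<alpha> s i) = 0"
      using fun_cong[OF c(2), of i] \<open>i \<noteq> v\<close> by (simp add: pl_map_def vertex_pt_def)
    then have "\<forall>s\<in>supp c. c s * \<alpha> s i = 0"
      using nn realizationD(3)[OF N c(1)] by (subst (asm) sum_nonneg_eq_0_iff) auto
    then show ?thesis using a by auto
  qed
  have "sum (\<alpha> a) {v} = 1"
    using realizationD(4)[OF K in_K[OF aN], of "{v}"] off by auto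
  then have "\<alpha> a = vertex_pt v" using off by (auto simp: vertex_pt_def fun_eq_iff)
  moreover have "a \<in> verts N" using aN by blast
  ultimately show ?thesis using that by blast
qed

text \<open>The hyperplanes are chosen for the positions in the boundary of the simplex, and the
  common labels carry the cuts over to \<open>K\<close>. The link of one label then subdivides
  \<open>link K v\<close> on one side and the boundary of a simplex with one vertex less on the
  other.\<close>

theorem PL_homeomorphic_link:
  fixes K :: "'v::countable cpx" and d :: nat
  assumes K: "simplicial_cpx K" and hom: "PL_homeomorphic K (simplex_boundary {..d})" and v: "v \<in> verts K"
  shows "0 < d" "PL_homeomorphic (link K v) (simplex_boundary {..d - 1})"
proof -
  let ?D = "{..d}"
  have D: "finite ?D" "?D \<noteq> {}" by auto
  note B = simplicial_cpx_simplex_boundary[OF D]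
  obtain N :: "('v \<Rightarrow> real) cpx" and \<alpha> \<beta> where tr: "triang N \<alpha> K" "triang N \<beta> (simplex_boundary ?D)"
    by (rule PL_homeomorphic_triang[OF K B hom])
  obtain a where a: "a \<in> verts N" "\<alpha> a = vertex_pt v" by (rule triang_vertex_preimage[OF K tr(1) v])
  note N = triangD(1)[OF tr(1)]
  have "\<beta> a \<in> realization (simplex_boundary ?D)"
    using vertex_pt_in_realization[OF N, of a] simplicial_cpx_vertex[OF N] a(1) triangD(3)[OF tr(2)]
      pl_map_vertex_pt[of \<beta> a] by (metis imageI)
  then have y: "supp (\<beta> a) \<subset> ?D" "sum (\<beta> a) ?D = 1"
    using realization_simplex_boundary_iff[OF D] by blast+
  \<comment> \<open>The shear divides by the coordinate at \<open>b\<close>.\<close>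
  obtain b where b: "b \<in> ?D" "\<beta> a b \<noteq> 0" using y(2) sum.neutral[of ?D "\<beta> a"] by (metis zero_neq_one)
  define g where "g = (\<lambda>(i, j) x. shear (\<beta> a) b x i - shear (\<beta> a) b x j)"
  have "affine_functional (g p)" for p
    unfolding affine_functional_def g_def shear_def
    by (auto simp: distrib_left distrib_right left_diff_distrib right_diff_distrib add_divide_distrib
        diff_divide_distrib mult.left_commute split: prod.split)
  then have G: "finite (g ` (?D \<times> ?D))" "\<forall>h\<in>g ` (?D \<times> ?D). affine_functional h" by auto
  have inf: "infinite (UNIV :: ('v \<Rightarrow> real) set)"
    using finite_fun_UNIVD2[where 'a='v and 'b=real] infinite_UNIV_char_0 by blast
  from cut_by_functionals[OF inf tr a(1) G]
  obtain N' :: "('v \<Rightarrow> real) cpx" and \<alpha>' \<beta>' where c: "triang N' \<alpha>' K" "triang N' \<beta>' (simplex_boundary ?D)"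
    "a \<in> verts N'" "\<alpha>' a = \<alpha> a" "\<beta>' a = \<beta> a" "\<forall>h\<in>g ` (?D \<times> ?D). unseparated h N' \<beta>'"
    by (elim exE conjE)
  have sep: "unseparated (\<lambda>x. shear (\<beta>' a) b x i - shear (\<beta>' a) b x j) N' \<beta>'"
    if "i \<in> ?D - {b}" "j \<in> ?D - {b}" for i j
    using c(6) that by (auto simp: g_def c(5))
  have "\<beta>' a b \<noteq> 0" using b(2) c(5) by simp
  from triang_link_simplex_boundary[OF D c(2,3) b(1) this sep]
  obtain \<beta>'' where D': "?D - {b} \<noteq> {}" and lb: "triang (link N' a) \<beta>'' (simplex_boundary (?D - {b}))"
    by blast
  obtain \<alpha>'' where la: "triang (link N' a) \<alpha>'' (link K v)"
    using triang_link_vertex[OF K c(1) c(3)] c(4) a(2) by auto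
  show d: "0 < d" using D' b(1) by (cases d) auto
  \<comment> \<open>Without \<open>b\<close> the set \<open>{..d}\<close> need not be an initial
    segment, so the vertices are renumbered.\<close>
  have "card {..d - 1} = card (?D - {b})" using d b(1) by simp
  then obtain h where h: "bij_betw h {..d - 1} (?D - {b})"
    by (metis D(1) bij_betw_iff_card finite_Diff finite_atMost)
  have "triang (link N' a) (\<lambda>s i. if i \<in> {..d - 1} then \<beta>'' s (h i) else 0) (simplex_boundary {..d - 1})"
    by (rule triang_relabel_simplex_boundary[OF _ D' h lb]) simp
  then show "PL_homeomorphic (link K v) (simplex_boundary {..d - 1})"
    using triang_PL_homeomorphic[OF simplicial_cpx_link[OF K v] _ la] simplicial_cpx_simplex_boundary[of "{..d - 1}"]
    by blast
qed

section \<open>Purity and ridges of PL spheres\<close>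

definition pure :: "nat \<Rightarrow> 'v cpx \<Rightarrow> bool" where
  "pure d K \<longleftrightarrow> (\<forall>\<sigma>\<in>K. \<exists>F\<in>K. \<sigma> \<subseteq> F \<and> card F = d) \<and> (\<forall>\<sigma>\<in>K. card \<sigma> \<le> d)"

text \<open>Here \<open>insert x (F - {v})\<close> is a second facet through the ridge
  \<open>F - {v}\<close>.\<close>

definition ridges_interior :: "nat \<Rightarrow> 'v cpx \<Rightarrow> bool" where
  "ridges_interior d K \<longleftrightarrow>
     (\<forall>F\<in>K. \<forall>v\<in>F. card F = d \<longrightarrow> (\<exists>x. x \<notin> F \<and> insert x (F - {v}) \<in> K))"

text \<open>The links of vertices detect everything except what concerns the empty face. There the
  realization is inspected: for \<open>d > 0\<close> it is nonempty, which yields a vertex, and for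
  \<open>d = 1\<close> it has more than one point, which yields a second facet.\<close>

lemma PL_sphere_pure:
  fixes K :: "'v::countable cpx"
  assumes "simplicial_cpx K" "PL_homeomorphic K (simplex_boundary {..d::nat})"
  shows "pure d K \<and> ridges_interior d K"
  using assms
proof (induction d arbitrary: K rule: less_induct)
  case (less d)
  note K = less.prems(1)
  let ?D = "{..d}"
  obtain f g where fg: "homeomorphism (realization K) (realization (simplex_boundary ?D)) f g"
    using less.prems(2) by (auto simp: PL_homeomorphic_def)
  show ?case
  proof (cases "d = 0")
    case True
    have "K = {{}}"
    proof -
      have "verts K = {}" using PL_homeomorphic_link(1)[OF less.prems] True by blast
      then show ?thesis using simplicial_cpx_empty[OF K] by blast
    qed
    then show ?thesis using True by (simp add: pure_def ridges_interior_def)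
  next
    case False
    have l: "pure (d - 1) (link K v) \<and> ridges_interior (d - 1) (link K v)" if v: "v \<in> verts K" for v
      using less.IH[of "d - 1" "link K v"] False simplicial_cpx_link[OF K v]
        PL_homeomorphic_link(2)[OF less.prems v] by auto
    have pts: "realization (simplex_boundary ?D) \<noteq> {}"
    proof -
      have "d \<in> ?D - {0}" using False by simp
      then have "{0} \<in> simplex_boundary ?D" unfolding simplex_boundary_def by blast
      then have "vertex_pt 0 \<in> realization (simplex_boundary ?D)"
        by (intro vertex_pt_in_realization simplicial_cpx_simplex_boundary) auto
      then show ?thesis by blast
    qed
    have "verts K \<noteq> {}"
    proof
      assume "verts K = {}"
      then have "K = {{}}" using simplicial_cpx_empty[OF K] by blast
      then have "realization K = {}" by (simp add: realization_def cell_def)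
      then show False using fg pts by (auto simp: homeomorphism_def)
    qed
    have star: "\<sigma> - {v} \<in> link K v" "insert v (\<sigma> - {v}) = \<sigma>" if "v \<in> \<sigma>" "\<sigma> \<in> K" for \<sigma> v
      using that by (auto simp: link_def insert_absorb)
    have ne: "\<exists>F\<in>K. \<sigma> \<subseteq> F \<and> card F = d" if \<sigma>: "\<sigma> \<in> K" "v \<in> \<sigma>" for \<sigma> v
    proof -
      obtain F where F: "F \<in> link K v" "\<sigma> - {v} \<subseteq> F" "card F = d - 1"
        using l[of v] \<sigma> star(1)[OF \<sigma>(2,1)] by (auto simp: pure_def)
      have "insert v F \<in> K" "v \<notin> F" using F(1) by (auto simp: link_def)
      moreover have "finite F" using simplicial_cpx_finite_face[OF K \<open>insert v F \<in> K\<close>] by simp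
      moreover have "card (insert v F) = d" using F(3) False calculation by simp
      ultimately show ?thesis using F(2) by (intro bexI[of _ "insert v F"]) auto
    qed
    have "\<exists>F\<in>K. \<sigma> \<subseteq> F \<and> card F = d" if \<sigma>: "\<sigma> \<in> K" for \<sigma>
    proof (cases "\<sigma> = {}")
      case True
      obtain v where "v \<in> verts K" using \<open>verts K \<noteq> {}\<close> by blast
      then show ?thesis using ne[of "{v}" v] simplicial_cpx_vertex[OF K] True by auto
    qed (use ne \<sigma> in blast)
    moreover have "card \<sigma> \<le> d" if \<sigma>: "\<sigma> \<in> K" for \<sigma>
    proof (cases "\<sigma> = {}")
      case F: False
      then obtain v where v: "v \<in> \<sigma>" by blast
      then have "pure (d - 1) (link K v)" using l[of v] \<sigma> by blast
      then have "card (\<sigma> - {v}) \<le> d - 1" using star(1)[OF v \<sigma>] by (simp add: pure_def)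
      then show ?thesis using v False simplicial_cpx_finite_face[OF K \<sigma>] by (simp add: card_Diff_singleton_if)
    qed simp
    ultimately have "pure d K" by (simp add: pure_def)
    moreover have "\<exists>x. x \<notin> F \<and> insert x (F - {v}) \<in> K" if F: "F \<in> K" "v \<in> F" "card F = d" for F v
    proof (cases "F = {v}")
      case False': False
      then obtain u where u: "u \<in> F" "u \<noteq> v" using F(2) by blast
      have cF: "card (F - {u}) = d - 1" using u F simplicial_cpx_finite_face[OF K F(1)] by simp
      have "ridges_interior (d - 1) (link K u)" using l[of u] u F(1) by blast
      then obtain x where x: "x \<notin> F - {u}" "insert x (F - {u} - {v}) \<in> link K u"
        using star(1)[OF u(1) F(1)] cF u F(2) unfolding ridges_interior_def by blast
      have "x \<noteq> u" "insert u (insert x (F - {u} - {v})) \<in> K" using x(2) by (auto simp: link_def)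
      moreover have "insert u (insert x (F - {u} - {v})) = insert x (F - {v})" using u by auto
      ultimately show ?thesis using x(1) by auto
    next
      case True
      then have d1: "d = 1" using F(3) by simp
      have "\<exists>x\<in>verts K. x \<noteq> v"
      proof (rule ccontr)
        assume "\<not> ?thesis"
        then have vK: "verts K = {v}" using F(1,2) by blast
        have "x = vertex_pt v" if x: "x \<in> realization K" for x
        proof -
          have "supp x \<subseteq> {v}" using realizationD(5)[OF K x] vK by simp
          moreover have "sum x {v} = 1" using realizationD(4)[OF K x, of "{v}"] \<open>supp x \<subseteq> {v}\<close> by simp
          ultimately show ?thesis by (auto simp: vertex_pt_def fun_eq_iff)
        qed
        moreover have "f ` realization K = realization (simplex_boundary ?D)"
          using fg by (simp add: homeomorphism_def)
        ultimately have one: "\<And>p q. p \<in> realization (simplex_boundary ?D) \<Longrightarrow>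
            q \<in> realization (simplex_boundary ?D) \<Longrightarrow> p = q" by (metis imageE)
        have "vertex_pt i \<in> realization (simplex_boundary ?D)" if "i \<le> 1" for i :: nat
        proof -
          have "1 - i \<in> ?D - {i}" "i \<in> ?D" using that d1 by auto arith
          then have "{i} \<in> simplex_boundary ?D" unfolding simplex_boundary_def by blast
          then show ?thesis by (intro vertex_pt_in_realization simplicial_cpx_simplex_boundary) auto
        qed
        then have "vertex_pt (0::nat) = vertex_pt 1" using one by simp
        then have "vertex_pt (0::nat) 0 = vertex_pt (1::nat) 0" by (rule fun_cong)
        then show False by (simp add: vertex_pt_def)
      qed
      then obtain x where x: "x \<in> verts K" "x \<noteq> v" by (rule bexE)
      have "insert x (F - {v}) = {x}" using True by simp
      then show ?thesis using True x simplicial_cpx_vertex[OF K, of x] by (intro exI[of _ x]) simp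
    qed
    ultimately show ?thesis unfolding ridges_interior_def by blast
  qed
qed

section \<open>Linear algebra over the field with two elements\<close>

lemma bit_vec_add_self: "(x :: 'i \<Rightarrow> bit) + x = 0"
  by (auto simp: fun_eq_iff)

lemma sum_bit_apply: "(\<Sum>s\<in>A. f s) i = (\<Sum>s\<in>A. f s i :: bit)"
  by (induct A rule: infinite_finite_induct) auto

text \<open>Over the field with two elements a linear combination is the sum of a subset. A repeated
  vector gives a vanishing sum of two terms, so the condition on subsets includes
  injectivity.\<close>

lemma indep_family_iff:
  assumes "finite A"
  shows "indep_family A x \<longleftrightarrow> (\<forall>B\<subseteq>A. B \<noteq> {} \<longrightarrow> (\<Sum>b\<in>B. x b) \<noteq> 0)"
proof
  assume A: "indep_family A x"
  then have inj: "inj_on x A" and ind: "Z2.independent (x ` A)" by (auto simp: indep_family_def)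
  show "\<forall>B\<subseteq>A. B \<noteq> {} \<longrightarrow> (\<Sum>b\<in>B. x b) \<noteq> 0"
  proof (intro allI impI notI)
    fix B assume B: "B \<subseteq> A" "B \<noteq> {}" "(\<Sum>b\<in>B. x b) = 0"
    have fB: "finite B" using B(1) assms finite_subset by blast
    have "(\<Sum>v\<in>x ` B. Z2_scale 1 v) = 0"
      using B(3) inj_on_subset[OF inj B(1)] by (simp add: sum.reindex)
    then have "Z2.dependent (x ` A)"
      unfolding Z2.dependent_explicit using fB B(1,2)
      by (intro exI[of _ "x ` B"] exI[of _ "\<lambda>_. 1"]) auto
    then show False using ind by simp
  qed
next
  assume r: "\<forall>B\<subseteq>A. B \<noteq> {} \<longrightarrow> (\<Sum>b\<in>B. x b) \<noteq> 0"
  have inj: "inj_on x A"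
  proof (rule inj_onI, rule ccontr)
    fix a b assume ab: "a \<in> A" "b \<in> A" "x a = x b" "a \<noteq> b"
    then have "(\<Sum>b\<in>{a, b}. x b) = 0" by (simp add: bit_vec_add_self)
    then show False using r[rule_format, of "{a, b}"] ab(1,2) by simp
  qed
  have "\<not> Z2.dependent (x ` A)"
  proof
    assume "Z2.dependent (x ` A)"
    then obtain t u where t: "finite t" "t \<subseteq> x ` A" "(\<Sum>v\<in>t. Z2_scale (u v) v) = 0" "\<exists>v\<in>t. u v \<noteq> 0"
      unfolding Z2.dependent_explicit by blast
    define B where "B = {a \<in> A. x a \<in> t \<and> u (x a) \<noteq> 0}"
    have xB: "x ` B = {v \<in> t. u v \<noteq> 0}" using t(2) by (auto simp: B_def)
    have "(\<Sum>b\<in>B. x b) = (\<Sum>v\<in>x ` B. v)"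
      using inj by (subst sum.reindex) (auto simp: B_def inj_on_def)
    also have "\<dots> = (\<Sum>v\<in>x ` B. Z2_scale (u v) v)"
      unfolding xB by (intro sum.cong) (auto simp: bit_not_zero_iff)
    also have "\<dots> = (\<Sum>v\<in>t. Z2_scale (u v) v)"
      unfolding xB using t(1) by (intro sum.mono_neutral_left) auto
    finally have "(\<Sum>b\<in>B. x b) = 0" using t(3) by simp
    moreover have "B \<subseteq> A" "B \<noteq> {}" using t(4) xB by (auto simp: B_def)
    ultimately show False using r by blast
  qed
  then show "indep_family A x" using inj by (simp add: indep_family_def)
qed

section \<open>Row operations and unit columns\<close>

definition column_map :: "nat \<Rightarrow> ((nat \<Rightarrow> bit) \<Rightarrow> nat \<Rightarrow> bit) \<Rightarrow> bool" where
  "column_map n g \<longleftrightarrow> (\<forall>x y. g (x + y) = g x + g y) \<and> (\<forall>x. g x = 0 \<longrightarrow> x = 0) \<and>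
     (\<forall>x. x \<in> Z2_vec {..<n} \<longrightarrow> g x \<in> Z2_vec {..<n})"

lemma row_op_column_map:
  assumes "row_op n \<Lambda> \<Lambda>'"
  obtains g where "column_map n g" "\<Lambda>' = (\<lambda>v. g (\<Lambda> v))"
  using assms
proof cases
  case (add i j)
  have "column_map n (\<lambda>x. x(i := x i + x j))"
    unfolding column_map_def
  proof (intro conjI allI impI)
    fix x :: "nat \<Rightarrow> bit" assume x: "x(i := x i + x j) = 0"
    show "x = 0"
    proof
      fix k
      have "x j = 0" using fun_cong[OF x, of j] add(4) by simp
      then show "x k = 0 k" using fun_cong[OF x, of k] by (cases "k = i") auto
    qed
  qed (use add in \<open>auto simp: fun_eq_iff Z2_vec_def\<close>)
  then show ?thesis using that add(1) by blast
next
  case (swap i j)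
  have "column_map n (\<lambda>x. x(i := x j, j := x i))"
    unfolding column_map_def
  proof (intro conjI allI impI)
    fix x :: "nat \<Rightarrow> bit" assume x: "x(i := x j, j := x i) = 0"
    show "x = 0"
    proof
      fix k
      have "x i = 0" "x j = 0" using fun_cong[OF x, of i] fun_cong[OF x, of j] by (auto split: if_splits)
      then show "x k = 0 k" using fun_cong[OF x, of k] by (cases "k = i \<or> k = j") auto
    qed
  qed (use swap in \<open>auto simp: fun_eq_iff Z2_vec_def\<close>)
  then show ?thesis using that swap(1) by blast
qed

text \<open>Row operations multiply every column by the same invertible matrix. Additivity and
  trivial kernel of this map carry linear relations between columns back and forth.\<close>

lemma DJ_equiv_column_map:
  assumes "DJ_equiv n \<Lambda> \<Lambda>'"
  shows "\<exists>g. column_map n g \<and> \<Lambda>' = (\<lambda>v. g (\<Lambda> v))"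
  using assms unfolding DJ_equiv_def
proof (induction rule: rtranclp_induct)
  case base
  have "column_map n (\<lambda>x. x)" by (auto simp: column_map_def)
  then show ?case by blast
next
  case (step \<Lambda>1 \<Lambda>2)
  obtain g where g: "column_map n g" "\<Lambda>1 = (\<lambda>v. g (\<Lambda> v))" using step.IH by blast
  obtain h where h: "column_map n h" "\<Lambda>2 = (\<lambda>v. h (\<Lambda>1 v))" using step.hyps(2) by (rule row_op_column_map)
  have "column_map n (\<lambda>x. h (g x))" using g(1) h(1) unfolding column_map_def by metis
  moreover have "\<Lambda>2 = (\<lambda>v. h (g (\<Lambda> v)))" using g(2) h(2) by simp
  ultimately show ?case by blast
qed

text \<open>In characteristic two both operations are their own inverses.\<close>

lemma row_op_sym:
  assumes "row_op n \<Lambda> \<Lambda>'"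
  shows "row_op n \<Lambda>' \<Lambda>"
  using assms
proof cases
  case (add i j)
  have "row_op n \<Lambda>' (\<lambda>v. (\<Lambda>' v)(i := \<Lambda>' v i + \<Lambda>' v j))" using add by (intro row_op.add) auto
  moreover have "(\<lambda>v. (\<Lambda>' v)(i := \<Lambda>' v i + \<Lambda>' v j)) = \<Lambda>"
    using add by (auto simp: fun_eq_iff add.assoc)
  ultimately show ?thesis by simp
next
  case (swap i j)
  have "row_op n \<Lambda>' (\<lambda>v. (\<Lambda>' v)(i := \<Lambda>' v j, j := \<Lambda>' v i))" using swap by (intro row_op.swap) auto
  moreover have "(\<lambda>v. (\<Lambda>' v)(i := \<Lambda>' v j, j := \<Lambda>' v i)) = \<Lambda>"
    using swap by (auto simp: fun_eq_iff)
  ultimately show ?thesis by simp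
qed

lemma DJ_equiv_sym: "DJ_equiv n \<Lambda> \<Lambda>' \<Longrightarrow> DJ_equiv n \<Lambda>' \<Lambda>"
  unfolding DJ_equiv_def
  by (induction rule: rtranclp_induct) (auto intro: converse_rtranclp_into_rtranclp row_op_sym)

lemma column_map_sum:
  assumes "column_map n g"
  shows "g (\<Sum>b\<in>B. x b) = (\<Sum>b\<in>B. g (x b))" "g 0 = 0" "g z = 0 \<longleftrightarrow> z = 0" "g (Z2_scale c z) = Z2_scale c (g z)"
proof -
  have add: "g (x + y) = g x + g y" for x y using assms by (auto simp: column_map_def)
  show z: "g 0 = 0" using add[of 0 0] by simp
  show "g (\<Sum>b\<in>B. x b) = (\<Sum>b\<in>B. g (x b))" 
    by (induct B rule: infinite_finite_induct) (simp_all only: sum.infinite sum.empty sum.insert z add not_False_eq_True)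
  show "g z = 0 \<longleftrightarrow> z = 0" using assms z by (auto simp: column_map_def)
  show "g (Z2_scale c z) = Z2_scale c (g z)" using z by (cases c) auto
qed

lemma DJ_equiv_indep_family:
  assumes "DJ_equiv n \<Lambda> \<Lambda>'" "finite A"
  shows "indep_family A \<Lambda>' \<longleftrightarrow> indep_family A \<Lambda>"
proof -
  obtain g where g: "column_map n g" "\<Lambda>' = (\<lambda>v. g (\<Lambda> v))" using DJ_equiv_column_map[OF assms(1)] by blast
  have "(\<Sum>b\<in>B. \<Lambda>' b) = 0 \<longleftrightarrow> (\<Sum>b\<in>B. \<Lambda> b) = 0" for B
    unfolding g(2) column_map_sum(1)[OF g(1), symmetric] column_map_sum(3)[OF g(1)] ..
  then show ?thesis unfolding indep_family_iff[OF assms(2)] by simp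
qed

lemma DJ_equiv_char_kernel:
  assumes "DJ_equiv n \<Lambda> \<Lambda>'"
  shows "char_kernel L \<Lambda>' = char_kernel L \<Lambda>"
proof -
  obtain g where g: "column_map n g" "\<Lambda>' = (\<lambda>v. g (\<Lambda> v))" using DJ_equiv_column_map[OF assms(1)] by blast
  show ?thesis
    unfolding char_kernel_def g(2) column_map_sum(4)[OF g(1), symmetric] column_map_sum(1)[OF g(1), symmetric]
      column_map_sum(3)[OF g(1)] ..
qed

lemma DJ_equiv_char_map:
  assumes "DJ_equiv (rk L) \<Lambda> \<Lambda>'" "char_map L \<Lambda>" "simplicial_cpx L"
  shows "char_map L \<Lambda>'"
proof -
  obtain g where g: "column_map (rk L) g" "\<Lambda>' = (\<lambda>v. g (\<Lambda> v))" using DJ_equiv_column_map[OF assms(1)] by blast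
  show ?thesis
    using assms(2) DJ_equiv_indep_family[OF assms(1)] simplicial_cpx_finite_face[OF assms(3)] g
      column_map_sum(2)[OF g(1)]
    unfolding char_map_def column_map_def by auto
qed

lemma clear_rows:
  assumes "finite J" "J \<subseteq> {..<n} - {k}" "k < n"
  shows "DJ_equiv n \<Lambda> (\<lambda>v j. if j \<in> J then \<Lambda> v j + \<Lambda> v k else \<Lambda> v j)"
  using assms(1,2)
proof (induction J rule: finite_induct)
  case empty
  then show ?case by (simp add: DJ_equiv_def)
next
  case (insert i J)
  let ?M = "\<lambda>J v j. if j \<in> J then \<Lambda> v j + \<Lambda> v k else \<Lambda> v j"
  have "DJ_equiv n \<Lambda> (?M J)" using insert by blast
  moreover have "row_op n (?M J) (\<lambda>v. (?M J v)(i := ?M J v i + ?M J v k))"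
    using insert.prems assms(3) by (intro row_op.add) auto
  moreover have "(\<lambda>v. (?M J v)(i := ?M J v i + ?M J v k)) = ?M (insert i J)"
    using insert.hyps(2) insert.prems by (auto simp: fun_eq_iff)
  ultimately show ?case unfolding DJ_equiv_def by (metis (no_types, lifting) rtranclp.rtrancl_into_rtrancl)
qed

text \<open>Gauss-Jordan elimination. The pivot for column \<open>k\<close> is found in row
  \<open>k\<close> or below, for otherwise this column would be a sum of the unit vectors made
  before, against independence.\<close>

lemma DJ_equiv_unit_columns:
  assumes vec: "\<And>i. i < n \<Longrightarrow> \<Lambda> (e i) \<in> Z2_vec {..<n}" and inj: "inj_on e {..<n}"
    and ind: "indep_family (e ` {..<n}) \<Lambda>"
  shows "\<exists>\<Lambda>'. DJ_equiv n \<Lambda> \<Lambda>' \<and> (\<forall>i<n. \<Lambda>' (e i) = unit_vec i)"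
proof -
  have "\<exists>\<Lambda>'. DJ_equiv n \<Lambda> \<Lambda>' \<and> (\<forall>i<k. \<Lambda>' (e i) = unit_vec i)" if "k \<le> n" for k
    using that
  proof (induction k)
    case 0
    then show ?case by (intro exI[of _ \<Lambda>]) (simp add: DJ_equiv_def)
  next
    case (Suc k)
    then obtain \<Lambda>1 where 1: "DJ_equiv n \<Lambda> \<Lambda>1" "\<And>i. i < k \<Longrightarrow> \<Lambda>1 (e i) = unit_vec i" by auto
    have kn: "k < n" using Suc.prems by simp
    obtain g where g: "column_map n g" "\<Lambda>1 = (\<lambda>v. g (\<Lambda> v))" using DJ_equiv_column_map[OF 1(1)] by blast
    have vec1: "\<Lambda>1 (e i) \<in> Z2_vec {..<n}" if "i < n" for i
      using g vec[OF that] by (auto simp: column_map_def)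
    have ind1: "indep_family (e ` {..<n}) \<Lambda>1" using DJ_equiv_indep_family[OF 1(1)] ind by simp
    have "\<exists>r\<ge>k. r < n \<and> \<Lambda>1 (e k) r = 1"
    proof (rule ccontr)
      assume no: "\<not> ?thesis"
      have big: "\<Lambda>1 (e k) r = 0" if "r \<ge> k" for r
      proof (cases "r < n")
        case True
        then show ?thesis using no that bit_not_zero_iff by blast
      qed (use vec1[OF kn] in \<open>auto simp: Z2_vec_def\<close>)
      define B where "B = {i. i < k \<and> \<Lambda>1 (e k) i = 1}"
      have fB: "finite B" "k \<notin> B" by (auto simp: B_def)
      have inj': "inj_on e (insert k B)" by (rule inj_on_subset[OF inj]) (use kn in \<open>auto simp: B_def\<close>)
      have "(\<Sum>i\<in>B. \<Lambda>1 (e i)) = \<Lambda>1 (e k)"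
      proof
        fix r
        have "(\<Sum>i\<in>B. \<Lambda>1 (e i)) r = (\<Sum>i\<in>B. if r = i then 1 else 0)"
          unfolding sum_bit_apply using 1(2) by (intro sum.cong) (auto simp: B_def unit_vec_def)
        also have "\<dots> = (if r \<in> B then 1 else 0)" using fB(1) by simp
        also have "\<dots> = \<Lambda>1 (e k) r"
          using big[of r] bit_not_zero_iff[of "\<Lambda>1 (e k) r"] by (auto simp: B_def not_less)
        finally show "(\<Sum>i\<in>B. \<Lambda>1 (e i)) r = \<Lambda>1 (e k) r" .
      qed
      then have "(\<Sum>i\<in>insert k B. \<Lambda>1 (e i)) = 0" using fB by (simp add: bit_vec_add_self)
      then have "(\<Sum>b\<in>e ` insert k B. \<Lambda>1 b) = 0" by (simp only: sum.reindex[OF inj'] o_def)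
      moreover have "e ` insert k B \<subseteq> e ` {..<n}" using kn by (auto simp: B_def)
      ultimately show False using ind1 unfolding indep_family_iff[OF finite_imageI[OF finite_lessThan]] by blast
    qed
    then obtain r where r: "k \<le> r" "r < n" "\<Lambda>1 (e k) r = 1" by blast
    define \<Lambda>2 where "\<Lambda>2 = (\<lambda>v. (\<Lambda>1 v)(k := \<Lambda>1 v r, r := \<Lambda>1 v k))"
    have 2: "DJ_equiv n \<Lambda> \<Lambda>2"
      using 1(1) row_op.swap[OF kn r(2), of \<Lambda>1] unfolding DJ_equiv_def \<Lambda>2_def
      by (meson rtranclp.rtrancl_into_rtrancl)
    have u2: "\<Lambda>2 (e i) = unit_vec i" if "i < k" for i
      using 1(2)[OF that] r(1) that by (auto simp: \<Lambda>2_def unit_vec_def fun_eq_iff)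
    have k2: "\<Lambda>2 (e k) k = 1" using r by (auto simp: \<Lambda>2_def)
    have v2: "\<Lambda>2 (e k) j = 0" if "n \<le> j" for j
      using vec1[OF kn] that r kn by (auto simp: \<Lambda>2_def Z2_vec_def)
    define J where "J = {j. j < n \<and> j \<noteq> k \<and> \<Lambda>2 (e k) j = 1}"
    define \<Lambda>3 where "\<Lambda>3 = (\<lambda>v j. if j \<in> J then \<Lambda>2 v j + \<Lambda>2 v k else \<Lambda>2 v j)"
    have "DJ_equiv n \<Lambda>2 \<Lambda>3"
      unfolding \<Lambda>3_def using kn by (intro clear_rows) (auto simp: J_def)
    then have "DJ_equiv n \<Lambda> \<Lambda>3" using 2 unfolding DJ_equiv_def by (rule rtranclp_trans[rotated])
    moreover have "\<Lambda>3 (e i) = unit_vec i" if "i < Suc k" for i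
    proof (cases "i = k")
      case True
      have "\<Lambda>3 (e k) j = unit_vec k j" for j
        using k2 v2[of j] bit_not_zero_iff[of "\<Lambda>2 (e k) j"] by (auto simp: \<Lambda>3_def J_def unit_vec_def not_less)
      then show ?thesis using True by auto
    next
      case False
      then have "i < k" using that by simp
      then show ?thesis using u2[of i] by (auto simp: \<Lambda>3_def unit_vec_def fun_eq_iff)
    qed
    ultimately show ?case by blast
  qed
  then show ?thesis by blast
qed

section \<open>Kernel and dual of a characteristic map\<close>

lemma char_mapD:
  assumes "char_map L \<Lambda>"
  shows "v \<in> verts L \<Longrightarrow> \<Lambda> v \<in> Z2_vec {..<rk L}" "v \<notin> verts L \<Longrightarrow> \<Lambda> v = 0" "\<sigma> \<in> L \<Longrightarrow> indep_family \<sigma> \<Lambda>"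
  using assms unfolding char_map_def by blast+

lemma char_map_unit_columns:
  assumes L: "simplicial_cpx L" and \<Lambda>: "char_map L \<Lambda>" and F: "F \<in> L" and e: "bij_betw e {..<rk L} F"
  obtains \<Lambda>' where "DJ_equiv (rk L) \<Lambda> \<Lambda>'" "char_map L \<Lambda>'" "\<And>i. i < rk L \<Longrightarrow> \<Lambda>' (e i) = unit_vec i"
proof -
  have inj: "inj_on e {..<rk L}" "e ` {..<rk L} = F" using e by (auto simp: bij_betw_def)
  have "\<Lambda> (e i) \<in> Z2_vec {..<rk L}" if "i < rk L" for i
  proof -
    have "e i \<in> F" using inj(2) that by auto
    then have "e i \<in> verts L" using F by auto
    then show ?thesis by (rule char_mapD(1)[OF \<Lambda>])
  qed
  moreover have "indep_family (e ` {..<rk L}) \<Lambda>"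
    unfolding inj(2) by (rule char_mapD(3)[OF \<Lambda> F])
  ultimately obtain \<Lambda>' where "DJ_equiv (rk L) \<Lambda> \<Lambda>'" "\<forall>i<rk L. \<Lambda>' (e i) = unit_vec i"
    using DJ_equiv_unit_columns[OF _ inj(1), of \<Lambda>] by blast
  then show ?thesis using that DJ_equiv_char_map[OF _ \<Lambda> L] by blast
qed

text \<open>When the columns over \<open>F\<close> are unit vectors, the entries of the column of
  \<open>u\<close> are the coefficients that express it through them. As -1 = 1, this relation is a
  kernel vector supported in \<open>insert u F\<close>.\<close>

lemma kernel_vector:
  assumes L: "simplicial_cpx L" and e: "bij_betw e {..<n} F" "F \<subseteq> verts L"
    and unit: "\<And>i. i < n \<Longrightarrow> \<Lambda> (e i) = unit_vec i"
    and u: "u \<in> verts L - F" "\<Lambda> u \<in> Z2_vec {..<n}"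
  shows "(\<lambda>v. if v = u then 1 else if v \<in> F then \<Lambda> u (the_inv_into {..<n} e v) else 0) \<in> char_kernel L \<Lambda>"
    (is "?\<kappa> \<in> _")
proof -
  have fV: "finite (verts L)" by (rule simplicial_cpx_finite_verts[OF L])
  have inj: "inj_on e {..<n}" "F = e ` {..<n}" using e(1) by (auto simp: bij_betw_def)
  have fF: "finite F" using inj(2) by simp
  have "(\<Sum>v\<in>verts L. Z2_scale (?\<kappa> v) (\<Lambda> v)) = (\<Sum>v\<in>insert u F. Z2_scale (?\<kappa> v) (\<Lambda> v))"
    using fV e(2) u(1) by (intro sum.mono_neutral_right) auto
  also have "\<dots> = \<Lambda> u + (\<Sum>v\<in>F. Z2_scale (?\<kappa> v) (\<Lambda> v))" using fF u(1) by simp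
  also have "(\<Sum>v\<in>F. Z2_scale (?\<kappa> v) (\<Lambda> v)) = (\<Sum>i<n. Z2_scale (\<Lambda> u i) (unit_vec i))"
    unfolding inj(2) sum.reindex[OF inj(1)] o_def
    using u(1) inj unit by (intro sum.cong) (auto simp: the_inv_into_f_f)
  also have "\<dots> = \<Lambda> u"
  proof
    fix j
    have "(\<Sum>i<n. Z2_scale (\<Lambda> u i) (unit_vec i)) j = (\<Sum>i<n. if j = i then \<Lambda> u i else 0)"
      unfolding sum_bit_apply by (intro sum.cong) (auto simp: Z2_scale_def unit_vec_def)
    also have "\<dots> = \<Lambda> u j" using u(2) by (auto simp: Z2_vec_def)
    finally show "(\<Sum>i<n. Z2_scale (\<Lambda> u i) (unit_vec i)) j = \<Lambda> u j" .
  qed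
  finally show ?thesis
    using u(1) e(2) by (auto simp: char_kernel_def bit_vec_add_self Z2_vec_def)
qed

lemma subspace_char_kernel: "Z2.subspace (char_kernel L \<Lambda>)"
proof (rule Z2.subspaceI)
  show "0 \<in> char_kernel L \<Lambda>" by (auto simp: char_kernel_def Z2_vec_def Z2_scale_def fun_eq_iff sum_bit_apply)
next
  fix x y assume "x \<in> char_kernel L \<Lambda>" "y \<in> char_kernel L \<Lambda>"
  then show "x + y \<in> char_kernel L \<Lambda>"
    unfolding char_kernel_def mem_Collect_eq plus_fun_apply Z2.scale_left_distrib sum.distrib
    by (simp add: Z2_vec_def zero_fun_def)
next
  fix c x assume "x \<in> char_kernel L \<Lambda>"
  then show "Z2_scale c x \<in> char_kernel L \<Lambda>" by (cases c) (auto simp: char_kernel_def Z2_vec_def Z2_scale_def fun_eq_iff sum_bit_apply)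
qed

text \<open>The kernel vectors belonging to the vertices outside a facet form a basis: restricted to
  these vertices they are an identity matrix, and a kernel vector vanishing there is zero because
  the columns of the facet are independent.\<close>

lemma dual_of_exists:
  assumes L: "simplicial_cpx L" and F: "F \<in> L" "card F = rk L" and \<Lambda>: "char_map L \<Lambda>"
  shows "\<exists>\<mu>. dual_of L \<Lambda> \<mu>"
proof -
  define n r where "n = rk L" and "r = card (verts L) - rk L"
  define V where "V = verts L"
  have fV: "finite V" unfolding V_def by (rule simplicial_cpx_finite_verts[OF L])
  have fF: "finite F" using simplicial_cpx_finite_face[OF L F(1)] .
  have FV: "F \<subseteq> V" using F(1) unfolding V_def by auto
  obtain e where e: "bij_betw e {..<n} F"
    using F(2) fF unfolding n_def by (metis bij_betw_from_nat_into_finite)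
  have inj: "inj_on e {..<n}" "e ` {..<n} = F" using e by (auto simp: bij_betw_def)
  have "card (V - F) = r" using fF FV F(2) by (simp add: r_def V_def card_Diff_subset)
  then obtain h where h: "bij_betw h {..<r} (V - F)"
    using fV by (metis bij_betw_from_nat_into_finite finite_Diff)
  have hi: "inj_on h {..<r}" "h ` {..<r} = V - F" using h by (auto simp: bij_betw_def)
  have hV: "h k \<in> V" "h k \<notin> F" if "k < r" for k
    using imageI[of k "{..<r}" h] that unfolding hi(2) by simp_all
  obtain \<Lambda>' where \<Lambda>': "DJ_equiv n \<Lambda> \<Lambda>'" "\<And>i. i < n \<Longrightarrow> \<Lambda>' (e i) = unit_vec i" and cm: "char_map L \<Lambda>'"
    using char_map_unit_columns[OF L \<Lambda> F(1) e[unfolded n_def]] unfolding n_def by metis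
  have ker: "char_kernel L \<Lambda>' = char_kernel L \<Lambda>" by (rule DJ_equiv_char_kernel[OF \<Lambda>'(1)])
  have vec: "\<Lambda>' v \<in> Z2_vec {..<n}" if "v \<in> V" for v using char_mapD(1)[OF cm] that unfolding n_def V_def by blast
  define \<kappa> where "\<kappa> = (\<lambda>u v. if v = u then 1 else if v \<in> F then \<Lambda>' u (the_inv_into {..<n} e v) else 0)"
  have \<kappa>: "\<kappa> u \<in> char_kernel L \<Lambda>'" if "u \<in> V - F" for u
    unfolding \<kappa>_def by (rule kernel_vector[OF L e FV[unfolded V_def] \<Lambda>'(2)]) (use vec that V_def in auto)
  define \<mu> where "\<mu> = (\<lambda>v k. if k < r then \<kappa> (h k) v else 0)"
  have col: "(\<lambda>v. \<mu> v k) = \<kappa> (h k)" if "k < r" for k using that by (simp add: \<mu>_def)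
  have 1: "\<mu> v \<in> Z2_vec {..<r}" for v by (auto simp: Z2_vec_def \<mu>_def)
  have 2: "\<mu> v = 0" if "v \<notin> V" for v
    using that FV hV(1) by (auto simp: \<mu>_def \<kappa>_def fun_eq_iff)
  have hh: "h k = h k' \<longleftrightarrow> k = k'" if "k < r" "k' < r" for k k' using that hi(1) by (auto simp: inj_on_def)
  have "(\<Sum>k\<in>B. (\<lambda>v. \<mu> v k)) \<noteq> 0" if B: "B \<subseteq> {..<r}" "B \<noteq> {}" for B
  proof -
    obtain k where k: "k \<in> B" using B(2) by blast
    have kr: "k < r" using k B(1) by auto
    have "(\<Sum>j\<in>B. (\<lambda>v. \<mu> v j)) (h k) = (\<Sum>j\<in>B. if k = j then 1 else 0)"
      unfolding sum_bit_apply
    proof (intro sum.cong refl)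
      fix j assume "j \<in> B"
      then have "j < r" using B(1) by auto
      then show "\<mu> (h k) j = (if k = j then 1 else 0)"
        using hh[OF kr] hV[OF kr] by (auto simp: \<mu>_def \<kappa>_def)
    qed
    also have "\<dots> = 1" using k finite_subset[OF B(1)] by simp
    finally show ?thesis by (metis zero_fun_def zero_neq_one)
  qed
  then have 3: "indep_family {..<r} (\<lambda>k v. \<mu> v k)" unfolding indep_family_iff[OF finite_lessThan] by blast
  have 4: "Z2.span ((\<lambda>k v. \<mu> v k) ` {..<r}) = char_kernel L \<Lambda>'"
  proof
    show "Z2.span ((\<lambda>k v. \<mu> v k) ` {..<r}) \<subseteq> char_kernel L \<Lambda>'"
      using \<kappa> hV col by (intro Z2.span_minimal subspace_char_kernel) auto
    show "char_kernel L \<Lambda>' \<subseteq> Z2.span ((\<lambda>k v. \<mu> v k) ` {..<r})"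
    proof
      fix x assume x: "x \<in> char_kernel L \<Lambda>'"
      \<comment> \<open>The only candidate: at \<open>h k\<close> all basis vectors but one vanish,
        so the coefficient is the value of \<open>x\<close> there.\<close>
      define y where "y = (\<Sum>k<r. Z2_scale (x (h k)) (\<lambda>v. \<mu> v k))"
      have ys: "y \<in> Z2.span ((\<lambda>k v. \<mu> v k) ` {..<r})"
        unfolding y_def by (intro Z2.span_sum Z2.span_scale Z2.span_base) auto
      have "y \<in> char_kernel L \<Lambda>'"
        unfolding y_def using \<kappa> hV col
        by (intro Z2.subspace_sum[OF subspace_char_kernel] Z2.subspace_scale[OF subspace_char_kernel]) auto
      then have d: "x + y \<in> char_kernel L \<Lambda>'" by (rule Z2.subspace_add[OF subspace_char_kernel x])
      have off: "(x + y) v = 0" if v: "v \<notin> F" for v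
      proof (cases "v \<in> V")
        case True
        then obtain k where k: "k < r" "v = h k" using v hi(2) by (metis DiffI imageE lessThan_iff)
        have "y v = (\<Sum>j<r. if k = j then x (h k) else 0)"
          unfolding y_def sum_bit_apply k(2)
        proof (intro sum.cong refl)
          fix j assume "j \<in> {..<r}"
          then show "Z2_scale (x (h j)) (\<lambda>v. \<mu> v j) (h k) = (if k = j then x (h k) else 0)"
            using hh[OF k(1)] hV[OF k(1)] by (auto simp: \<mu>_def \<kappa>_def Z2_scale_def)
        qed
        then show ?thesis using k by simp
      qed (use d in \<open>simp add: char_kernel_def Z2_vec_def V_def[symmetric]\<close>)
      have "(\<Sum>v\<in>V. Z2_scale ((x + y) v) (\<Lambda>' v)) = (\<Sum>v\<in>F. Z2_scale ((x + y) v) (\<Lambda>' v))"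
        using fV FV off by (intro sum.mono_neutral_right) auto
      then have s0: "(\<Sum>v\<in>F. Z2_scale ((x + y) v) (\<Lambda>' v)) = 0" using d by (simp add: char_kernel_def V_def[symmetric])
      have "(x + y) (e i) = 0" if i: "i < n" for i
      proof -
        have "(\<Sum>v\<in>F. Z2_scale ((x + y) v) (\<Lambda>' v)) i = (\<Sum>j<n. if i = j then (x + y) (e j) else 0)"
          unfolding inj(2)[symmetric] sum.reindex[OF inj(1)] sum_bit_apply
          by (intro sum.cong) (auto simp: \<Lambda>'(2) Z2_scale_def unit_vec_def)
        then show ?thesis using s0 i by simp
      qed
      then have sum0: "(x + y) v = 0" for v using off[of v] inj(2) by (cases "v \<in> F") auto
      have "x v = y v" for v using sum0[of v] by (cases "x v"; cases "y v") auto
      then have "x = y" by auto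
      then show "x \<in> Z2.span ((\<lambda>k v. \<mu> v k) ` {..<r})" using ys by simp
    qed
  qed
  have "dual_of L \<Lambda> \<mu>"
    unfolding dual_of_def Let_def r_def[symmetric] unfolding V_def[symmetric]
    using 1 2 3 4 ker by simp
  then show ?thesis by blast
qed

text \<open>Replaces a property of the chosen basis by one of the kernel, which row operations on
  \<open>\<Lambda>\<close> do not change.\<close>

lemma dual_of_equal_rows:
  assumes "dual_of L \<Lambda> \<mu>" "\<mu> v = \<mu> w" "x \<in> char_kernel L \<Lambda>"
  shows "x v = x w"
proof -
  define r where "r = card (verts L) - rk L"
  have "char_kernel L \<Lambda> = Z2.span ((\<lambda>k v. \<mu> v k) ` {..<r})"
    using assms(1) by (simp add: dual_of_def Let_def r_def)
  moreover have "Z2.span ((\<lambda>k v. \<mu> v k) ` {..<r}) \<subseteq> {x. x v = x w}"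
    using assms(2) by (intro Z2.span_minimal Z2.subspaceI) (auto simp: Z2_scale_def)
  ultimately show ?thesis using assms(3) by blast
qed

section \<open>The complexes \<open>K(J)\<close> in terms of fibres\<close>

text \<open>\<open>K(J)\<close> is encoded by the map sending each copy of a vertex to that vertex: a set of copies is a face
  iff the vertices all of whose copies it contains form a face of \<open>K\<close>.\<close>
definition filled :: "'v cpx \<Rightarrow> 'x set \<Rightarrow> ('x \<Rightarrow> 'v) \<Rightarrow> 'x set \<Rightarrow> 'v set" where
  "filled K V \<pi> \<sigma> = {i \<in> verts K. \<forall>x\<in>V. \<pi> x = i \<longrightarrow> x \<in> \<sigma>}"

definition fibre_cpx :: "'v cpx \<Rightarrow> 'x set \<Rightarrow> ('x \<Rightarrow> 'v) \<Rightarrow> 'x cpx" where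
  "fibre_cpx K V \<pi> = {\<sigma>. \<sigma> \<subseteq> V \<and> filled K V \<pi> \<sigma> \<in> K}"

text \<open>The sizes of the fibres of \<open>\<pi>\<close> are the entries of \<open>J\<close>;
  surjectivity says that they are positive.\<close>

definition fibred :: "'v cpx \<Rightarrow> 'x cpx \<Rightarrow> ('x \<Rightarrow> 'v) \<Rightarrow> bool" where
  "fibred K L \<pi> \<longleftrightarrow> finite (verts L) \<and> \<pi> ` verts L = verts K \<and> L = fibre_cpx K (verts L) \<pi>"

lemma filled_iff: "i \<in> filled K V \<pi> \<sigma> \<longleftrightarrow> i \<in> verts K \<and> (\<forall>x\<in>V. \<pi> x = i \<longrightarrow> x \<in> \<sigma>)"
  by (simp add: filled_def)

lemma filled_mono: "\<sigma> \<subseteq> \<tau> \<Longrightarrow> filled K V \<pi> \<sigma> \<subseteq> filled K V \<pi> \<tau>"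
  by (auto simp: filled_def)

lemma fibre_cpx_iff: "\<sigma> \<in> fibre_cpx K V \<pi> \<longleftrightarrow> \<sigma> \<subseteq> V \<and> filled K V \<pi> \<sigma> \<in> K"
  by (simp add: fibre_cpx_def)

lemma verts_fibre_cpx:
  assumes K: "simplicial_cpx K" and "\<pi> ` V = verts K"
  shows "verts (fibre_cpx K V \<pi>) = V"
proof
  show "verts (fibre_cpx K V \<pi>) \<subseteq> V" by (auto simp: fibre_cpx_iff)
  show "V \<subseteq> verts (fibre_cpx K V \<pi>)"
  proof
    fix x assume x: "x \<in> V"
    then have "\<pi> x \<in> verts K" using assms(2) by blast
    then have "{\<pi> x} \<in> K" using simplicial_cpx_vertex[OF K] by blast
    moreover have "filled K V \<pi> {x} \<subseteq> {\<pi> x}"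
    proof
      fix i assume "i \<in> filled K V \<pi> {x}"
      then have "i \<in> \<pi> ` V" "\<forall>y\<in>V. \<pi> y = i \<longrightarrow> y = x" unfolding filled_iff assms(2) by simp_all
      then show "i \<in> {\<pi> x}" by auto
    qed
    ultimately have "{x} \<in> fibre_cpx K V \<pi>"
      using x simplicial_cpx_subset[OF K] by (simp add: fibre_cpx_iff)
    then show "x \<in> verts (fibre_cpx K V \<pi>)" by blast
  qed
qed

lemma fibre_cpx_image:
  assumes \<phi>: "bij_betw \<phi> V' V" and \<pi>: "\<And>x. x \<in> V' \<Longrightarrow> \<pi> (\<phi> x) = \<pi>' x"
  shows "(\<lambda>\<sigma>. \<phi> ` \<sigma>) ` fibre_cpx K V' \<pi>' = fibre_cpx K V \<pi>"
proof -
  have inj: "inj_on \<phi> V'" and im: "\<phi> ` V' = V" using \<phi> by (auto simp: bij_betw_def)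
  have eq: "filled K V \<pi> (\<phi> ` \<sigma>) = filled K V' \<pi>' \<sigma>" if \<sigma>: "\<sigma> \<subseteq> V'" for \<sigma>
  proof -
    have "\<phi> x \<in> \<phi> ` \<sigma> \<longleftrightarrow> x \<in> \<sigma>" if "x \<in> V'" for x using inj_on_image_mem_iff[OF inj that \<sigma>] .
    then show ?thesis unfolding filled_def im[symmetric] using \<pi> by auto
  qed
  show ?thesis
  proof
    show "(\<lambda>\<sigma>. \<phi> ` \<sigma>) ` fibre_cpx K V' \<pi>' \<subseteq> fibre_cpx K V \<pi>"
    proof clarify
      fix \<sigma> assume "\<sigma> \<in> fibre_cpx K V' \<pi>'"
      then have "\<sigma> \<subseteq> V'" "filled K V' \<pi>' \<sigma> \<in> K" by (simp_all add: fibre_cpx_iff)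
      then show "\<phi> ` \<sigma> \<in> fibre_cpx K V \<pi>" using eq[of \<sigma>] im by (auto simp only: fibre_cpx_iff)
    qed
    show "fibre_cpx K V \<pi> \<subseteq> (\<lambda>\<sigma>. \<phi> ` \<sigma>) ` fibre_cpx K V' \<pi>'"
    proof
      fix \<tau> assume \<tau>: "\<tau> \<in> fibre_cpx K V \<pi>"
      then obtain \<sigma> where "\<sigma> \<subseteq> V'" "\<tau> = \<phi> ` \<sigma>" using im by (metis fibre_cpx_iff subset_imageE)
      moreover from this have "\<sigma> \<in> fibre_cpx K V' \<pi>'" using \<tau> eq[of \<sigma>] by (simp add: fibre_cpx_iff)
      ultimately show "\<tau> \<in> (\<lambda>\<sigma>. \<phi> ` \<sigma>) ` fibre_cpx K V' \<pi>'" by blast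
    qed
  qed
qed

text \<open>All copies of \<open>\<eta>\<close> lie in a set exactly if \<open>\<eta>\<close> lies
  in what the set fills. Since every non-face contains a minimal one, avoiding the minimal non-faces
  means that the filled set is a face.\<close>

lemma K_of_eq_fibre_cpx:
  assumes K: "simplicial_cpx K" and J: "\<forall>i\<in>verts K. 1 \<le> J i"
  shows "K_of K J = fibre_cpx K (copies J (verts K)) fst"
proof -
  let ?V = "copies J (verts K)"
  have sub: "copies J \<eta> \<subseteq> \<sigma> \<longleftrightarrow> \<eta> \<subseteq> filled K ?V fst \<sigma>" if "\<eta> \<subseteq> verts K" for \<eta> \<sigma>
    using that by (auto simp: copies_def filled_def)
  have fin: "finite (filled K ?V fst \<sigma>)" for \<sigma>
    by (rule finite_subset[OF _ simplicial_cpx_finite_verts[OF K]]) (auto simp: filled_def)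
  have minimal: "\<exists>\<eta>\<in>min_nonfaces K. \<eta> \<subseteq> S" if S: "finite S" "S \<subseteq> verts K" "S \<notin> K" for S
    using S
  proof (induction S rule: finite_psubset_induct)
    case (psubset S)
    show ?case
    proof (cases "\<forall>\<tau>. \<tau> \<subset> S \<longrightarrow> \<tau> \<in> K")
      case True
      then have "S \<in> min_nonfaces K" using psubset.prems by (simp add: min_nonfaces_def)
      then show ?thesis by blast
    next
      case False
      then obtain \<tau> where \<tau>: "\<tau> \<subset> S" "\<tau> \<notin> K" by blast
      then obtain \<eta> where "\<eta> \<in> min_nonfaces K" "\<eta> \<subseteq> \<tau>" using psubset.IH[of \<tau>] psubset.prems by blast
      then show ?thesis using \<tau>(1) by blast
    qed
  qed
  have "(\<forall>\<eta>\<in>min_nonfaces K. \<not> copies J \<eta> \<subseteq> \<sigma>) \<longleftrightarrow> filled K ?V fst \<sigma> \<in> K" for \<sigma>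
  proof
    assume no: "\<forall>\<eta>\<in>min_nonfaces K. \<not> copies J \<eta> \<subseteq> \<sigma>"
    show "filled K ?V fst \<sigma> \<in> K"
    proof (rule ccontr)
      assume "filled K ?V fst \<sigma> \<notin> K"
      moreover have "filled K ?V fst \<sigma> \<subseteq> verts K" unfolding filled_def by (rule Collect_restrict)
      ultimately obtain \<eta> where \<eta>: "\<eta> \<in> min_nonfaces K" "\<eta> \<subseteq> filled K ?V fst \<sigma>"
        using minimal[OF fin] by blast
      have "\<eta> \<subseteq> verts K" using \<eta>(1) by (simp add: min_nonfaces_def)
      then show False using no \<eta> sub by blast
    qed
  next
    assume fK: "filled K ?V fst \<sigma> \<in> K"
    show "\<forall>\<eta>\<in>min_nonfaces K. \<not> copies J \<eta> \<subseteq> \<sigma>"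
    proof (intro ballI notI)
      fix \<eta> assume \<eta>: "\<eta> \<in> min_nonfaces K" "copies J \<eta> \<subseteq> \<sigma>"
      have "\<eta> \<subseteq> verts K" "\<eta> \<notin> K" using \<eta>(1) by (simp_all add: min_nonfaces_def)
      then have "\<eta> \<subseteq> filled K ?V fst \<sigma>" using sub[of \<eta> \<sigma>] \<eta>(2) by blast
      then show False using simplicial_cpx_subset[OF K fK] \<open>\<eta> \<notin> K\<close> by blast
    qed
  qed
  then show ?thesis by (auto simp: K_of_def fibre_cpx_def)
qed

lemma fst_copies:
  assumes "\<forall>i\<in>U. 1 \<le> J i"
  shows "fst ` copies J U = U"
proof
  show "U \<subseteq> fst ` copies J U"
  proof
    fix i assume "i \<in> U"
    then have "(i, 1) \<in> copies J U" using assms by (simp add: copies_def)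
    then show "i \<in> fst ` copies J U" by force
  qed
qed (auto simp: copies_def)

text \<open>Frees membership in \<open>X_of K\<close> from the tuple \<open>J\<close> and from the
  numbering of copies: when a copy disappears, only the map to the vertices of \<open>K\<close> has
  to be adapted.\<close>

lemma isomorphic_K_of_iff_fibred:
  assumes K: "simplicial_cpx K"
  shows "(\<exists>J. (\<forall>i\<in>verts K. 1 \<le> J i) \<and> isomorphic (K_of K J) L) \<longleftrightarrow> (\<exists>\<pi>. fibred K L \<pi>)"
proof
  assume "\<exists>J. (\<forall>i\<in>verts K. 1 \<le> J i) \<and> isomorphic (K_of K J) L"
  then obtain J where J: "\<forall>i\<in>verts K. 1 \<le> J i" and iso: "isomorphic (K_of K J) L" by blast
  let ?V = "copies J (verts K)"
  note Keq = K_of_eq_fibre_cpx[OF K J]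
  have vK: "verts (K_of K J) = ?V" unfolding Keq by (rule verts_fibre_cpx[OF K fst_copies[OF J]])
  obtain \<phi> where \<phi>: "bij_betw \<phi> ?V (verts L)" "L = (\<lambda>\<sigma>. \<phi> ` \<sigma>) ` fibre_cpx K ?V fst"
    using iso unfolding isomorphic_def vK unfolding Keq by blast
  define \<pi> where "\<pi> = fst \<circ> the_inv_into ?V \<phi>"
  have \<pi>: "\<pi> (\<phi> x) = fst x" if "x \<in> ?V" for x
    using that \<phi>(1) by (simp add: \<pi>_def the_inv_into_f_f bij_betw_def)
  have "L = fibre_cpx K (verts L) \<pi>" using fibre_cpx_image[OF \<phi>(1), of \<pi> fst K] \<pi> \<phi>(2) by simp
  moreover have "\<pi> ` verts L = verts K"
  proof -
    have "\<pi> ` verts L = \<pi> ` (\<phi> ` ?V)" using \<phi>(1) unfolding bij_betw_def by (elim conjE) (rule arg_cong[where f="image \<pi>", OF sym])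
    also have "\<dots> = fst ` ?V" using \<pi> by (auto simp: image_image)
    also have "\<dots> = verts K" by (rule fst_copies[OF J])
    finally show ?thesis .
  qed
  moreover have "finite ?V"
  proof (rule finite_subset)
    show "?V \<subseteq> Sigma (verts K) (\<lambda>i. {..J i})" by (auto simp: copies_def)
    show "finite (Sigma (verts K) (\<lambda>i. {..J i}))" using simplicial_cpx_finite_verts[OF K] by (intro finite_SigmaI) auto
  qed
  then have "finite (verts L)" using \<phi>(1) bij_betw_finite by blast
  ultimately show "\<exists>\<pi>. fibred K L \<pi>" unfolding fibred_def by blast
next
  assume "\<exists>\<pi>. fibred K L \<pi>"
  then obtain \<pi> where \<pi>: "finite (verts L)" "\<pi> ` verts L = verts K" "L = fibre_cpx K (verts L) \<pi>"
    by (auto simp: fibred_def)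
  define V where "V = verts L"
  define J where "J = (\<lambda>i. card {x \<in> V. \<pi> x = i})"
  have fV: "finite V" using \<pi>(1) V_def by simp
  have J: "\<forall>i\<in>verts K. 1 \<le> J i"
  proof
    fix i assume "i \<in> verts K"
    then have "{x \<in> V. \<pi> x = i} \<noteq> {}" unfolding \<pi>(2)[symmetric] V_def[symmetric] by auto
    then have "J i \<noteq> 0" unfolding J_def using fV by simp
    then show "1 \<le> J i" by simp
  qed
  have "\<exists>h. bij_betw h {1..J i} {x \<in> V. \<pi> x = i}" for i
    using fV by (intro finite_same_card_bij) (auto simp: J_def)
  then obtain h where h: "\<And>i. bij_betw (h i) {1..J i} {x \<in> V. \<pi> x = i}" by metis
  let ?V = "copies J (verts K)"
  define \<phi> where "\<phi> = (\<lambda>(i, k). h i k)"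
  have hm: "h i k \<in> V" "\<pi> (h i k) = i" if "k \<in> {1..J i}" for i k
    using bij_betwE[OF h[of i]] that by blast+
  have inj: "inj_on \<phi> ?V"
  proof (rule inj_onI, clarify)
    fix i k i' k' assume a: "(i, k) \<in> ?V" "(i', k') \<in> ?V" "\<phi> (i, k) = \<phi> (i', k')"
    then have r: "k \<in> {1..J i}" "k' \<in> {1..J i'}" by (simp_all add: copies_def)
    have e: "h i k = h i' k'" using a(3) by (simp add: \<phi>_def)
    then have "i = i'" using hm(2)[OF r(1)] hm(2)[OF r(2)] by simp
    moreover have "k = k'" using bij_betw_imp_inj_on[OF h[of i]] e r \<open>i = i'\<close> by (auto dest: inj_onD)
    ultimately show "i = i' \<and> k = k'" by simp
  qed
  have im: "\<phi> ` ?V = V"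
  proof
    show "\<phi> ` ?V \<subseteq> V" using hm by (auto simp: \<phi>_def copies_def)
    show "V \<subseteq> \<phi> ` ?V"
    proof
      fix x assume x: "x \<in> V"
      then have "x \<in> h (\<pi> x) ` {1..J (\<pi> x)}" using bij_betw_imp_surj_on[OF h[of "\<pi> x"]] by simp
      then obtain k where k: "k \<in> {1..J (\<pi> x)}" "x = h (\<pi> x) k" by blast
      have "\<pi> x \<in> verts K" using x \<pi>(2) unfolding V_def by blast
      then have "(\<pi> x, k) \<in> ?V" using k(1) by (simp add: copies_def)
      then show "x \<in> \<phi> ` ?V" using k(2) unfolding \<phi>_def by force
    qed
  qed
  have b: "bij_betw \<phi> ?V V" using inj im by (simp add: bij_betw_def)
  have p: "\<pi> (\<phi> x) = fst x" if "x \<in> ?V" for x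
    using that hm(2) by (auto simp: \<phi>_def copies_def)
  have "L = (\<lambda>\<sigma>. \<phi> ` \<sigma>) ` K_of K J"
    using fibre_cpx_image[OF b, of \<pi> fst K] p \<pi>(3) unfolding K_of_eq_fibre_cpx[OF K J] V_def by simp
  moreover have "verts (K_of K J) = ?V"
    unfolding K_of_eq_fibre_cpx[OF K J] by (rule verts_fibre_cpx[OF K fst_copies[OF J]])
  ultimately have "isomorphic (K_of K J) L"
    unfolding isomorphic_def using b V_def by (intro exI[of _ \<phi>]) simp
  then show "\<exists>J. (\<forall>i\<in>verts K. 1 \<le> J i) \<and> isomorphic (K_of K J) L" using J by blast
qed

section \<open>Purity and ridges of the complexes \<open>K(J)\<close>\<close>

lemma fibredD:
  assumes "fibred K L \<pi>"
  shows "finite (verts L)" "\<pi> ` verts L = verts K" "\<sigma> \<in> L \<longleftrightarrow> \<sigma> \<subseteq> verts L \<and> filled K (verts L) \<pi> \<sigma> \<in> K"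
proof -
  have L: "L = fibre_cpx K (verts L) \<pi>" and "finite (verts L)" "\<pi> ` verts L = verts K"
    using assms by (auto simp only: fibred_def)
  then show "finite (verts L)" "\<pi> ` verts L = verts K" by auto
  show "\<sigma> \<in> L \<longleftrightarrow> \<sigma> \<subseteq> verts L \<and> filled K (verts L) \<pi> \<sigma> \<in> K"
    by (subst (1) L) (rule fibre_cpx_iff)
qed

lemma fibred_simplicial:
  assumes K: "simplicial_cpx K" and f: "fibred K L \<pi>"
  shows "simplicial_cpx L"
proof -
  define V where "V = verts L"
  note L = fibredD(3)[OF f, folded V_def] and fV = fibredD(1)[OF f, folded V_def]
    and im = fibredD(2)[OF f, folded V_def]
  have "filled K V \<pi> {} = {}" unfolding filled_def im[symmetric] by auto
  then have "{} \<in> L" using L simplicial_cpx_empty[OF K] by simp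
  moreover have "\<tau> \<in> L" if "\<sigma> \<in> L" "\<tau> \<subseteq> \<sigma>" for \<sigma> \<tau>
    using that simplicial_cpx_subset[OF K _ filled_mono[OF that(2)]] unfolding L by blast
  moreover have "L \<subseteq> Pow V" unfolding V_def by blast
  then have "finite L" "\<forall>\<sigma>\<in>L. finite \<sigma>" using fV by (auto intro: finite_subset)
  ultimately show ?thesis unfolding simplicial_cpx_def by blast
qed

text \<open>The basis for counting faces through their complements: a vertex of \<open>K\<close> is
  unfilled exactly if one of its copies is missing.\<close>

lemma fibred_complement:
  assumes "fibred K L \<pi>"
  shows "\<pi> ` (verts L - \<sigma>) = verts K - filled K (verts L) \<pi> \<sigma>"
proof -
  have "\<pi> ` (V - \<sigma>) = \<pi> ` V - {i \<in> \<pi> ` V. \<forall>x\<in>V. \<pi> x = i \<longrightarrow> x \<in> \<sigma>}" for V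
    by (auto, metis DiffI imageI)
  then show ?thesis unfolding filled_def fibredD(2)[OF assms, symmetric] .
qed

text \<open>A facet of \<open>L\<close> omits exactly one copy of each vertex outside a facet of
  \<open>K\<close>. Hence complements of facets have the same size in both complexes.\<close>

lemma fibred_pure:
  assumes K: "simplicial_cpx K" and pr: "pure d K" and f: "fibred K L \<pi>"
  shows "pure (card (verts L) - (card (verts K) - d)) L"
proof -
  define V where "V = verts L"
  define U where "U = verts K"
  note L = fibredD(3)[OF f, folded V_def] and fV = fibredD(1)[OF f, folded V_def]
    and im = fibredD(2)[OF f, folded V_def U_def]
    and compl = fibred_complement[OF f, folded V_def U_def]
  have fU: "finite U" unfolding U_def by (rule simplicial_cpx_finite_verts[OF K])
  have KU: "\<rho> \<subseteq> U" if "\<rho> \<in> K" for \<rho> using that unfolding U_def by blast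
  have "card \<sigma> \<le> card V - (card U - d)" if \<sigma>: "\<sigma> \<in> L" for \<sigma>
  proof -
    let ?G = "filled K V \<pi> \<sigma>"
    have G: "?G \<in> K" "\<sigma> \<subseteq> V" using \<sigma> L by auto
    have "card ?G \<le> d" using pr G by (auto simp: pure_def)
    then have "card U - d \<le> card (U - ?G)" using KU[OF G(1)] fU by (simp add: card_Diff_subset finite_subset)
    also have "\<dots> \<le> card (V - \<sigma>)" unfolding compl[symmetric] using fV by (intro card_image_le) simp
    also have "\<dots> = card V - card \<sigma>" using G(2) fV by (simp add: card_Diff_subset finite_subset)
    finally show ?thesis using card_mono[OF fV G(2)] by linarith
  qed
  moreover have "\<exists>F\<in>L. \<sigma> \<subseteq> F \<and> card F = card V - (card U - d)" if \<sigma>: "\<sigma> \<in> L" for \<sigma>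
  proof -
    have s: "filled K V \<pi> \<sigma> \<in> K" "\<sigma> \<subseteq> V" using \<sigma> L by auto
    obtain G where G: "G \<in> K" "filled K V \<pi> \<sigma> \<subseteq> G" "card G = d" using pr s(1) by (auto simp: pure_def)
    have "\<exists>x\<in>V - \<sigma>. \<pi> x = i" if "i \<in> U - G" for i
    proof -
      have "i \<in> \<pi> ` (V - \<sigma>)" unfolding compl using that G(2) by blast
      then show ?thesis by blast
    qed
    then obtain x where x: "\<And>i. i \<in> U - G \<Longrightarrow> x i \<in> V - \<sigma> \<and> \<pi> (x i) = i" by metis
    define F where "F = V - x ` (U - G)"
    have "filled K V \<pi> F \<subseteq> G"
    proof
      fix i assume i: "i \<in> filled K V \<pi> F"
      show "i \<in> G"
      proof (rule ccontr)
        assume "i \<notin> G"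
        then have iU: "i \<in> U - G" using i by (simp add: filled_iff U_def)
        then have "x i \<in> F" using i x[OF iU] by (auto simp: filled_iff)
        then show False using iU unfolding F_def by blast
      qed
    qed
    then have "F \<in> L" unfolding L using simplicial_cpx_subset[OF K G(1)] by (auto simp: F_def)
    moreover have "\<sigma> \<subseteq> F" using s(2) x unfolding F_def by blast
    moreover have "card F = card V - (card U - d)"
    proof -
      have "inj_on x (U - G)" by (rule inj_on_inverseI[where g=\<pi>]) (use x in blast)
      then have "card (x ` (U - G)) = card U - d"
        using KU[OF G(1)] G(3) fU by (simp add: card_image card_Diff_subset finite_subset)
      moreover have "x ` (U - G) \<subseteq> V" using x by blast
      ultimately show ?thesis unfolding F_def using fV by (simp add: card_Diff_subset finite_subset)
    qed
    ultimately show ?thesis by blast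
  qed
  ultimately show ?thesis unfolding pure_def V_def U_def by blast
qed

lemma fibred_ridges_interior:
  assumes K: "simplicial_cpx K" and pr: "pure d K" and ri: "ridges_interior d K" and f: "fibred K L \<pi>"
  shows "ridges_interior (card (verts L) - (card (verts K) - d)) L"
proof -
  define V where "V = verts L"
  define U where "U = verts K"
  note L = fibredD(3)[OF f, folded V_def] and fV = fibredD(1)[OF f, folded V_def]
    and im = fibredD(2)[OF f, folded V_def U_def]
    and compl = fibred_complement[OF f, folded V_def U_def]
  have fU: "finite U" unfolding U_def by (rule simplicial_cpx_finite_verts[OF K])
  have KU: "\<rho> \<subseteq> U" if "\<rho> \<in> K" for \<rho> using that unfolding U_def by blast
  have "\<exists>x. x \<notin> F \<and> insert x (F - {v}) \<in> L"
    if F: "F \<in> L" "v \<in> F" "card F = card V - (card U - d)" for F v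
  proof -
    let ?G = "filled K V \<pi> F"
    have G: "?G \<in> K" "F \<subseteq> V" using F(1) L by auto
    have vV: "v \<in> V" using F(2) G(2) by blast
    \<comment> \<open>Exchanging \<open>v\<close> for \<open>x\<close> leaves \<open>\<pi> v\<close>
      unfilled and can fill at most \<open>\<pi> x\<close> anew.\<close>
    have swap: "insert x (F - {v}) \<in> L"
      if x: "x \<in> V" "x \<notin> F" and sub: "\<And>\<rho>. \<rho> \<subseteq> insert (\<pi> x) ?G - {\<pi> v} \<Longrightarrow> \<rho> \<in> K" for x
    proof -
      have "filled K V \<pi> (insert x (F - {v})) \<subseteq> insert (\<pi> x) ?G - {\<pi> v}"
      proof
        fix k assume k: "k \<in> filled K V \<pi> (insert x (F - {v}))"
        have "v \<noteq> x" using x(2) F(2) by blast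
        then have "k \<noteq> \<pi> v" using k vV by (auto simp: filled_iff)
        moreover have "k \<in> ?G" if "k \<noteq> \<pi> x"
          unfolding filled_iff
        proof (intro conjI ballI impI)
          show "k \<in> verts K" using k unfolding filled_iff by blast
          fix y assume "y \<in> V" "\<pi> y = k"
          then have "y \<in> insert x (F - {v})" "y \<noteq> x" using k that unfolding filled_iff by blast+
          then show "y \<in> F" by simp
        qed
        ultimately show "k \<in> insert (\<pi> x) ?G - {\<pi> v}" by blast
      qed
      then have "filled K V \<pi> (insert x (F - {v})) \<in> K" by (rule sub)
      then show ?thesis unfolding L using x(1) G(2) by blast
    qed
    show ?thesis
    proof (cases "\<pi> v \<in> ?G")
      \<comment> \<open>Some copy of \<open>\<pi> v\<close> is missing from \<open>F\<close>;
        exchanging \<open>v\<close> for it fills nothing new.\<close>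
      case False
      then have "\<pi> v \<in> \<pi> ` (V - F)" unfolding compl im[symmetric] using vV by simp
      then obtain x where x: "x \<in> V" "x \<notin> F" "\<pi> x = \<pi> v" by (elim imageE DiffE) simp
      have "\<rho> \<in> K" if "\<rho> \<subseteq> insert (\<pi> x) ?G - {\<pi> v}" for \<rho>
        using that x(3) by (intro simplicial_cpx_subset[OF K G(1)]) blast
      then show ?thesis using swap[OF x(1,2)] x(2) by blast
    next
      case True
      \<comment> \<open>Here \<open>F\<close> contains all copies of \<open>\<pi> v\<close>, so the
        exchange is found in \<open>K\<close>: comparing complements shows that the filled set is a
        facet, and a second facet through its ridge supplies a vertex \<open>j\<close>, a missing
        copy of which replaces \<open>v\<close>.\<close>
      have "card ?G = d"
      proof -
        have le: "card ?G \<le> d" using pr G by (auto simp: pure_def)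
        obtain H where H: "H \<in> K" "card H = d" using pr G(1) by (auto simp: pure_def)
        have dU: "d \<le> card U" using card_mono[OF fU KU[OF H(1)]] H(2) by simp
        have "card U - card ?G = card (U - ?G)" using KU[OF G(1)] fU by (simp add: card_Diff_subset finite_subset)
        also have "\<dots> \<le> card (V - F)" unfolding compl[symmetric] using fV by (intro card_image_le) simp
        also have "\<dots> = card V - card F" using G(2) fV by (simp add: card_Diff_subset finite_subset)
        finally have "card U - card ?G \<le> card V - card F" .
        moreover have "card ?G \<le> card U" using card_mono[OF fU KU[OF G(1)]] .
        moreover have "card U \<le> card V" using card_image_le[OF fV, of \<pi>] im by simp
        ultimately show ?thesis using le F(3) dU by linarith
      qed
      then obtain j where j: "j \<notin> ?G" "insert j (?G - {\<pi> v}) \<in> K"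
        using ri True G(1) unfolding ridges_interior_def by blast
      have "j \<in> U" using KU[OF j(2)] by blast
      then have "j \<in> \<pi> ` (V - F)" unfolding compl using j(1) by blast
      then obtain x where x: "x \<in> V" "x \<notin> F" "\<pi> x = j" by (elim imageE DiffE) simp
      have "\<rho> \<in> K" if "\<rho> \<subseteq> insert (\<pi> x) ?G - {\<pi> v}" for \<rho>
        using that x(3) by (intro simplicial_cpx_subset[OF K j(2)]) blast
      then show ?thesis using swap[OF x(1,2)] x(2) by blast
    qed
  qed
  then show ?thesis unfolding ridges_interior_def V_def[symmetric] U_def[symmetric] by blast
qed

section \<open>Vertices with equal rows in the dual map\<close>

lemma rk_eqI:
  assumes "finite L" "\<And>\<sigma>. \<sigma> \<in> L \<Longrightarrow> card \<sigma> \<le> n" "F \<in> L" "card F = n"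
  shows "rk L = n"
  unfolding rk_def using assms by (intro Max_eqI) auto

lemma pure_rk:
  assumes "simplicial_cpx L" "pure n L"
  shows "rk L = n"
proof -
  obtain F where "F \<in> L" "card F = n"
    using assms(2) simplicial_cpx_empty[OF assms(1)] unfolding pure_def by blast
  then show ?thesis
    using assms(2) by (intro rk_eqI[OF simplicial_cpx_finite[OF assms(1)]]) (auto simp: pure_def)
qed

text \<open>The transposition of \<open>v\<close> and \<open>w\<close> is then an automorphism of \<open>L\<close>, and every facet contains
  \<open>v\<close> or \<open>w\<close>.\<close>
definition twins :: "'v cpx \<Rightarrow> 'v \<Rightarrow> 'v \<Rightarrow> bool" where
  "twins L v w \<longleftrightarrow> v \<noteq> w \<and>
     (\<forall>\<sigma>\<in>L. v \<notin> \<sigma> \<longrightarrow> w \<notin> \<sigma> \<longrightarrow> insert v \<sigma> \<in> L \<and> insert w \<sigma> \<in> L)"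

lemma twins_sym: "twins L v w \<Longrightarrow> twins L w v"
  by (auto simp: twins_def)

text \<open>If a facet avoids both, the kernel vector of \<open>v\<close> relative to it is 1 at
  \<open>v\<close> and 0 at \<open>w\<close>.\<close>

lemma kernel_facet:
  assumes L: "simplicial_cpx L" and \<Lambda>: "char_map L \<Lambda>" and vw: "v \<in> verts L" "v \<noteq> w"
    and ker: "\<And>x. x \<in> char_kernel L \<Lambda> \<Longrightarrow> x v = x w" and F: "F \<in> L" "card F = rk L"
  shows "v \<in> F \<or> w \<in> F"
proof (rule ccontr)
  assume no: "\<not> (v \<in> F \<or> w \<in> F)"
  have FV: "F \<subseteq> verts L" using F(1) by blast
  obtain e where e: "bij_betw e {..<rk L} F"
    using F(2) simplicial_cpx_finite_face[OF L F(1)] by (metis bij_betw_from_nat_into_finite)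
  obtain \<Lambda>' where \<Lambda>': "DJ_equiv (rk L) \<Lambda> \<Lambda>'" "char_map L \<Lambda>'" "\<And>i. i < rk L \<Longrightarrow> \<Lambda>' (e i) = unit_vec i"
    using char_map_unit_columns[OF L \<Lambda> F(1) e] by blast
  have "v \<in> verts L - F" using vw(1) no by blast
  from kernel_vector[OF L e FV \<Lambda>'(3) this char_mapD(1)[OF \<Lambda>'(2) vw(1)]]
  have "(\<lambda>u. if u = v then 1 else if u \<in> F then \<Lambda>' v (the_inv_into {..<rk L} e u) else 0) \<in> char_kernel L \<Lambda>"
    unfolding DJ_equiv_char_kernel[OF \<Lambda>'(1)] by simp
  from ker[OF this] show False using vw(2) no by simp
qed

text \<open>If a facet contains \<open>v\<close> but not \<open>w\<close>, a second facet through
  the ridge opposite to \<open>v\<close> must contain one of the two, and so it arises by exchanging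
  \<open>v\<close> for \<open>w\<close>. Faces inherit this from the facets that contain
  them.\<close>

lemma kernel_twins:
  assumes L: "simplicial_cpx L" and pr: "pure (rk L) L" and ri: "ridges_interior (rk L) L"
    and \<Lambda>: "char_map L \<Lambda>" and vw: "v \<in> verts L" "v \<noteq> w"
    and ker: "\<And>x. x \<in> char_kernel L \<Lambda> \<Longrightarrow> x v = x w"
  shows "twins L v w"
proof -
  have facet: "v \<in> F \<or> w \<in> F" if "F \<in> L" "card F = rk L" for F
    by (rule kernel_facet[OF L \<Lambda> vw ker that])
  have swap: "insert b \<sigma> \<in> L" if F: "F \<in> L" "card F = rk L" "\<sigma> \<subseteq> F" "a \<in> F" "a \<notin> \<sigma>" and ab: "{a, b} = {v, w}" for F \<sigma> a b
  proof (cases "b \<in> F")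
    case True
    then show ?thesis using F by (intro simplicial_cpx_subset[OF L F(1)]) blast
  next
    case False
    obtain x where x: "x \<notin> F" "insert x (F - {a}) \<in> L"
      using ri F(1,2,4) unfolding ridges_interior_def by blast
    have "finite F" using simplicial_cpx_finite_face[OF L F(1)] .
    then have "card (insert x (F - {a})) = rk L"
      using x(1) F(2) card_Suc_Diff1[OF _ F(4)] by simp
    from facet[OF x(2) this] have "x = b" using ab False x(1) F(4) by (auto simp: doubleton_eq_iff)
    then show ?thesis using F(3,5) x(2) by (intro simplicial_cpx_subset[OF L x(2)]) blast
  qed
  have "insert v \<sigma> \<in> L \<and> insert w \<sigma> \<in> L" if \<sigma>: "\<sigma> \<in> L" "v \<notin> \<sigma>" "w \<notin> \<sigma>" for \<sigma>
  proof -
    obtain F where F: "F \<in> L" "\<sigma> \<subseteq> F" "card F = rk L" using pr \<sigma>(1) unfolding pure_def by blast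
    have self: "insert a \<sigma> \<in> L" if "a \<in> F" for a
      using that F(2) by (intro simplicial_cpx_subset[OF L F(1)]) blast
    show ?thesis
      using facet[OF F(1,3)]
    proof
      assume "v \<in> F"
      then show ?thesis using self[of v] swap[OF F(1,3,2) _ \<sigma>(2), of w] by blast
    next
      assume "w \<in> F"
      then show ?thesis using self[of w] swap[OF F(1,3,2) _ \<sigma>(3), of v] by blast
    qed
  qed
  then show ?thesis using vw(2) by (simp add: twins_def)
qed

section \<open>Twins, suspended pairs and wedges\<close>

lemma joinI: "\<rho> \<in> A \<Longrightarrow> \<tau> \<in> B \<Longrightarrow> \<sigma> = \<rho> \<union> \<tau> \<Longrightarrow> \<sigma> \<in> join A B"
  by (auto simp: join_def)

lemma joinE:
  assumes "\<sigma> \<in> join A B"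
  obtains \<rho> \<tau> where "\<sigma> = \<rho> \<union> \<tau>" "\<rho> \<in> A" "\<tau> \<in> B"
  using assms by (auto simp: join_def)

text \<open>The shape of a wedge before the merged vertex has a name: the two sets in braces are its
  future link and deletion. If the edge \<open>{v, w}\<close> is missing, the first join is empty
  and a suspension remains.\<close>

lemma twins_decomposition:
  assumes L: "simplicial_cpx L" and tw: "twins L v w"
  shows "L = join (full_simplex {v, w}) {\<tau>. v \<notin> \<tau> \<and> w \<notin> \<tau> \<and> insert v (insert w \<tau>) \<in> L} \<union>
     join (simplex_boundary {v, w}) {\<tau> \<in> L. v \<notin> \<tau> \<and> w \<notin> \<tau>}" (is "_ = ?A \<union> ?B")
proof (intro subset_antisym subsetI)
  fix \<sigma> assume \<sigma>: "\<sigma> \<in> L"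
  have eq: "\<sigma> = (\<sigma> \<inter> {v, w}) \<union> (\<sigma> - {v, w})" by blast
  show "\<sigma> \<in> ?A \<union> ?B"
  proof (cases "{v, w} \<subseteq> \<sigma>")
    case True
    then have "insert v (insert w (\<sigma> - {v, w})) = \<sigma>" by blast
    then have "\<sigma> \<in> ?A" using \<sigma> eq by (intro joinI[of "\<sigma> \<inter> {v, w}" _ "\<sigma> - {v, w}"]) simp_all
    then show ?thesis by (rule UnI1)
  next
    case False
    then have "\<sigma> \<inter> {v, w} \<in> simplex_boundary {v, w}" unfolding simplex_boundary_def by blast
    moreover have "\<sigma> - {v, w} \<in> {\<tau> \<in> L. v \<notin> \<tau> \<and> w \<notin> \<tau>}" using simplicial_cpx_subset[OF L \<sigma>] by simp
    ultimately have "\<sigma> \<in> ?B" using eq by (rule joinI)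
    then show ?thesis by (rule UnI2)
  qed
next
  fix \<sigma> assume "\<sigma> \<in> ?A \<union> ?B"
  then show "\<sigma> \<in> L"
  proof (elim UnE joinE)
    fix \<rho> \<tau> assume a: "\<sigma> = \<rho> \<union> \<tau>" "\<rho> \<in> Pow {v, w}"
      "\<tau> \<in> {\<tau>. v \<notin> \<tau> \<and> w \<notin> \<tau> \<and> insert v (insert w \<tau>) \<in> L}"
    then have "insert v (insert w \<tau>) \<in> L" "\<sigma> \<subseteq> insert v (insert w \<tau>)" by auto
    then show ?thesis by (rule simplicial_cpx_subset[OF L])
  next
    fix \<rho> \<tau> assume a: "\<sigma> = \<rho> \<union> \<tau>" "\<rho> \<in> simplex_boundary {v, w}" "\<tau> \<in> {\<tau> \<in> L. v \<notin> \<tau> \<and> w \<notin> \<tau>}"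
    have "\<rho> \<subseteq> {v} \<or> \<rho> \<subseteq> {w}" using a(2) unfolding simplex_boundary_def by blast
    then have "\<sigma> \<subseteq> insert v \<tau> \<or> \<sigma> \<subseteq> insert w \<tau>" using a(1) by blast
    moreover have "insert v \<tau> \<in> L" "insert w \<tau> \<in> L" using tw a(3) by (simp_all add: twins_def)
    ultimately show ?thesis using simplicial_cpx_subset[OF L] by blast
  qed
qed

lemma twins_suspended_pair:
  assumes L: "simplicial_cpx L" and tw: "twins L v w" and "{v, w} \<notin> L"
  shows "suspended_pair L v w"
proof -
  let ?L = "{\<tau> \<in> L. v \<notin> \<tau> \<and> w \<notin> \<tau>}"
  have "insert v (insert w \<tau>) \<notin> L" for \<tau>
    using assms(3) simplicial_cpx_subset[OF L, of "insert v (insert w \<tau>)" "{v, w}"] by blast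
  then have "L = join (simplex_boundary {v, w}) ?L"
    using twins_decomposition[OF L tw] by (simp add: join_def)
  moreover have "simplicial_cpx ?L"
    using simplicial_cpx_finite[OF L] simplicial_cpx_finite_face[OF L] simplicial_cpx_empty[OF L]
      simplicial_cpx_subset[OF L] unfolding simplicial_cpx_def by auto
  moreover have "v \<notin> verts ?L" "w \<notin> verts ?L" "v \<noteq> w" using tw by (auto simp: twins_def)
  ultimately show ?thesis unfolding suspended_pair_def by blast
qed

text \<open>The link of \<open>w\<close>, with \<open>v\<close> renamed to \<open>z\<close>.\<close>
definition merge_pair :: "'v cpx \<Rightarrow> 'v \<Rightarrow> 'v \<Rightarrow> 'v \<Rightarrow> 'v cpx" where
  "merge_pair L v w z = {\<tau> \<in> L. v \<notin> \<tau> \<and> w \<notin> \<tau>} \<union>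
     {insert z \<tau> |\<tau>. v \<notin> \<tau> \<and> w \<notin> \<tau> \<and> insert v (insert w \<tau>) \<in> L}"

lemma merge_pair_iff:
  assumes "z \<notin> verts L"
  shows "z \<notin> \<sigma> \<Longrightarrow> \<sigma> \<in> merge_pair L v w z \<longleftrightarrow> \<sigma> \<in> L \<and> v \<notin> \<sigma> \<and> w \<notin> \<sigma>"
    "z \<notin> \<sigma> \<Longrightarrow> insert z \<sigma> \<in> merge_pair L v w z \<longleftrightarrow> v \<notin> \<sigma> \<and> w \<notin> \<sigma> \<and> insert v (insert w \<sigma>) \<in> L"
proof -
  assume z: "z \<notin> \<sigma>"
  then show "\<sigma> \<in> merge_pair L v w z \<longleftrightarrow> \<sigma> \<in> L \<and> v \<notin> \<sigma> \<and> w \<notin> \<sigma>" by (auto simp: merge_pair_def)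
  have "\<tau> = \<sigma>" if "insert z \<sigma> = insert z \<tau>" "insert v (insert w \<tau>) \<in> L" for \<tau>
  proof -
    have "z \<notin> \<tau>" using assms that(2) by blast
    then show ?thesis using that(1) z by (metis insert_ident)
  qed
  moreover have "insert z \<sigma> \<notin> L" using assms by blast
  ultimately show "insert z \<sigma> \<in> merge_pair L v w z \<longleftrightarrow> v \<notin> \<sigma> \<and> w \<notin> \<sigma> \<and> insert v (insert w \<sigma>) \<in> L"
    unfolding merge_pair_def by blast
qed

text \<open>An equation rather than an isomorphism, as \<open>v\<close> and \<open>w\<close>
  themselves are the new vertices of the wedge. The inductive step therefore yields the property for
  \<open>L\<close> itself and not for a relabeled copy.\<close>

lemma wedge_merge_pair:
  assumes L: "simplicial_cpx L" and tw: "twins L v w" and z: "z \<notin> verts L"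
  shows "wedge (merge_pair L v w z) z v w = L"
proof -
  have "z \<notin> \<tau>" if "insert v (insert w \<tau>) \<in> L" for \<tau> using that z by blast
  then have "link (merge_pair L v w z) z = {\<tau>. v \<notin> \<tau> \<and> w \<notin> \<tau> \<and> insert v (insert w \<tau>) \<in> L}"
    unfolding link_def using merge_pair_iff(2)[OF z, of _ v w] by (intro Collect_cong) metis
  moreover have "z \<notin> \<tau>" if "\<tau> \<in> L" for \<tau> using that z by blast
  then have "deletion (merge_pair L v w z) z = {\<tau> \<in> L. v \<notin> \<tau> \<and> w \<notin> \<tau>}"
    unfolding deletion_def using merge_pair_iff(1)[OF z, of _ v w] by (intro Collect_cong) metis
  ultimately show ?thesis unfolding wedge_def using twins_decomposition[OF L tw] by simp
qed

lemma verts_merge_pair: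
  assumes L: "simplicial_cpx L" and z: "z \<notin> verts L" and vw: "{v, w} \<in> L"
  shows "verts (merge_pair L v w z) = insert z (verts L - {v, w})"
proof (intro subset_antisym subsetI)
  fix x assume "x \<in> verts (merge_pair L v w z)"
  then show "x \<in> insert z (verts L - {v, w})" unfolding merge_pair_def by blast
next
  fix x assume x: "x \<in> insert z (verts L - {v, w})"
  show "x \<in> verts (merge_pair L v w z)"
  proof (cases "x = z")
    case True
    have "insert z {} \<in> merge_pair L v w z" using merge_pair_iff(2)[OF z, of "{}"] vw by simp
    then show ?thesis using True by blast
  next
    case False
    then have "x \<in> verts L" "x \<noteq> v" "x \<noteq> w" using x by simp_all
    then have "{x} \<in> merge_pair L v w z" using simplicial_cpx_vertex[OF L, of x] by (simp add: merge_pair_def)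
    then show ?thesis by blast
  qed
qed

text \<open>One vertex is lost: \<open>z\<close> stands for both \<open>v\<close> and
  \<open>w\<close>, and a face without \<open>z\<close> can be enlarged by \<open>v\<close> in
  \<open>L\<close>.\<close>

lemma rk_merge_pair:
  assumes L: "simplicial_cpx L" and pr: "pure (Suc n) L" and tw: "twins L v w" and z: "z \<notin> verts L"
    and vw: "{v, w} \<in> L"
  shows "rk (merge_pair L v w z) = n"
proof -
  have vne: "v \<noteq> w" using tw by (simp add: twins_def)
  have two: "finite \<tau>" "card (insert v (insert w \<tau>)) = Suc (Suc (card \<tau>))" "z \<notin> \<tau>"
    if "insert v (insert w \<tau>) \<in> L" "v \<notin> \<tau>" "w \<notin> \<tau>" for \<tau>
  proof -
    show "finite \<tau>" using simplicial_cpx_finite_face[OF L that(1)] by simp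
    then show "card (insert v (insert w \<tau>)) = Suc (Suc (card \<tau>))" using that vne by simp
    show "z \<notin> \<tau>" using that(1) z by blast
  qed
  have le: "card \<sigma> \<le> n" if "\<sigma> \<in> merge_pair L v w z" for \<sigma>
  proof -
    from that consider "\<sigma> \<in> L" "v \<notin> \<sigma>" "w \<notin> \<sigma>"
      | \<tau> where "\<sigma> = insert z \<tau>" "v \<notin> \<tau>" "w \<notin> \<tau>" "insert v (insert w \<tau>) \<in> L"
      unfolding merge_pair_def by blast
    then show ?thesis
    proof cases
      case 1
      then have "insert v \<sigma> \<in> L" using tw by (simp add: twins_def)
      then have "card (insert v \<sigma>) \<le> Suc n" using pr by (simp add: pure_def)
      then show ?thesis using 1(2) simplicial_cpx_finite_face[OF L 1(1)] by simp
    next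
      case 2
      have "card (insert v (insert w \<tau>)) \<le> Suc n" using pr 2(4) by (simp add: pure_def)
      then show ?thesis using two[OF 2(4,2,3)] 2(1) by simp
    qed
  qed
  obtain F where F: "F \<in> L" "{v, w} \<subseteq> F" "card F = Suc n" using pr vw unfolding pure_def by blast
  define \<tau> where "\<tau> = F - {v, w}"
  have F': "insert v (insert w \<tau>) = F" "v \<notin> \<tau>" "w \<notin> \<tau>" using F(2) unfolding \<tau>_def by blast+
  have t: "insert v (insert w \<tau>) \<in> L" using F(1) F'(1) by simp
  have "insert z \<tau> \<in> merge_pair L v w z" using merge_pair_iff(2)[OF z two(3)[OF t F'(2,3)]] F' t by simp
  moreover have "card (insert z \<tau>) = n" using two[OF t F'(2,3)] F'(1) F(3) by simp
  moreover have "finite (merge_pair L v w z)"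
  proof (rule finite_subset)
    show "merge_pair L v w z \<subseteq> Pow (insert z (verts L))" unfolding merge_pair_def by blast
    show "finite (Pow (insert z (verts L)))" using simplicial_cpx_finite_verts[OF L] by simp
  qed
  ultimately show ?thesis using le rk_eqI by blast
qed

text \<open>Merging drops \<open>v\<close> from the copies of its vertex, while \<open>z\<close>
  takes the place of \<open>w\<close>. The further copy \<open>x\<close> keeps the fibre over
  \<open>\<pi> v\<close> nonempty, so that no vertex of \<open>K\<close> gets lost.\<close>

lemma fibred_merge_pair:
  assumes K: "simplicial_cpx K" and f: "fibred K L \<pi>" and tw: "twins L v w" and z: "z \<notin> verts L"
    and vw: "{v, w} \<in> L" and x: "x \<in> verts L" "x \<noteq> v" "\<pi> x = \<pi> v"
  shows "fibred K (merge_pair L v w z) (\<pi>(z := \<pi> w))"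
proof -
  note L = fibred_simplicial[OF K f]
  define V where "V = verts L"
  define V' where "V' = insert z (V - {v, w})"
  let ?\<pi> = "\<pi>(z := \<pi> w)"
  note Lf = fibredD(3)[OF f, folded V_def] and fV = fibredD(1)[OF f, folded V_def]
    and im = fibredD(2)[OF f, folded V_def]
  note z' = z[folded V_def] and x' = x[folded V_def]
  have vV: "v \<in> V" "w \<in> V" "v \<noteq> w" using vw tw unfolding V_def twins_def by blast+
  have vM: "verts (merge_pair L v w z) = V'" using verts_merge_pair[OF L z vw] unfolding V'_def V_def .
  have same: "?\<pi> y = \<pi> y" if "y \<in> V" for y using that z' by auto
  have "?\<pi> ` V' = \<pi> ` V"
  proof (intro subset_antisym subsetI)
    fix i assume "i \<in> ?\<pi> ` V'"
    then show "i \<in> \<pi> ` V" using vV same by (auto simp: V'_def split: if_splits)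
  next
    fix i assume "i \<in> \<pi> ` V"
    then obtain y where y: "y \<in> V" "i = \<pi> y" by blast
    have w: "\<pi> w \<in> ?\<pi> ` V'" by (rule image_eqI[of _ _ z]) (auto simp: V'_def)
    have other: "\<pi> y \<in> ?\<pi> ` V'" if "y \<in> V" "y \<noteq> v" for y
    proof (cases "y = w")
      case False
      then show ?thesis using that same[of y] by (intro image_eqI[of _ _ y]) (auto simp: V'_def)
    qed (use w in simp)
    show "i \<in> ?\<pi> ` V'" using other[OF x'(1,2)] other[OF y(1)] x'(3) y(2) by (cases "y = v") auto
  qed
  then have imM: "?\<pi> ` V' = verts K" using im by simp
  have "\<sigma> \<in> merge_pair L v w z \<longleftrightarrow> \<sigma> \<subseteq> V' \<and> filled K V' ?\<pi> \<sigma> \<in> K" for \<sigma>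
  proof (cases "\<sigma> \<subseteq> V'")
    case False
    have "\<sigma> \<notin> merge_pair L v w z" using False unfolding vM[symmetric] by blast
    then show ?thesis using False by blast
  next
    case True
    have vz: "v \<noteq> z" "w \<noteq> z" using vV z' by auto
    have nv: "v \<notin> \<sigma>" "w \<notin> \<sigma>" using True vz unfolding V'_def by blast+
    show ?thesis
    proof (cases "z \<in> \<sigma>")
      case zn: False
      have sV: "\<sigma> \<subseteq> V" using True zn unfolding V'_def by blast
      have "filled K V' ?\<pi> \<sigma> \<in> K \<longleftrightarrow> \<sigma> \<in> L"
      proof
        \<comment> \<open>Once the copy \<open>v\<close> is gone, \<open>\<sigma>\<close> may fill
          \<open>\<pi> v\<close>. This does no harm, because for twins
          \<open>insert v \<sigma>\<close> is a face of \<open>L\<close> as well.\<close>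
        assume "\<sigma> \<in> L"
        then have "insert v \<sigma> \<in> L" using tw nv by (simp add: twins_def)
        then have "filled K V \<pi> (insert v \<sigma>) \<in> K" using Lf by blast
        moreover have "filled K V' ?\<pi> \<sigma> \<subseteq> filled K V \<pi> (insert v \<sigma>)"
        proof
          fix k assume k: "k \<in> filled K V' ?\<pi> \<sigma>"
          then have kK: "k \<in> verts K" and kx: "\<And>y. y \<in> V' \<Longrightarrow> ?\<pi> y = k \<Longrightarrow> y \<in> \<sigma>"
            unfolding filled_iff by blast+
          have "k \<noteq> \<pi> w" using kx[of z] zn by (auto simp: V'_def)
          then have "y \<in> insert v \<sigma>" if "y \<in> V" "\<pi> y = k" for y
            using kx[of y] that same[of y] by (auto simp: V'_def)
          then show "k \<in> filled K V \<pi> (insert v \<sigma>)" using kK unfolding filled_iff by blast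
        qed
        ultimately show "filled K V' ?\<pi> \<sigma> \<in> K" using simplicial_cpx_subset[OF K] by blast
      next
        assume F: "filled K V' ?\<pi> \<sigma> \<in> K"
        have "filled K V \<pi> \<sigma> \<subseteq> filled K V' ?\<pi> \<sigma>"
        proof
          fix k assume k: "k \<in> filled K V \<pi> \<sigma>"
          then have kK: "k \<in> verts K" and kx: "\<And>y. y \<in> V \<Longrightarrow> \<pi> y = k \<Longrightarrow> y \<in> \<sigma>"
            unfolding filled_iff by blast+
          have "k \<noteq> \<pi> w" using kx[of w] nv vV by auto
          then have "y \<in> \<sigma>" if "y \<in> V'" "?\<pi> y = k" for y
            using kx[of y] that same[of y] by (auto simp: V'_def split: if_splits)
          then show "k \<in> filled K V' ?\<pi> \<sigma>" using kK unfolding filled_iff by blast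
        qed
        then have "filled K V \<pi> \<sigma> \<in> K" using simplicial_cpx_subset[OF K F] by blast
        then show "\<sigma> \<in> L" using Lf sV by blast
      qed
      then show ?thesis using True nv merge_pair_iff(1)[OF z zn] by blast
    next
      case zs: True
      define \<tau> where "\<tau> = \<sigma> - {z}"
      have \<tau>: "\<sigma> = insert z \<tau>" "z \<notin> \<tau>" "v \<notin> \<tau>" "w \<notin> \<tau>" "\<tau> \<subseteq> V"
        using zs nv True unfolding \<tau>_def V'_def by blast+
      have "(\<forall>y\<in>V'. ?\<pi> y = k \<longrightarrow> y \<in> \<sigma>) \<longleftrightarrow> (\<forall>y\<in>V. \<pi> y = k \<longrightarrow> y \<in> insert v (insert w \<tau>))" for k
        unfolding V'_def \<tau>(1) using same z' by auto
      then have "filled K V' ?\<pi> \<sigma> = filled K V \<pi> (insert v (insert w \<tau>))" unfolding filled_def by blast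
      moreover have "insert v (insert w \<tau>) \<in> L \<longleftrightarrow> filled K V \<pi> (insert v (insert w \<tau>)) \<in> K"
        using Lf \<tau>(5) vV by blast
      ultimately show ?thesis using True \<tau> merge_pair_iff(2)[OF z \<tau>(2), of v w] by simp
    qed
  qed
  then have "merge_pair L v w z = fibre_cpx K V' ?\<pi>" unfolding fibre_cpx_def by blast
  moreover have "finite V'" using fV unfolding V'_def by simp
  ultimately show ?thesis unfolding fibred_def vM using imM by simp
qed

text \<open>After normalizing the columns of a facet containing \<open>v\<close> and \<open>w\<close>, the first two rows agree outside
  the columns of \<open>v\<close> and \<open>w\<close>, because the kernel cannot tell \<open>v\<close> from \<open>w\<close>.\<close>
lemma canonical_extension_merge_pair:
  assumes L: "simplicial_cpx L" and pr: "pure (rk L) L" and \<Lambda>: "char_map L \<Lambda>"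
    and tw: "twins L v w" and z: "z \<notin> verts L" and vw: "{v, w} \<in> L"
    and ker: "\<And>x. x \<in> char_kernel L \<Lambda> \<Longrightarrow> x v = x w"
  shows "\<exists>\<Lambda>'. char_map (merge_pair L v w z) \<Lambda>' \<and> canonical_extension (merge_pair L v w z) z v w \<Lambda>' \<Lambda>"
proof -
  define V where "V = verts L"
  have zV: "z \<notin> V" using z V_def by simp
  have vne: "v \<noteq> w" using tw by (simp add: twins_def)
  have vV: "v \<in> V" "w \<in> V" using vw unfolding V_def by blast+
  have vz: "v \<noteq> z" "w \<noteq> z" using vV zV by auto
  obtain F where F: "F \<in> L" "{v, w} \<subseteq> F" "card F = rk L" using pr vw unfolding pure_def by blast
  have fF: "finite F" using simplicial_cpx_finite_face[OF L F(1)] .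
  have FV: "F \<subseteq> V" using F(1) unfolding V_def by blast
  obtain xs where xs: "set xs = F - {v, w}" "distinct xs" using finite_distinct_list[of "F - {v, w}"] fF by blast
  define ys where "ys = v # w # xs"
  have ys: "set ys = F" "distinct ys" using xs F(2) vne unfolding ys_def by auto
  have len: "length ys = rk L" using distinct_card[OF ys(2)] ys(1) F(3) by simp
  define n where "n = length xs"
  have rkL: "rk L = Suc (Suc n)" using len by (simp add: ys_def n_def)
  define e where "e = (!) ys"
  have e: "bij_betw e {..<rk L} F" unfolding e_def by (rule bij_betw_nth[OF ys(2)]) (use len ys(1) in auto)
  have e01: "e 0 = v" "e 1 = w" by (simp_all add: e_def ys_def)
  have einj: "e i = e j \<longleftrightarrow> i = j" if "i < rk L" "j < rk L" for i j
    using e that by (auto simp: bij_betw_def inj_on_def)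
  have einv: "the_inv_into {..<rk L} e (e i) = i" if "i < rk L" for i
    using e that by (intro the_inv_into_f_f) (auto simp: bij_betw_def)
  obtain \<Lambda>0 where \<Lambda>0: "DJ_equiv (rk L) \<Lambda> \<Lambda>0" "char_map L \<Lambda>0" "\<And>i. i < rk L \<Longrightarrow> \<Lambda>0 (e i) = unit_vec i"
    using char_map_unit_columns[OF L \<Lambda> F(1) e] by blast
  have u01: "\<Lambda>0 v = unit_vec 0" "\<Lambda>0 w = unit_vec 1" using \<Lambda>0(3)[of 0] \<Lambda>0(3)[of 1] rkL e01 by simp_all
  have out: "\<Lambda>0 u = 0" if "u \<notin> V" for u using char_mapD(2)[OF \<Lambda>0(2)] that unfolding V_def .
  have vec: "\<Lambda>0 u k = 0" if "rk L \<le> k" for u k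
    using char_mapD(1)[OF \<Lambda>0(2), of u] out[of u] that unfolding V_def[symmetric]
    by (cases "u \<in> V") (auto simp: Z2_vec_def)
  have rows: "\<Lambda>0 u 0 = \<Lambda>0 u 1" if u: "u \<noteq> v" "u \<noteq> w" for u
  proof -
    consider "u \<in> F" | "u \<in> V - F" | "u \<notin> V" by blast
    then show ?thesis
    proof cases
      case 1
      then obtain i where i: "i < rk L" "u = e i" using e by (metis bij_betw_imp_surj_on imageE lessThan_iff)
      then have "i \<noteq> 0" "i \<noteq> 1" using u e01 by metis+
      then show ?thesis using \<Lambda>0(3)[OF i(1)] i(2) by (simp add: unit_vec_def)
    next
      case 2
      have "(\<lambda>x. if x = u then 1 else if x \<in> F then \<Lambda>0 u (the_inv_into {..<rk L} e x) else 0) \<in> char_kernel L \<Lambda>0"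
      proof (rule kernel_vector[OF L e FV[unfolded V_def] \<Lambda>0(3)])
        show "u \<in> verts L - F" using 2 unfolding V_def .
        then show "\<Lambda>0 u \<in> Z2_vec {..<rk L}" by (intro char_mapD(1)[OF \<Lambda>0(2)]) (rule DiffD1)
      qed
      from ker[OF this[unfolded DJ_equiv_char_kernel[OF \<Lambda>0(1)]]]
      have "\<Lambda>0 u (the_inv_into {..<rk L} e v) = \<Lambda>0 u (the_inv_into {..<rk L} e w)" using u F(2) by auto
      then show ?thesis using einv[of 0] einv[of 1] e01 rkL by simp
    qed (simp add: out)
  qed
  let ?M = "merge_pair L v w z"
  have vM: "verts ?M = insert z (V - {v, w})" using verts_merge_pair[OF L z vw] unfolding V_def .
  have rkM: "rk ?M = Suc n" using rk_merge_pair[OF L _ tw z vw] pr rkL by simp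
  \<comment> \<open>Rows 0 and 1, which agree outside \<open>v\<close> and \<open>w\<close>, are
    kept once; the index of every later row drops by one, and \<open>z\<close> gets the first unit
    vector.\<close>
  define \<Lambda>' where "\<Lambda>' = (\<lambda>x. if x = z then unit_vec 0 else if x \<in> V - {v, w}
      then (\<lambda>i. case i of 0 \<Rightarrow> \<Lambda>0 x 0 | Suc k \<Rightarrow> \<Lambda>0 x (Suc (Suc k))) else 0)"
  have sums: "(\<Sum>x\<in>B. \<Lambda>0 x) 0 = (\<Sum>x\<in>B. \<Lambda>' x) 0" "(\<Sum>x\<in>B. \<Lambda>0 x) (Suc 0) = (\<Sum>x\<in>B. \<Lambda>' x) 0"
    "(\<Sum>x\<in>B. \<Lambda>0 x) (Suc (Suc k)) = (\<Sum>x\<in>B. \<Lambda>' x) (Suc k)" if B: "B \<subseteq> V - {v, w}" for B k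
  proof -
    have B': "x \<noteq> z" "x \<in> V" "x \<noteq> v" "x \<noteq> w" if "x \<in> B" for x using that B zV by auto
    show "(\<Sum>x\<in>B. \<Lambda>0 x) 0 = (\<Sum>x\<in>B. \<Lambda>' x) 0"
      unfolding sum_bit_apply using B' by (intro sum.cong) (auto simp: \<Lambda>'_def)
    show "(\<Sum>x\<in>B. \<Lambda>0 x) (Suc 0) = (\<Sum>x\<in>B. \<Lambda>' x) 0"
      unfolding sum_bit_apply using B' rows by (intro sum.cong) (auto simp: \<Lambda>'_def)
    show "(\<Sum>x\<in>B. \<Lambda>0 x) (Suc (Suc k)) = (\<Sum>x\<in>B. \<Lambda>' x) (Suc k)"
      unfolding sum_bit_apply using B' by (intro sum.cong) (auto simp: \<Lambda>'_def)
  qed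
  have ind0: "(\<Sum>x\<in>B. \<Lambda>0 x) \<noteq> 0" if "\<sigma> \<in> L" "B \<subseteq> \<sigma>" "B \<noteq> {}" for \<sigma> B
    using char_mapD(3)[OF \<Lambda>0(2) that(1)] indep_family_iff[OF simplicial_cpx_finite_face[OF L that(1)]] that(2,3)
    by blast
  have free: "(\<Sum>x\<in>B. \<Lambda>' x) \<noteq> 0" if B: "\<sigma> \<in> L" "B \<subseteq> \<sigma>" "v \<notin> B" "w \<notin> B" "B \<noteq> {}" for \<sigma> B
  proof
    assume s: "(\<Sum>x\<in>B. \<Lambda>' x) = 0"
    have BV: "B \<subseteq> V - {v, w}" using B unfolding V_def by blast
    have "(\<Sum>x\<in>B. \<Lambda>0 x) i = 0" for i
    proof (cases i)
      case (Suc j)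
      then show ?thesis using sums(2,3)[OF BV] s by (cases j) simp_all
    qed (use sums(1)[OF BV] s in simp)
    then have "(\<Sum>x\<in>B. \<Lambda>0 x) = 0" by (simp add: fun_eq_iff)
    then show False using ind0[OF B(1,2,5)] by blast
  qed
  have "char_map ?M \<Lambda>'"
    unfolding char_map_def
  proof (intro conjI ballI allI impI)
    fix x
    show "\<Lambda>' x \<in> Z2_vec {..<rk ?M}"
      unfolding rkM Z2_vec_def \<Lambda>'_def using vec rkL by (auto simp: unit_vec_def split: nat.split)
    show "\<Lambda>' x = 0" if "x \<notin> verts ?M" using that unfolding vM \<Lambda>'_def by auto
  next
    fix \<sigma> assume \<sigma>: "\<sigma> \<in> ?M"
    then consider "\<sigma> \<in> L" "v \<notin> \<sigma>" "w \<notin> \<sigma>"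
      | \<tau> where "\<sigma> = insert z \<tau>" "v \<notin> \<tau>" "w \<notin> \<tau>" "insert v (insert w \<tau>) \<in> L"
      unfolding merge_pair_def by blast
    then show "indep_family \<sigma> \<Lambda>'"
    proof cases
      case 1
      then show ?thesis
        unfolding indep_family_iff[OF simplicial_cpx_finite_face[OF L 1(1)]] using free by blast
    next
      case 2
      have f\<tau>: "finite \<tau>" using simplicial_cpx_finite_face[OF L 2(4)] by simp
      have "(\<Sum>x\<in>B. \<Lambda>' x) \<noteq> 0" if B: "B \<subseteq> insert z \<tau>" "B \<noteq> {}" for B
      proof (cases "z \<in> B")
        case False
        then have "B \<subseteq> \<tau>" using B(1) by blast
        then show ?thesis using free[OF 2(4), of B] B(2) 2(2,3) by blast
      next
        case True
        \<comment> \<open>A vanishing sum through \<open>z\<close> would lift to a vanishing sum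
          over \<open>v\<close>, \<open>w\<close> and \<open>C\<close>: the unit vectors of
          \<open>v\<close> and \<open>w\<close> cancel rows 0 and 1 as that of \<open>z\<close>
          cancels the merged row.\<close>
        define C where "C = B - {z}"
        have C: "B = insert z C" "z \<notin> C" "C \<subseteq> \<tau>" using True B(1) unfolding C_def by blast+
        have fC: "finite C" using C(3) f\<tau> finite_subset by blast
        have vC: "v \<notin> C" "w \<notin> C" using C(3) 2(2,3) by blast+
        have CV: "C \<subseteq> V - {v, w}" using C(3) 2(2-4) unfolding V_def by blast
        show ?thesis
        proof
          assume "(\<Sum>x\<in>B. \<Lambda>' x) = 0"
          then have s: "unit_vec 0 + (\<Sum>x\<in>C. \<Lambda>' x) = 0" using C(2) fC unfolding C(1) by (simp add: \<Lambda>'_def)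
          have s': "unit_vec 0 k + (\<Sum>x\<in>C. \<Lambda>' x) k = 0" for k
            using fun_cong[OF s, of k] unfolding plus_fun_apply zero_fun_apply .
          have "(\<Sum>x\<in>insert v (insert w C). \<Lambda>0 x) i = 0" for i
          proof -
            have e: "(\<Sum>x\<in>insert v (insert w C). \<Lambda>0 x) i = unit_vec 0 i + (unit_vec 1 i + (\<Sum>x\<in>C. \<Lambda>0 x) i)"
              using fC vC vne by (simp add: u01 del: add_bit_eq_xor)
            show ?thesis
            proof (cases i)
              case 0
              then show ?thesis unfolding e using sums(1)[OF CV] s'[of 0] by (simp add: unit_vec_def)
            next
              case (Suc j)
              then show ?thesis unfolding e using sums(2,3)[OF CV] s'[of 0] s'[of j]
                by (cases j) (simp_all add: unit_vec_def)
            qed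
          qed
          then have "(\<Sum>x\<in>insert v (insert w C). \<Lambda>0 x) = 0" by (simp add: fun_eq_iff)
          moreover have "insert v (insert w C) \<subseteq> insert v (insert w \<tau>)" using C(3) by blast
          ultimately show False using ind0[OF 2(4)] by blast
        qed
      qed
      then show ?thesis unfolding 2(1) indep_family_iff[OF finite.insertI[OF f\<tau>]] by blast
    qed
  qed
  moreover have "normal_form_at ?M z \<Lambda>'"
    unfolding normal_form_at_def rkM
  \<comment> \<open>The shift by one reflects the merging of two rows: unit column
    \<open>Suc i\<close> of \<open>\<Lambda>0\<close> becomes unit column \<open>i\<close>.\<close>
  proof (intro conjI exI[of _ "\<lambda>i. e (Suc i)"] ballI)
    show "\<Lambda>' z = unit_vec 0" by (simp add: \<Lambda>'_def)
    show "inj_on (\<lambda>i. e (Suc i)) {1..<Suc n}" using einj rkL by (auto simp: inj_on_def)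
    have mem: "e (Suc i) \<in> V - {v, w}" if "i \<in> {1..<Suc n}" for i
    proof -
      have i: "Suc i < rk L" "i \<noteq> 0" using that rkL by auto
      then have "e (Suc i) \<in> F" using e by (auto simp: bij_betw_def)
      moreover have "e (Suc i) \<noteq> v" "e (Suc i) \<noteq> w"
        using einj[OF i(1), of 0] einj[OF i(1), of 1] i rkL unfolding e01[symmetric] by simp_all
      ultimately show ?thesis using FV by blast
    qed
    then show "(\<lambda>i. e (Suc i)) ` {1..<Suc n} \<subseteq> verts ?M - {z}" unfolding vM using zV by blast
    fix i assume i: "i \<in> {1..<Suc n}"
    have u: "\<Lambda>0 (e (Suc i)) = unit_vec (Suc i)" using i rkL by (intro \<Lambda>0(3)) simp
    have "e (Suc i) \<noteq> z" using mem[OF i] zV by blast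
    then have "\<Lambda>' (e (Suc i)) = (\<lambda>k. case k of 0 \<Rightarrow> unit_vec (Suc i) 0 | Suc k \<Rightarrow> unit_vec (Suc i) (Suc (Suc k)))"
      using mem[OF i] unfolding \<Lambda>'_def u by simp
    also have "\<dots> = unit_vec i" using i by (auto simp: unit_vec_def fun_eq_iff split: nat.split)
    finally show "\<Lambda>' (e (Suc i)) = unit_vec i" .
  qed
  \<comment> \<open>Duplicating the merged row restores \<open>\<Lambda>0\<close> exactly, and this
    is D-J equivalent to \<open>\<Lambda>\<close>.\<close>
  moreover have "extension_matrix z v w \<Lambda>' = \<Lambda>0"
  proof
    fix x
    consider "x = v" | "x = w" | "x = z" | "x \<in> V - {v, w, z}" | "x \<notin> insert z V" using vV by blast
    then show "extension_matrix z v w \<Lambda>' x = \<Lambda>0 x"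
    proof cases
      case 4
      then have "\<Lambda>0 x 0 = \<Lambda>0 x (Suc 0)" using rows[of x] by simp
      then show ?thesis using 4 by (auto simp: extension_matrix_def \<Lambda>'_def fun_eq_iff split: nat.split)
    next
      case 5
      then have "\<Lambda>0 x = 0" "x \<noteq> z" "x \<noteq> v" "x \<noteq> w" "x \<notin> V" using out vV by auto
      then show ?thesis by (auto simp: extension_matrix_def \<Lambda>'_def fun_eq_iff split: nat.split)
    qed (use u01 out[OF zV] vne vz in \<open>simp_all add: extension_matrix_def\<close>)
  qed
  moreover have "DJ_equiv (Suc (rk ?M)) \<Lambda>0 \<Lambda>" using DJ_equiv_sym[OF \<Lambda>0(1)] rkM rkL by simp
  moreover have "DJ_equiv (rk ?M) \<Lambda>' \<Lambda>'" by (simp add: DJ_equiv_def)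
  ultimately show ?thesis unfolding canonical_extension_def by metis
qed

text \<open>The link of \<open>j\<close> is a PL sphere by \<open>PL_homeomorphic_link\<close>, and
  twins make \<open>K\<close> its wedge at \<open>i\<close>. As \<open>j\<close> is no vertex of its
  own link, it can serve as one of the new vertices; \<open>i\<close> is a vertex of the link, so it
  is renamed to a fresh \<open>z\<close> to serve as the other.\<close>

lemma seed_no_twins:
  fixes K :: "nat cpx"
  assumes "seed K" "twins K i j" "{i, j} \<in> K"
  shows False
proof -
  obtain d :: nat where K: "simplicial_cpx K" and hom: "PL_homeomorphic K (simplex_boundary {..d})"
    using assms(1) by (auto simp: seed_def PL_sphere_def)
  have ne: "i \<noteq> j" using assms(2) by (simp add: twins_def)
  have iK: "i \<in> verts K" "j \<in> verts K" using assms(3) by blast+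
  let ?M = "link K j"
  have M: "PL_sphere ?M"
    using simplicial_cpx_link[OF K iK(2)] PL_homeomorphic_link(2)[OF K hom iK(2)] by (auto simp: PL_sphere_def)
  have "{i} \<in> ?M" using assms(3) ne by (simp add: link_def insert_commute)
  then have iM: "i \<in> verts ?M" by blast
  obtain z where z: "z \<notin> verts K"
    using ex_new_if_finite[OF infinite_UNIV_nat simplicial_cpx_finite_verts[OF K]] by blast
  have "verts ?M \<subseteq> verts K" "j \<notin> verts ?M" unfolding link_def by blast+
  then have np: "new_pair ?M j z" using z iK unfolding new_pair_def by blast
  let ?A = "{\<tau>. i \<notin> \<tau> \<and> j \<notin> \<tau> \<and> insert i (insert j \<tau>) \<in> K}" and ?B = "{\<tau> \<in> K. i \<notin> \<tau> \<and> j \<notin> \<tau>}"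
  have lk: "link ?M i = ?A" unfolding link_def using ne by (auto simp: insert_commute)
  have del: "deletion ?M i = ?B"
  proof -
    have "insert j \<tau> \<in> K \<longleftrightarrow> \<tau> \<in> K" if "i \<notin> \<tau>" "j \<notin> \<tau>" for \<tau>
      using assms(2) that simplicial_cpx_subset[OF K, of "insert j \<tau>" \<tau>] unfolding twins_def by blast
    then show ?thesis unfolding deletion_def link_def by blast
  qed
  define \<phi> where "\<phi> = (\<lambda>x. if x = i then z else x)"
  have inj: "inj_on \<phi> (verts K)" using z unfolding \<phi>_def inj_on_def by (metis (full_types))
  have \<phi>_id: "\<phi> ` \<tau> = \<tau>" if "i \<notin> \<tau>" for \<tau> using that unfolding \<phi>_def by (auto simp: image_iff)
  have im: "\<phi> ` {i, j} = {j, z}" using ne by (auto simp: \<phi>_def)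
  have injij: "inj_on \<phi> {i, j}" by (rule inj_on_subset[OF inj]) (use iK in simp)
  have P1: "(\<lambda>\<rho>. \<phi> ` \<rho>) ` Pow {i, j} = Pow {j, z}"
    using image_Pow_surj[OF im] by simp
  have P2: "(\<lambda>\<rho>. \<phi> ` \<rho>) ` simplex_boundary {i, j} = simplex_boundary {j, z}"
  proof -
    have "simplex_boundary W = Pow W - {W}" for W :: "nat set" unfolding simplex_boundary_def by blast
    moreover have "(\<lambda>\<rho>. \<phi> ` \<rho>) ` (Pow {i, j} - {{i, j}}) = Pow {j, z} - {{j, z}}"
      using inj_on_image_set_diff[OF inj_on_image_Pow[OF injij], of "Pow {i, j}" "{{i, j}}"] P1 im by simp
    ultimately show ?thesis by simp
  qed
  have jn: "(\<lambda>\<sigma>. \<phi> ` \<sigma>) ` join P Q = join ((\<lambda>\<rho>. \<phi> ` \<rho>) ` P) Q" if "\<And>\<tau>. \<tau> \<in> Q \<Longrightarrow> i \<notin> \<tau>" for P Q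
  proof (intro subset_antisym subsetI)
    fix s assume "s \<in> (\<lambda>\<sigma>. \<phi> ` \<sigma>) ` join P Q"
    then obtain \<rho> \<tau> where "\<rho> \<in> P" "\<tau> \<in> Q" "s = \<phi> ` (\<rho> \<union> \<tau>)" unfolding join_def by blast
    then have "s = \<phi> ` \<rho> \<union> \<tau>" using \<phi>_id[OF that] by (simp add: image_Un)
    then show "s \<in> join ((\<lambda>\<rho>. \<phi> ` \<rho>) ` P) Q" unfolding join_def using \<open>\<rho> \<in> P\<close> \<open>\<tau> \<in> Q\<close> by blast
  next
    fix s assume "s \<in> join ((\<lambda>\<rho>. \<phi> ` \<rho>) ` P) Q"
    then obtain \<rho> \<tau> where "\<rho> \<in> P" "\<tau> \<in> Q" "s = \<phi> ` \<rho> \<union> \<tau>" unfolding join_def by blast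
    then have "s = \<phi> ` (\<rho> \<union> \<tau>)" using \<phi>_id[OF that] by (simp add: image_Un)
    then show "s \<in> (\<lambda>\<sigma>. \<phi> ` \<sigma>) ` join P Q" unfolding join_def using \<open>\<rho> \<in> P\<close> \<open>\<tau> \<in> Q\<close> by blast
  qed
  have "(\<lambda>\<sigma>. \<phi> ` \<sigma>) ` K = (\<lambda>\<sigma>. \<phi> ` \<sigma>) ` (join (Pow {i, j}) ?A \<union> join (simplex_boundary {i, j}) ?B)"
    using twins_decomposition[OF K assms(2)] by simp
  also have "\<dots> = wedge ?M i j z"
    unfolding wedge_def lk del image_Un
    by (subst (1 2) jn) (auto simp: P1 P2)
  finally have w: "wedge ?M i j z = (\<lambda>\<sigma>. \<phi> ` \<sigma>) ` K" by simp
  have "verts (wedge ?M i j z) = \<phi> ` verts K" unfolding w by blast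
  then have "isomorphic K (wedge ?M i j z)"
    unfolding isomorphic_def using w inj by (intro exI[of _ \<phi>]) (simp add: bij_betw_def)
  then show False using assms(1) M iM np unfolding seed_def by blast
qed

text \<open>All copies of a face of \<open>K\<close> together form a face of \<open>L\<close>.
  Adding \<open>v\<close> to it fills \<open>\<pi> v\<close>, because \<open>v\<close> is the only
  copy; so being twins descends to \<open>K\<close>.\<close>

lemma singleton_fibres_twins:
  assumes K: "simplicial_cpx K" and f: "fibred K L \<pi>" and tw: "twins L v w" and vw: "{v, w} \<in> L"
    and v: "\<And>x. x \<in> verts L \<Longrightarrow> \<pi> x = \<pi> v \<Longrightarrow> x = v" and w: "\<And>x. x \<in> verts L \<Longrightarrow> \<pi> x = \<pi> w \<Longrightarrow> x = w"
  shows "twins K (\<pi> v) (\<pi> w)" "{\<pi> v, \<pi> w} \<in> K"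
proof -
  define V where "V = verts L"
  note Lf = fibredD(3)[OF f, folded V_def] and im = fibredD(2)[OF f, folded V_def]
  note v' = v[folded V_def] and w' = w[folded V_def]
  have vV: "v \<in> V" "w \<in> V" "v \<noteq> w" using vw tw unfolding V_def twins_def by blast+
  have ne: "\<pi> v \<noteq> \<pi> w" using v'[of w] vV by auto
  have vK: "\<pi> v \<in> verts K" "\<pi> w \<in> verts K" using vV unfolding im[symmetric] by blast+
  have "filled K V \<pi> {v, w} \<in> K" using Lf vw by blast
  moreover have "{\<pi> v, \<pi> w} \<subseteq> filled K V \<pi> {v, w}" using vK v' w' unfolding filled_def by blast
  ultimately show "{\<pi> v, \<pi> w} \<in> K" by (rule simplicial_cpx_subset[OF K])
  have "insert (\<pi> v) \<rho> \<in> K \<and> insert (\<pi> w) \<rho> \<in> K" if \<rho>: "\<rho> \<in> K" "\<pi> v \<notin> \<rho>" "\<pi> w \<notin> \<rho>" for \<rho>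
  proof -
    define \<sigma> where "\<sigma> = {x \<in> V. \<pi> x \<in> \<rho>}"
    have "filled K V \<pi> \<sigma> \<subseteq> \<rho>" unfolding filled_def \<sigma>_def im[symmetric] by blast
    then have "filled K V \<pi> \<sigma> \<in> K" by (rule simplicial_cpx_subset[OF K \<rho>(1)])
    then have "\<sigma> \<in> L" unfolding Lf by (auto simp: \<sigma>_def)
    then have "insert v \<sigma> \<in> L" "insert w \<sigma> \<in> L" using tw \<rho>(2,3) by (simp_all add: twins_def \<sigma>_def)
    then have "filled K V \<pi> (insert v \<sigma>) \<in> K" "filled K V \<pi> (insert w \<sigma>) \<in> K" using Lf by blast+
    moreover have "\<rho> \<subseteq> verts K" using \<rho>(1) by blast
    then have "insert (\<pi> v) \<rho> \<subseteq> filled K V \<pi> (insert v \<sigma>)" "insert (\<pi> w) \<rho> \<subseteq> filled K V \<pi> (insert w \<sigma>)"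
      using vK v' w' unfolding filled_def \<sigma>_def by blast+
    ultimately show ?thesis using simplicial_cpx_subset[OF K] by blast
  qed
  then show "twins K (\<pi> v) (\<pi> w)" using ne by (simp add: twins_def)
qed

section \<open>Induction on the number of vertices\<close>

theorem proposition4p10:
  fixes K :: "nat cpx" and m :: nat
    and P :: "(nat \<times> nat) cpx \<times> (nat \<times> nat \<Rightarrow> nat \<Rightarrow> bit) \<Rightarrow> bool"
  assumes "seed K" and "colorable K" and "verts K = {1..m}"
    and basis_step: "\<And>J L \<Lambda> \<mu>. \<lbrakk>\<forall>i\<in>{1..m}. 1 \<le> J i; isomorphic (K_of K J) L; char_map L \<Lambda>;
           dual_of L \<Lambda> \<mu>; quasi_injective L \<mu>\<rbrakk> \<Longrightarrow> P (L, \<Lambda>)"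
    and inductive_step: "\<And>L \<Lambda> v v1 v2 \<mu>. \<lbrakk>(L, \<Lambda>) \<in> X_of K; P (L, \<Lambda>); v \<in> verts L;
           new_pair L v1 v2; canonical_extension L v v1 v2 \<Lambda> \<mu>\<rbrakk> \<Longrightarrow> P (wedge L v v1 v2, \<mu>)"
  shows "\<forall>(L, \<Lambda>) \<in> X_of K. P (L, \<Lambda>)"
proof -
  obtain d :: nat where K: "simplicial_cpx K" and hom: "PL_homeomorphic K (simplex_boundary {..d})"
    using assms(1) by (auto simp: seed_def PL_sphere_def)
  have pK: "pure d K" "ridges_interior d K" using PL_sphere_pure[OF K hom] by auto
  have X_iff: "(L, \<Lambda>) \<in> X_of K \<longleftrightarrow> (\<exists>\<pi>. fibred K L \<pi>) \<and> char_map L \<Lambda>" for L \<Lambda>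
    unfolding X_of_def isomorphic_K_of_iff_fibred[OF K, symmetric] by simp
  have "P (L, \<Lambda>)" if "(L, \<Lambda>) \<in> X_of K" for L \<Lambda>
    using that
  proof (induction "card (verts L)" arbitrary: L \<Lambda> rule: less_induct)
    case less
    obtain \<pi> where f: "fibred K L \<pi>" and \<Lambda>: "char_map L \<Lambda>" using less.prems X_iff by blast
    note L = fibred_simplicial[OF K f]
    have pL: "pure (rk L) L" "ridges_interior (rk L) L"
      using fibred_pure[OF K pK(1) f] fibred_ridges_interior[OF K pK f] pure_rk[OF L] by auto
    obtain F where F: "F \<in> L" "card F = rk L" using pL(1) simplicial_cpx_empty[OF L] unfolding pure_def by blast
    obtain \<mu> where \<mu>: "dual_of L \<Lambda> \<mu>" using dual_of_exists[OF L F \<Lambda>] by blast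
    show ?case
    proof (cases "quasi_injective L \<mu>")
      case True
      from iffD2[OF isomorphic_K_of_iff_fibred[OF K] exI, OF f]
      obtain J where "\<forall>i\<in>verts K. 1 \<le> J i" "isomorphic (K_of K J) L" by (elim exE conjE)
      then show ?thesis unfolding assms(3) by (rule basis_step[OF _ _ \<Lambda> \<mu> True])
    next
      case False
      then obtain a b where ab: "a \<in> verts L" "b \<in> verts L" "a \<noteq> b" "\<mu> a = \<mu> b" "\<not> suspended_pair L a b"
        unfolding quasi_injective_def by blast
      have kab: "x a = x b" if "x \<in> char_kernel L \<Lambda>" for x by (rule dual_of_equal_rows[OF \<mu> ab(4) that])
      have tab: "twins L a b" by (rule kernel_twins[OF L pL \<Lambda> ab(1,3) kab])
      have eab: "{a, b} \<in> L" using twins_suspended_pair[OF L tab] ab(5) by blast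
      \<comment> \<open>The pair is ordered so that \<open>v\<close>, the copy given up by the
        merging, is not the only copy of its vertex. Otherwise both fibres would be singletons, and
        \<open>K\<close> itself would have twins spanning an edge.\<close>
      have "\<exists>v w x. {v, w} = {a, b} \<and> x \<in> verts L \<and> x \<noteq> v \<and> \<pi> x = \<pi> v"
      proof (rule ccontr)
        assume no: "\<nexists>v w x. {v, w} = {a, b} \<and> x \<in> verts L \<and> x \<noteq> v \<and> \<pi> x = \<pi> v"
        have 1: "x = a" if "x \<in> verts L" "\<pi> x = \<pi> a" for x using no that by blast
        have 2: "x = b" if "x \<in> verts L" "\<pi> x = \<pi> b" for x using no that by (metis insert_commute)
        have "twins K (\<pi> a) (\<pi> b)"
          by (rule singleton_fibres_twins(1)[OF K f tab eab]) (rule 1, assumption+, rule 2, assumption+)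
        moreover have "{\<pi> a, \<pi> b} \<in> K"
          by (rule singleton_fibres_twins(2)[OF K f tab eab]) (rule 1, assumption+, rule 2, assumption+)
        ultimately show False by (rule seed_no_twins[OF assms(1)])
      qed
      then obtain v w x where vw: "{v, w} = {a, b}" and x: "x \<in> verts L" "x \<noteq> v" "\<pi> x = \<pi> v" by blast
      have tw: "twins L v w" using vw tab twins_sym[OF tab] by (auto simp: doubleton_eq_iff)
      have ker: "y v = y w" if "y \<in> char_kernel L \<Lambda>" for y using vw kab[OF that] by (auto simp: doubleton_eq_iff)
      have evw: "{v, w} \<in> L" using eab vw by simp
      have inf: "infinite (UNIV :: (nat \<times> nat) set)" by (simp add: finite_prod)
      obtain z where z: "z \<notin> verts L"
        using ex_new_if_finite[OF inf simplicial_cpx_finite_verts[OF L]] by blast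
      let ?M = "merge_pair L v w z"
      obtain \<Lambda>' where \<Lambda>': "char_map ?M \<Lambda>'" "canonical_extension ?M z v w \<Lambda>' \<Lambda>"
        using canonical_extension_merge_pair[OF L pL(1) \<Lambda> tw z evw] ker by metis
      have M: "(?M, \<Lambda>') \<in> X_of K" unfolding X_iff using fibred_merge_pair[OF K f tw z evw x] \<Lambda>'(1) by blast
      have vM: "verts ?M = insert z (verts L - {v, w})" by (rule verts_merge_pair[OF L z evw])
      have ne: "v \<noteq> w" using tw by (simp add: twins_def)
      have vL: "{v, w} \<subseteq> verts L" using evw by blast
      have fL: "finite (verts L)" by (rule simplicial_cpx_finite_verts[OF L])
      have "card (verts ?M) < card (verts L)"
      proof -
        have "card (verts L - {v, w}) = card (verts L) - 2" using vL fL ne by (simp add: card_Diff_subset)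
        moreover have "2 \<le> card (verts L)" using card_mono[OF fL vL] ne by simp
        moreover have "card (verts ?M) = Suc (card (verts L - {v, w}))" unfolding vM using z fL by simp
        ultimately show ?thesis by linarith
      qed
      then have "P (?M, \<Lambda>')" using less.hyps M by blast
      moreover have "z \<in> verts ?M" unfolding vM by simp
      moreover have "new_pair ?M v w" unfolding new_pair_def vM using ne z vL by blast
      ultimately have "P (wedge ?M z v w, \<Lambda>)" using inductive_step[OF M] \<Lambda>'(2) by blast
      then show ?thesis unfolding wedge_merge_pair[OF L tw z] .
    qed
  qed
  then show ?thesis by blast
qed

end
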